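(* Let $1\le\gamma<b<\infty$ and put $\sigma(t)=(b/t)'$ for $\gamma\le t<b$. Let $\gamma<p<b$, let $w\in A_{p/\gamma}\cap RH_\sigma$ for some $\sigma$ with $\sigma(p)<\sigma<\infty$, and let $r\in[-n/p,\,-n\sigma'/b]$. Then there exist $q_0\in(\gamma,p)$ and, for each $q\in[\gamma,q_0]$, some $s_0(q)>\sigma(q)$, such that for $\sigma(q)<s\le s_0(q)$, each cube $Q$ and each nonnegative $h\in L_{(p/q)',w}(Q)$ with norm $1$, the continuous embedding $$L^r_p(w,\mathbb R^n)\hookrightarrow L_{q,\,M(h^sw^s\chi_Q)^{1/s}}(\mathbb R^n)$$ holds with constant independent of $h$ and depending on $Q$ as $w(Q)^{1/p+r/n}$; that is, $\|f|L_{q,M(h^sw^s\chi_Q)^{1/s}}(\mathbb R^n)\|\le C\,w(Q)^{1/p+r/n}\|f|L^r_p(w,\mathbb R^n)\|$ with $C$ independent of $h$, $Q$ and $f$. Furthermore, with the additional assumption $r\in[-n/p,\,-n/(p\sigma)-n/b]$, it also holds that $$L^r_p(\lambda,w,\mathbb R^n)\hookrightarrow L_{q,\,M(h^sw^s\chi_Q)^{1/s}}(\mathbb R^n)$$ with constant independent of $h$ and depending on $Q$ as $|Q|^{1/p+r/n}$ (in the same sense). As a consequence, under the same respective conditions on $p$, $r$ and $w$, for each $q\in[\gamma,q_0]$ there exists $0<\alpha<n/\sigma(q)$ such that $$L^r_p(w,\mathbb R^n)\hookrightarrow L_{q,(1+|x|)^{-\alpha}}(\mathbb R^n),\qquad L^r_p(\lambda,w,\mathbb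 R^n)\hookrightarrow L_{q,(1+|x|)^{-\alpha}}(\mathbb R^n).$$
   Context: Cubes in $\mathbb R^n$ have sides parallel to the axes. A weight is a nonnegative locally integrable function; $w(E)=\int_E w$, $|E|$ is Lebesgue measure, $\chi_E$ the characteristic function. $p'$ is the conjugate exponent: $1/p+1/p'=1$. For $0<p<\infty$, $\|f|L_{p,w}(E)\|=(\int_E|f|^pw)^{1/p}$. $M$ is the Hardy–Littlewood maximal operator, $Mf(x)=\sup_{Q\ni x}|Q|^{-1}\int_Q|f|$. Muckenhoupt classes: for $1<p<\infty$ and $w>0$ a.e. locally integrable, $w\in A_p$ iff $[w]_{A_p}=\sup_Q\frac{w(Q)}{|Q|}\big(\frac{w^{1-p'}(Q)}{|Q|}\big)^{p-1}<\infty$; $w\in A_1$ iff there is $c$ with $w(Q)/|Q|\le c\,w(x)$ for a.e. $x\in Q$ and every cube $Q$. Reverse Hölder class: for $1<\sigma<\infty$, $w\in RH_\sigma$ iff there is $c$ with $\big(|Q|^{-1}\int_Q w^\sigma\big)^{1/\sigma}\le c\,|Q|^{-1}\int_Q w$ for all cubes $Q$. Morrey spaces: for $0<p<\infty$, $-n/p\le r<0$ and a weight $w$, the spaces $L^r_p(w,\mathbb R^n)$ and $L^r_p(\lambda,w,\mathbb R^n)$ consist of the (classes of) measurable complex functions $f$ on $\mathbb R^n$ for which, respectively, the following quasinorms are finite (suprema over all cubes; here $\lambda$ is just a label for the second type of space): $$\|f|L^r_p(w,\mathbb R^n)\|=\sup_Q w(Q)^{-(1/p+r/n)}\|f|L_{p,w}(Q)\|,\qquad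 \|f|L^r_p(\lambda,w,\mathbb R^n)\|=\sup_Q |Q|^{-(1/p+r/n)}\|f|L_{p,w}(Q)\|.$$ $X\hookrightarrow Y$ means $X\subset Y$ with $\|f|Y\|\le C\|f|X\|$. *)

theory Defs
  imports "HOL-Analysis.Analysis"
begin

text \<open>Real powers on \<open>[0, \<infinity>]\<close>, with \<open>x\<^sup>0 = 1\<close>, \<open>0\<^sup>a = \<infinity>\<close> and \<open>\<infinity>\<^sup>a = 0\<close> for \<open>a < 0\<close>.\<close>

definition epowr :: "ennreal \<Rightarrow> real \<Rightarrow> ennreal" where
  "epowr x a =
     (if a = 0 then 1
      else if x = \<infinity> then (if a < 0 then 0 else \<infinity>)
      else if x = 0 then (if a < 0 then \<infinity> else 0)
      else ennreal (enn2real x powr a))"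

text \<open>The solution \<open>p'\<close> of \<open>1/p + 1/p' = 1\<close>; meaningful for \<open>1 < p\<close>.\<close>

definition conj_exp :: "real \<Rightarrow> real" where
  "conj_exp p = p / (p - 1)"

definition is_cube :: "(real ^ 'n) set \<Rightarrow> bool" where
  "is_cube Q \<longleftrightarrow> (\<exists>a l. 0 < l \<and> Q = cbox a (\<chi> i. a $ i + l))"

definition is_weight :: "(real ^ 'n \<Rightarrow> real) \<Rightarrow> bool" where
  "is_weight w \<longleftrightarrow>
     w \<in> borel_measurable lebesgue \<and> (\<forall>x. 0 \<le> w x) \<and>
     (\<forall>K. compact K \<longrightarrow> w absolutely_integrable_on K)"

definition wmeas :: "(real ^ 'n \<Rightarrow> real) \<Rightarrow> (real ^ 'n) set \<Rightarrow> ennreal" where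
  "wmeas w E = (\<integral>\<^sup>+x\<in>E. ennreal (w x) \<partial>lebesgue)"

abbreviation vol :: "(real ^ 'n) set \<Rightarrow> ennreal" where
  "vol E \<equiv> emeasure lebesgue E"

text \<open>\<open>w\<^sup>1\<^sup>-\<^sup>p\<^sup>'\<close> uses \<open>powr\<close>, so it is \<open>0\<close> (not \<open>\<infinity>\<close>) where \<open>w\<close> vanishes; this only concerns a null set.\<close>

definition muckenhoupt_const :: "real \<Rightarrow> (real ^ 'n \<Rightarrow> real) \<Rightarrow> ennreal" where
  "muckenhoupt_const p w =
     (SUP Q\<in>Collect is_cube.
        wmeas w Q / vol Q *
        epowr (wmeas (\<lambda>x. w x powr (1 - conj_exp p)) Q / vol Q) (p - 1))"

text \<open>The class \<open>A\<^sub>p\<close> for \<open>1 < p < \<infinity>\<close>.\<close>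

definition muckenhoupt :: "real \<Rightarrow> (real ^ 'n \<Rightarrow> real) set" where
  "muckenhoupt p =
     {w. is_weight w \<and> (AE x in lebesgue. 0 < w x) \<and> muckenhoupt_const p w < \<infinity>}"

definition reverse_holder :: "real \<Rightarrow> (real ^ 'n \<Rightarrow> real) set" where
  "reverse_holder \<sigma> =
     {w. is_weight w \<and>
         (\<exists>c::real. \<forall>Q. is_cube Q \<longrightarrow>
            epowr (wmeas (\<lambda>x. w x powr \<sigma>) Q / vol Q) (1 / \<sigma>) \<le> ennreal c * (wmeas w Q / vol Q))}"

definition maximal :: "(real ^ 'n \<Rightarrow> real) \<Rightarrow> real ^ 'n \<Rightarrow> ennreal" where
  "maximal f x =
     (SUP Q\<in>{Q. is_cube Q \<and> x \<in> Q}. (\<integral>\<^sup>+y\<in>Q. ennreal \<bar>f y\<bar> \<partial>lebesgue) / vol Q)"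

text \<open>The weight \<open>v\<close> is \<open>[0, \<infinity>]\<close>-valued here so that it can be a power of a maximal function.\<close>

definition wLp_norm ::
  "real \<Rightarrow> (real ^ 'n \<Rightarrow> ennreal) \<Rightarrow> (real ^ 'n) set \<Rightarrow> (real ^ 'n \<Rightarrow> 'b::real_normed_vector) \<Rightarrow> ennreal"
  where
  "wLp_norm p v E f = epowr (\<integral>\<^sup>+x\<in>E. ennreal (norm (f x) powr p) * v x \<partial>lebesgue) (1 / p)"

definition morrey_norm ::
  "real \<Rightarrow> real \<Rightarrow> (real ^ 'n \<Rightarrow> real) \<Rightarrow> (real ^ 'n \<Rightarrow> complex) \<Rightarrow> ennreal" where
  "morrey_norm p r w f =
     (SUP Q\<in>Collect is_cube.
        epowr (wmeas w Q) (- (1 / p + r / real CARD('n))) * wLp_norm p (\<lambda>x. ennreal (w x)) Q f)"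

definition morrey_norm_lambda ::
  "real \<Rightarrow> real \<Rightarrow> (real ^ 'n \<Rightarrow> real) \<Rightarrow> (real ^ 'n \<Rightarrow> complex) \<Rightarrow> ennreal" where
  "morrey_norm_lambda p r w f =
     (SUP Q\<in>Collect is_cube.
        epowr (vol Q) (- (1 / p + r / real CARD('n))) * wLp_norm p (\<lambda>x. ennreal (w x)) Q f)"

text \<open>The space of measurable functions with finite quasinorm \<open>N\<close>. Almost everywhere equal functions
  are not identified; all the quasinorms above are invariant under changes on null sets.\<close>

definition fun_space :: "((real ^ 'n \<Rightarrow> complex) \<Rightarrow> ennreal) \<Rightarrow> (real ^ 'n \<Rightarrow> complex) set" where
  "fun_space N = {f \<in> borel_measurable lebesgue. N f < \<infinity>}"

text \<open>Continuous embedding of the space with quasinorm \<open>N\<^sub>1\<close> into the one with quasinorm \<open>N\<^sub>2\<close>,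
  with embedding constant \<open>C\<close>.\<close>

definition embeds_with ::
  "ennreal \<Rightarrow> ((real ^ 'n \<Rightarrow> complex) \<Rightarrow> ennreal) \<Rightarrow> ((real ^ 'n \<Rightarrow> complex) \<Rightarrow> ennreal) \<Rightarrow> bool" where
  "embeds_with C N\<^sub>1 N\<^sub>2 \<longleftrightarrow>
     fun_space N\<^sub>1 \<subseteq> fun_space N\<^sub>2 \<and> (\<forall>f\<in>fun_space N\<^sub>1. N\<^sub>2 f \<le> C * N\<^sub>1 f)"

definition embeds ::
  "((real ^ 'n \<Rightarrow> complex) \<Rightarrow> ennreal) \<Rightarrow> ((real ^ 'n \<Rightarrow> complex) \<Rightarrow> ennreal) \<Rightarrow> bool" where
  "embeds N\<^sub>1 N\<^sub>2 \<longleftrightarrow> (\<exists>C::real. embeds_with (ennreal C) N\<^sub>1 N\<^sub>2)"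

text \<open>Nonnegative functions of norm \<open>1\<close> in \<open>L\<^bsub>t,w\<^esub>(Q)\<close>; the values of \<open>h\<close> outside \<open>Q\<close> are irrelevant.\<close>

definition unit_nonneg_Lp ::
  "real \<Rightarrow> (real ^ 'n \<Rightarrow> real) \<Rightarrow> (real ^ 'n) set \<Rightarrow> (real ^ 'n \<Rightarrow> real) set" where
  "unit_nonneg_Lp t w Q =
     {h. h \<in> borel_measurable (lebesgue_on Q) \<and> (\<forall>x\<in>Q. 0 \<le> h x) \<and>
         wLp_norm t (\<lambda>x. ennreal (w x)) Q h = 1}"

text \<open>The weight \<open>M(h\<^sup>s w\<^sup>s \<chi>\<^sub>Q)\<^sup>1\<^sup>/\<^sup>s\<close>.\<close>

definition max_weight ::
  "real \<Rightarrow> (real ^ 'n \<Rightarrow> real) \<Rightarrow> (real ^ 'n \<Rightarrow> real) \<Rightarrow> (real ^ 'n) set \<Rightarrow> real ^ 'n \<Rightarrow> ennreal" where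
  "max_weight s h w Q x =
     epowr (maximal (\<lambda>y. h y powr s * w y powr s * indicator Q y) x) (1 / s)"

end

theory Submission
  imports Defs
begin

text \<open>
  For \<open>w\<close> as in the theorem, the \<open>A\<^sub>p\<close> and reverse Hoelder conditions both say that the average of
  \<open>w\<^sup>\<alpha>\<close> over each cube is at most a constant times the \<open>\<alpha>\<close>-th power of the average of \<open>w\<close>, with
  \<open>\<alpha> = -\<gamma>/(p-\<gamma>)\<close> and \<open>\<alpha> = \<sigma>\<close>. Since the two exponents have opposite signs, a subset of
  at most half the measure of a cube carries at most a fixed fraction \<open>\<beta> < 1\<close> of its \<open>w\<^sup>\<alpha>\<close>-mass, and stopping at
  geometrically growing heights gives the same bound for slightly larger \<open>\<bar>\<alpha>\<bar>\<close>. This yields \<open>q\<^sub>0 > \<gamma>\<close>, and the strict inequalities that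
  make \<open>s\<^sub>0 > \<sigma>(q)\<close> possible.

  Let \<open>T = (p/q)'\<close> and split \<open>\<real>\<^sup>n\<close> into dilates \<open>Q\<^sub>k\<close> of \<open>Q\<close>. Averages over cubes at least as large as
  \<open>Q\<close> are controlled on \<open>Q\<^sub>k\<close> by \<open>2\<^bsup>-kn\<^esup>\<close> times the average of \<open>h\<^sup>sw\<^sup>s\<close> over \<open>Q\<close>; with Hoelder's inequality
  they contribute a geometric series. Averages over smaller cubes are dominated, by the one-third trick,
  by \<open>2\<^sup>n\<close> dyadic maximal functions, which are bounded on \<open>L\<^bsub>T/s\<^esub>\<close> with weight \<open>w\<^bsup>1-T\<^esup>\<close>.
  The weight \<open>(1+\<bar>x\<bar>)\<^bsup>-\<alpha>\<^esup>\<close> lies below a multiple of \<open>M(h\<^sup>sw\<^sup>s\<chi>\<^sub>Q)\<^bsup>1/s\<^esup>\<close> for a constant \<open>h\<close>.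
\<close>


text \<open>Duality with T = (p/q)' brings in the weight w^(1-T), where 1-T = -q/(p-q). So q is
  admissible as long as the improved Muckenhoupt exponent reaches q/(p-q), and \<open>q0\<close> is
  the point where it stops. As for s, every requirement is an upper bound for 1 - 1/s, while s >
  \<sigma>(q) means 1 - 1/s > q/b. The bound for the dyadic maximal functions gets its room from
  \<sigma>(p) < \<sigma>. The series over the dilates has no such room at the right end of either
  range of r: with \<sigma> itself it would converge only for 1 - 1/s < q/b. The larger exponent
  \<open>\<sigma>1\<close> opens the gap there. The two Morrey scales differ only in how they
  measure a cube, so the central estimate is proved once for an abstract size \<mu> of cubes, which
  is later the w-mass or the volume. For the w-mass a part of the mass ratio cancels the growth of
  \<mu>; for the volume nothing cancels, which is why the second embedding asks for a different
  range of r.\<close>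

section \<open>Hoelder's inequality for nonnegative integrals\<close>

lemma young_powr:
  fixes a b A B t :: real
  assumes "0 \<le> a" "0 \<le> b" "0 < A" "0 < B" "0 < t" "t < 1"
  shows "a powr t * b powr (1 - t) \<le> A powr t * B powr (1 - t) * (t * (a / A) + (1 - t) * (b / B))"
proof (cases "a = 0 \<or> b = 0")
  case False
  have "(a / A) powr t * (b / B) powr (1 - t) \<le> t * (a / A) + (1 - t) * (b / B)"
    using assms False by (intro Youngs_inequality_0) auto
  then have "A powr t * B powr (1 - t) * ((a / A) powr t * (b / B) powr (1 - t))
     \<le> A powr t * B powr (1 - t) * (t * (a / A) + (1 - t) * (b / B))"
    using assms by (intro mult_left_mono) auto
  also have "A powr t * B powr (1 - t) * ((a / A) powr t * (b / B) powr (1 - t)) = a powr t * b powr (1 - t)"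
    using assms by (simp add: powr_divide)
  finally show ?thesis .
qed (use assms in auto)

text \<open>Upper bounds A and B stand in place of the two integrals, because later estimates know
  only such bounds. Scaling Young's inequality by A and B makes its linear right side integrate to
  the product bound.\<close>

lemma nn_integral_holder:
  fixes F G :: "'a \<Rightarrow> real"
  assumes [measurable]: "F \<in> borel_measurable M" "G \<in> borel_measurable M"
    and F: "\<And>x. 0 \<le> F x" and G: "\<And>x. 0 \<le> G x"
    and t: "0 < t" "t < 1"
    and A: "(\<integral>\<^sup>+x. ennreal (F x) \<partial>M) \<le> ennreal A" "0 \<le> A"
    and B: "(\<integral>\<^sup>+x. ennreal (G x) \<partial>M) \<le> ennreal B" "0 \<le> B"
  shows "(\<integral>\<^sup>+x. ennreal (F x powr t * G x powr (1 - t)) \<partial>M) \<le> ennreal (A powr t * B powr (1 - t))"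
\<comment> \<open>Young's inequality divides by A and B. If one of them is 0, one factor vanishes
  almost everywhere, and so does the product.\<close>
proof (cases "A = 0 \<or> B = 0")
  case True
  have "AE x in M. F x = 0 \<or> G x = 0"
  proof (cases "A = 0")
    case True
    then have "(\<integral>\<^sup>+x. ennreal (F x) \<partial>M) = 0" using A by simp
    then have "AE x in M. ennreal (F x) = 0" by (subst (asm) nn_integral_0_iff_AE) auto
    then show ?thesis by eventually_elim (use F in \<open>auto simp: ennreal_eq_0_iff intro: antisym\<close>)
  next
    case False
    then have "(\<integral>\<^sup>+x. ennreal (G x) \<partial>M) = 0" using B True by simp
    then have "AE x in M. ennreal (G x) = 0" by (subst (asm) nn_integral_0_iff_AE) auto
    then show ?thesis by eventually_elim (use G in \<open>auto simp: ennreal_eq_0_iff intro: antisym\<close>)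
  qed
  then have "(\<integral>\<^sup>+x. ennreal (F x powr t * G x powr (1 - t)) \<partial>M) = (\<integral>\<^sup>+x. 0 \<partial>M)"
    by (intro nn_integral_cong_AE) (auto elim!: eventually_mono)
  then show ?thesis by simp
next
  case False
  then have pos: "0 < A" "0 < B" using A B by auto
  define K where "K = A powr t * B powr (1 - t)"
  have lin: "ennreal (K * t / A) * ennreal a + ennreal (K * (1 - t) / B) * ennreal b
      = ennreal (K * t / A * a + K * (1 - t) / B * b)" if "0 \<le> a" "0 \<le> b" for a b
  proof -
    have nn: "0 \<le> K * t / A" "0 \<le> K * (1 - t) / B" using pos t by (auto simp: K_def)
    show ?thesis
      by (simp only: ennreal_mult[OF nn(1) that(1)] ennreal_mult[OF nn(2) that(2)] ennreal_plus mult_nonneg_nonneg nn that)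
  qed
  have "(\<integral>\<^sup>+x. ennreal (F x powr t * G x powr (1 - t)) \<partial>M)
      \<le> (\<integral>\<^sup>+x. ennreal (K * t / A) * ennreal (F x) + ennreal (K * (1 - t) / B) * ennreal (G x) \<partial>M)"
  proof (intro nn_integral_mono)
    fix x
    have "F x powr t * G x powr (1 - t) \<le> K * (t * (F x / A) + (1 - t) * (G x / B))"
      unfolding K_def using young_powr[OF F[of x] G[of x] pos t] by simp
    also have "\<dots> = (K * t / A) * F x + (K * (1 - t) / B) * G x"
      by (simp add: algebra_simps)
    finally show "ennreal (F x powr t * G x powr (1 - t))
        \<le> ennreal (K * t / A) * ennreal (F x) + ennreal (K * (1 - t) / B) * ennreal (G x)"
      using lin[OF F[of x] G[of x]] by (simp only: ennreal_leI)
  qed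
  also have "\<dots> = ennreal (K * t / A) * (\<integral>\<^sup>+x. ennreal (F x) \<partial>M) + ennreal (K * (1 - t) / B) * (\<integral>\<^sup>+x. ennreal (G x) \<partial>M)"
    by (simp add: nn_integral_add nn_integral_cmult)
  also have "\<dots> \<le> ennreal (K * t / A) * ennreal A + ennreal (K * (1 - t) / B) * ennreal B"
    using A B by (intro add_mono mult_left_mono) auto
  also have "\<dots> = ennreal (K * t / A * A + K * (1 - t) / B * B)"
    using A B by (intro lin)
  also have "K * t / A * A + K * (1 - t) / B * B = K" using pos by (simp add: field_simps)
  finally show ?thesis by (simp add: K_def)
qed

lemma set_nn_integral_holder:
  fixes F G :: "'a \<Rightarrow> real"
  assumes [measurable]: "F \<in> borel_measurable M" "G \<in> borel_measurable M" "E \<in> sets M"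
    and F: "\<And>x. 0 \<le> F x" and G: "\<And>x. 0 \<le> G x"
    and t: "0 < t" "t < 1"
    and A: "(\<integral>\<^sup>+x\<in>E. ennreal (F x) \<partial>M) \<le> ennreal A" "0 \<le> A"
    and B: "(\<integral>\<^sup>+x\<in>E. ennreal (G x) \<partial>M) \<le> ennreal B" "0 \<le> B"
  shows "(\<integral>\<^sup>+x\<in>E. ennreal (F x powr t * G x powr (1 - t)) \<partial>M) \<le> ennreal (A powr t * B powr (1 - t))"
proof -
  have "(\<integral>\<^sup>+x. ennreal ((F x * indicator E x) powr t * (G x * indicator E x) powr (1 - t)) \<partial>M)
      \<le> ennreal (A powr t * B powr (1 - t))"
    using F G t A B by (intro nn_integral_holder) (auto simp: ennreal_mult ennreal_indicator)
  moreover have "ennreal ((F x * indicator E x) powr t * (G x * indicator E x) powr (1 - t))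
      = ennreal (F x powr t * G x powr (1 - t)) * indicator E x" for x
    by (auto split: split_indicator)
  ultimately show ?thesis by simp
qed

section \<open>Nested partitions\<close>

text \<open>\<open>D k x\<close> is the cell of level k around x, so a sequence of partitions
  becomes a map from points to cells. The measure is left open because the same cells are used with
  Lebesgue measure and with the density w^(1-T).\<close>

locale nested_partition =
  fixes M :: "'a measure" and D :: "nat \<Rightarrow> 'a \<Rightarrow> 'a set"
  assumes cell_self: "x \<in> D k x"
    and cell_eq: "y \<in> D k x \<Longrightarrow> D k y = D k x"
    and cell_nested: "D (Suc k) x \<subseteq> D k x"
    and cell_sets [measurable]: "D k x \<in> sets M"
    and countable_cells: "countable (range (D k))"
    and space_UNIV: "space M = UNIV"
begin

lemma cell_antimono: "j \<le> k \<Longrightarrow> D k x \<subseteq> D j x"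
  by (induction rule: dec_induct) (use cell_nested in blast)+

lemma cell_eq_le: "y \<in> D k x \<Longrightarrow> j \<le> k \<Longrightarrow> D j y = D j x"
  using cell_antimono[of j k x] cell_eq by blast

text \<open>The stopping-time principle: the union of the selected cells is a disjoint union of those that
  are selected for the first time.\<close>

lemma
  fixes P :: "nat \<Rightarrow> 'a set \<Rightarrow> bool"
  assumes sets: "sets N1 = sets M" "sets N2 = sets M"
    and le: "\<And>x k. P k (D k x) \<Longrightarrow> (\<And>j. j < k \<Longrightarrow> \<not> P j (D j x)) \<Longrightarrow>
              emeasure N1 (D k x) \<le> emeasure N2 (D k x)"
  shows stopping_le: "emeasure N1 {x. \<exists>k. P k (D k x)} \<le> emeasure N2 {x. \<exists>k. P k (D k x)}"
    and stopping_sets: "{x. \<exists>k. P k (D k x)} \<in> sets M"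
proof -
  define \<C> where "\<C> = {S. \<exists>k x. S = D k x \<and> P k (D k x) \<and> (\<forall>j<k. \<not> P j (D j x))}"
  have "\<C> \<subseteq> (\<Union>k. range (D k))" by (auto simp: \<C>_def)
  then have count: "countable \<C>" by (rule countable_subset) (use countable_cells in auto)
  have U: "{x. \<exists>k. P k (D k x)} = (\<Union>S\<in>\<C>. S)"
  proof (intro set_eqI iffI)
    fix x assume "x \<in> {x. \<exists>k. P k (D k x)}"
    then have ex: "\<exists>k. P k (D k x)" by simp
    define k where "k = (LEAST k. P k (D k x))"
    have "P k (D k x)" "\<And>j. j < k \<Longrightarrow> \<not> P j (D j x)"
      using LeastI_ex[OF ex] not_less_Least by (auto simp: k_def)
    then show "x \<in> (\<Union>S\<in>\<C>. S)" using cell_self[of x k] by (auto simp: \<C>_def)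
  next
    fix x assume "x \<in> (\<Union>S\<in>\<C>. S)"
    then obtain k y where "x \<in> D k y" "P k (D k y)" by (auto simp: \<C>_def)
    then have "P k (D k x)" using cell_eq by auto
    then show "x \<in> {x. \<exists>k. P k (D k x)}" by blast
  qed
  have disj: "disjoint_family_on (\<lambda>S. S) \<C>"
    unfolding disjoint_family_on_def
  proof (intro ballI impI)
    fix S T assume "S \<in> \<C>" "T \<in> \<C>" "S \<noteq> T"
    then obtain k x l y where S: "S = D k x" "P k (D k x)" "\<forall>j<k. \<not> P j (D j x)"
      and T: "T = D l y" "P l (D l y)" "\<forall>j<l. \<not> P j (D j y)"
      by (auto simp: \<C>_def)
    show "S \<inter> T = {}"
    proof (rule ccontr)
      assume "S \<inter> T \<noteq> {}"
      then obtain z where z: "z \<in> D k x" "z \<in> D l y" using S T by auto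
      have *: "D k z = D k x" "D l z = D l y" using z cell_eq by auto
      \<comment> \<open>The cells share z. If k < l, then the ancestor of the second cell at level k
        is the first cell, which was selected, against the minimality of l.\<close>
      have "\<not> k < l" using T(3) cell_eq_le[OF z(2), of k] *(1) S(2) by auto
      moreover have "\<not> l < k" using S(3) cell_eq_le[OF z(1), of l] *(2) T(2) by auto
      ultimately have "k = l" by simp
      then show False using * S T \<open>S \<noteq> T\<close> by simp
    qed
  qed
  have m: "S \<in> \<C> \<Longrightarrow> S \<in> sets M" for S using cell_sets by (auto simp: \<C>_def)
  show "{x. \<exists>k. P k (D k x)} \<in> sets M"
    unfolding U using m count by (intro sets.countable_UN') auto
  have "emeasure N1 (\<Union>S\<in>\<C>. S) = (\<integral>\<^sup>+S. emeasure N1 S \<partial>count_space \<C>)"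
    using m count disj sets by (intro emeasure_UN_countable) auto
  also have "\<dots> \<le> (\<integral>\<^sup>+S. emeasure N2 S \<partial>count_space \<C>)"
    using le by (intro nn_integral_mono) (auto simp: \<C>_def)
  also have "\<dots> = emeasure N2 (\<Union>S\<in>\<C>. S)"
    using m count disj sets by (intro emeasure_UN_countable[symmetric]) auto
  finally show "emeasure N1 {x. \<exists>k. P k (D k x)} \<le> emeasure N2 {x. \<exists>k. P k (D k x)}"
    unfolding U .
qed

text \<open>The function is constant on each cell of level k, so every preimage is a countable union
  of cells.\<close>

lemma measurable_cell_fun:
  "(\<lambda>x. \<phi> (D k x)) \<in> measurable M (count_space UNIV)"
proof (rule measurableI)
  fix A
  have "(\<lambda>x. \<phi> (D k x)) -` A \<inter> space M = (\<Union>S\<in>{S\<in>range (D k). \<phi> S \<in> A}. S)"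
    using cell_self cell_eq by (fastforce simp: space_UNIV)
  also have "\<dots> \<in> sets M"
    by (intro sets.countable_UN') (auto intro: countable_subset[OF _ countable_cells])
  finally show "(\<lambda>x. \<phi> (D k x)) -` A \<inter> space M \<in> sets M" .
qed auto

lemma borel_measurable_cell_fun:
  "(\<lambda>x. \<phi> (D k x)) \<in> measurable M (borel :: 'b::topological_space measure)"
  using measurable_compose[OF measurable_cell_fun[of \<phi> k], of "\<lambda>x. x" borel] by simp

text \<open>The levels start at 0, so only cells inside the coarsest one around x compete; averages
  over larger cubes are estimated separately.\<close>

definition cell_max :: "('a \<Rightarrow> real) \<Rightarrow> 'a \<Rightarrow> ennreal" where
  "cell_max F x = (SUP k. (\<integral>\<^sup>+y\<in>D k x. ennreal (F y) \<partial>M) / emeasure M (D k x))"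

lemma borel_measurable_cell_max [measurable]: "cell_max F \<in> borel_measurable M"
  unfolding cell_max_def
  using borel_measurable_cell_fun[of "\<lambda>S. (\<integral>\<^sup>+y\<in>S. ennreal (F y) \<partial>M) / emeasure M S"]
  by (intro borel_measurable_SUP) auto

text \<open>On a cell where the average of F exceeds 2c, the part of F below c accounts for at most
  c, so the part above c still has average at least c. Keeping only {F > c} on the right is what
  makes the integral over all heights in \<open>cell_max_strong\<close> converge.\<close>

lemma cell_max_weak:
  fixes F :: "'a \<Rightarrow> real" and c :: real
  assumes [measurable]: "F \<in> borel_measurable M" and c: "0 < c"
  shows "ennreal c * emeasure M {x. ennreal (2 * c) < cell_max F x}
    \<le> (\<integral>\<^sup>+x. ennreal (F x) * indicator {x. c < F x} x \<partial>M)"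
proof -
  define P where "P = (\<lambda>(k::nat) S. ennreal (2 * c) < (\<integral>\<^sup>+y\<in>S. ennreal (F y) \<partial>M) / emeasure M S)"
  define N1 where "N1 = density M (\<lambda>_. ennreal c)"
  define N2 where "N2 = density M (\<lambda>x. ennreal (F x) * indicator {x. c < F x} x)"
  have U: "{x. ennreal (2 * c) < cell_max F x} = {x. \<exists>k. P k (D k x)}"
    by (auto simp: cell_max_def P_def less_SUP_iff)
  have Um: "{x. \<exists>k. P k (D k x)} \<in> sets M"
  proof -
    have "{x \<in> space M. ennreal (2 * c) < cell_max F x} \<in> sets M" by measurable
    then show ?thesis by (simp add: space_UNIV U)
  qed
  have Fm: "{x. c < F x} \<in> sets M"
  proof -
    have "{x \<in> space M. c < F x} \<in> sets M" by measurable
    then show ?thesis by (simp add: space_UNIV)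
  qed
  note [measurable] = Fm
  have two_c: "ennreal (2 * c) = ennreal c + ennreal c"
    using c by (simp flip: ennreal_plus)
  have "emeasure N1 {x. \<exists>k. P k (D k x)} \<le> emeasure N2 {x. \<exists>k. P k (D k x)}"
  proof (rule stopping_le)
    fix x k assume P: "P k (D k x)"
    let ?S = "D k x"
    let ?J = "(\<integral>\<^sup>+x\<in>?S. ennreal (F x) * indicator {x. c < F x} x \<partial>M)"
    \<comment> \<open>In \<open>ennreal\<close> a quotient by \<infinity> is 0, so a cell with
      positive average has finite measure.\<close>
    have fin: "emeasure M ?S \<noteq> \<infinity>" using P by (auto simp: P_def)
    have "ennreal (2 * c) * emeasure M ?S \<le> (\<integral>\<^sup>+y\<in>?S. ennreal (F y) \<partial>M)"
    proof (cases "emeasure M ?S = 0")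
      case False
      have "ennreal (2 * c) * emeasure M ?S \<le> (\<integral>\<^sup>+y\<in>?S. ennreal (F y) \<partial>M) / emeasure M ?S * emeasure M ?S"
        using P by (intro mult_right_mono) (auto simp: P_def)
      also have "\<dots> = (\<integral>\<^sup>+y\<in>?S. ennreal (F y) \<partial>M) * emeasure M ?S / emeasure M ?S"
        by (simp add: ennreal_times_divide mult.commute)
      also have "\<dots> = (\<integral>\<^sup>+y\<in>?S. ennreal (F y) \<partial>M)"
        using fin False by (intro ennreal_mult_divide_eq) auto
      finally show ?thesis .
    qed simp
    also have "\<dots> \<le> (\<integral>\<^sup>+y. ennreal c * indicator ?S y + ennreal (F y) * indicator {x. c < F x} y * indicator ?S y \<partial>M)"
      by (intro nn_integral_mono) (auto split: split_indicator simp: not_less ennreal_leI add_increasing)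
    also have "\<dots> = ennreal c * emeasure M ?S + ?J"
      by (subst nn_integral_add) (auto simp: nn_integral_cmult_indicator)
    finally have "ennreal c * emeasure M ?S + ennreal c * emeasure M ?S \<le> ennreal c * emeasure M ?S + ?J"
      unfolding two_c distrib_right .
    then have "ennreal c * emeasure M ?S \<le> ?J"
      using fin by (simp add: ennreal_add_left_cancel_le ennreal_mult_eq_top_iff)
    then show "emeasure N1 ?S \<le> emeasure N2 ?S"
      by (simp add: N1_def N2_def emeasure_density nn_integral_cmult_indicator)
  qed (auto simp: N1_def N2_def)
  also have "emeasure N1 {x. \<exists>k. P k (D k x)} = ennreal c * emeasure M {x. \<exists>k. P k (D k x)}"
    using Um by (simp add: N1_def emeasure_density nn_integral_cmult_indicator)
  also have "emeasure N2 {x. \<exists>k. P k (D k x)} \<le> (\<integral>\<^sup>+x. ennreal (F x) * indicator {x. c < F x} x \<partial>M)"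
    unfolding N2_def using Um
    by (subst emeasure_density) (auto intro!: nn_integral_mono split: split_indicator)
  finally show ?thesis unfolding U .
qed

end

section \<open>Layer-cake formula and powers on [0, \<infinity>]\<close>

lemma nn_integral_powr_Ioo:
  fixes a y :: real
  assumes "0 < a" "0 \<le> y"
  shows "(\<integral>\<^sup>+t. ennreal (a * t powr (a - 1)) * indicator {0<..<y} t \<partial>lborel) = ennreal (y powr a)"
proof -
  have "((\<lambda>t. a * t powr (a - 1)) has_integral (a * (y powr (a - 1 + 1) / (a - 1 + 1)))) {0..y}"
    using assms by (intro has_integral_mult_right has_integral_powr_from_0) auto
  then have "((\<lambda>t. a * t powr (a - 1)) has_integral (y powr a)) {0..y}"
    using assms by simp
  then have "(\<integral>\<^sup>+t. ennreal (a * t powr (a - 1)) * indicator {0..y} t \<partial>lborel) = ennreal (y powr a)"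
    using assms by (intro nn_integral_has_integral_lebesgue') auto
  moreover have "AE t in lborel. indicator {0<..<y} t = (indicator {0..y} t :: ennreal)"
    using AE_lborel_singleton[of 0] AE_lborel_singleton[of y]
    by eventually_elim (auto split: split_indicator)
  ultimately show ?thesis
    by (subst nn_integral_cong_AE) (auto elim!: eventually_mono)
qed


lemma epowr_mono:
  assumes "x \<le> y" "0 \<le> a" shows "epowr x a \<le> epowr y a"
proof (cases "y = \<infinity>")
  case False
  then have "x \<noteq> \<infinity>" using assms(1) by (auto simp: top_unique)
  then show ?thesis
    using assms False unfolding epowr_def
    by (auto intro!: ennreal_leI powr_mono2 enn2real_mono simp: less_top)
qed (use assms in \<open>auto simp: epowr_def\<close>)

lemma epowr_ennreal: "0 < a \<Longrightarrow> 0 \<le> x \<Longrightarrow> epowr (ennreal x) a = ennreal (x powr a)"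
  by (auto simp: epowr_def)

lemma epowr_ennreal_pos: "0 < x \<Longrightarrow> epowr (ennreal x) a = ennreal (x powr a)"
  by (auto simp: epowr_def)

lemma borel_measurable_epowr [measurable]:
  assumes [measurable]: "f \<in> borel_measurable M"
  shows "(\<lambda>x. epowr (f x) a) \<in> borel_measurable M"
  unfolding epowr_def by measurable

text \<open>The exponent has to be positive: for a < 0 the product of 0 and \<infinity>, which is 0,
  has power \<infinity>, while the product of the powers is 0.\<close>

lemma epowr_mult:
  assumes "0 < a" shows "epowr (x * y) a = epowr x a * epowr y a"
proof (cases "x = \<infinity> \<or> y = \<infinity>")
  case True
  have nz: "epowr z a \<noteq> 0" if "z \<noteq> 0" for z
    using assms that by (auto simp: epowr_def enn2real_eq_0_iff)
  have z: "epowr 0 a = 0" and t: "epowr top a = top" using assms by (auto simp: epowr_def)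
  show ?thesis
  proof (cases "x = 0 \<or> y = 0")
    case True
    then show ?thesis using z by auto
  next
    case False
    then show ?thesis using True nz[of x] nz[of y] t
      by (auto simp: ennreal_top_mult ennreal_mult_top)
  qed
next
  case False
  then obtain a' b' where ab: "x = ennreal a'" "0 \<le> a'" "y = ennreal b'" "0 \<le> b'"
    by (cases x; cases y) auto
  have "epowr (x * y) a = ennreal ((a' * b') powr a)"
    using ab assms by (subst epowr_ennreal[symmetric]) (auto simp: ennreal_mult)
  then show ?thesis using ab assms by (simp add: epowr_ennreal powr_mult ennreal_mult)
qed

lemma epowr_epowr:
  assumes "0 < a" "0 < b" shows "epowr (epowr x a) b = epowr x (a * b)"
proof (cases x)
  case (real r)
  then show ?thesis using assms by (simp add: epowr_ennreal powr_powr)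
qed (use assms in \<open>simp add: epowr_def not_less less_imp_le\<close>)

lemma epowr_1: "epowr x 1 = x"
  by (cases x) (auto simp: epowr_ennreal, simp add: epowr_def)

lemma epowr_inverse_le_iff:
  assumes "0 < s" shows "epowr x (1 / s) \<le> z \<longleftrightarrow> x \<le> epowr z s"
proof
  assume "epowr x (1 / s) \<le> z"
  from epowr_mono[OF this, of s] show "x \<le> epowr z s" using assms by (simp add: epowr_epowr epowr_1)
next
  assume "x \<le> epowr z s"
  from epowr_mono[OF this, of "1 / s"] show "epowr x (1 / s) \<le> z" using assms by (simp add: epowr_epowr epowr_1)
qed

lemma epowr_layer_cake:
  assumes "0 < a"
  shows "epowr y a \<le> (\<integral>\<^sup>+t. ennreal (a * t powr (a - 1)) * indicator {t. 0 < t \<and> ennreal t < y} t \<partial>lborel)"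
proof (cases y)
  case (real r)
  then have "{t. 0 < t \<and> ennreal t < y} = {0<..<r}"
    by (auto simp: ennreal_less_iff)
  then show ?thesis using nn_integral_powr_Ioo[OF assms, of r] real assms by (simp add: epowr_ennreal)
next
  case top
  let ?I = "\<integral>\<^sup>+t. ennreal (a * t powr (a - 1)) * indicator {t. 0 < t \<and> ennreal t < y} t \<partial>lborel"
  have ge: "of_nat n \<le> ?I" for n
  proof -
    \<comment> \<open>Integrating only up to n^(1/a) already gives n.\<close>
    have "of_nat n = ennreal ((real n powr (1 / a)) powr a)"
      using assms by (simp add: powr_powr ennreal_of_nat_eq_real_of_nat)
    also have "\<dots> \<le> ?I"
      unfolding nn_integral_powr_Ioo[OF assms powr_ge_zero, symmetric]
      by (intro nn_integral_mono) (auto split: split_indicator simp: top)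
    finally show ?thesis .
  qed
  have "?I = top"
  proof (rule ccontr)
    assume "?I \<noteq> top"
    then obtain n where "?I < of_nat n"
      using ennreal_Ex_less_of_nat[of ?I] by (auto simp: less_top)
    with ge[of n] show False by simp
  qed
  then show ?thesis by simp
qed

text \<open>Layer cake, the weak bound at c = t/2, and Fubini. The constant comes from integrating 2
  u t^(u-2) F over 0 < t < 2F. The measure needs no doubling property, because averages and
  integrals refer to the same M; this allows M to be a weighted measure.\<close>

lemma (in nested_partition) cell_max_strong:
  fixes F :: "'a \<Rightarrow> real" and u :: real
  assumes "sigma_finite_measure M" and [measurable]: "F \<in> borel_measurable M"
    and F: "\<And>x. 0 \<le> F x" and u: "1 < u"
  shows "(\<integral>\<^sup>+x. epowr (cell_max F x) u \<partial>M) \<le>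
     ennreal (u * 2 powr u / (u - 1)) * (\<integral>\<^sup>+x. ennreal (F x powr u) \<partial>M)"
proof -
  interpret sigma_finite_measure M by fact
  interpret pair_sigma_finite M lborel ..
  let ?G = "cell_max F"
  let ?a = "\<lambda>t x. if 0 < t \<and> ennreal t < ?G x then ennreal (u * t powr (u - 1)) else 0"
  let ?b = "\<lambda>t x. if 0 < t \<and> t < 2 * F x then ennreal (2 * u * t powr (u - 2) * F x) else 0"
  have "(\<integral>\<^sup>+x. epowr (?G x) u \<partial>M)
     \<le> (\<integral>\<^sup>+x. (\<integral>\<^sup>+t. ennreal (u * t powr (u - 1)) * indicator {t. 0 < t \<and> ennreal t < ?G x} t \<partial>lborel) \<partial>M)"
    using u by (intro nn_integral_mono epowr_layer_cake) auto
  also have "\<dots> = (\<integral>\<^sup>+x. (\<integral>\<^sup>+t. ?a t x \<partial>lborel) \<partial>M)"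
    by (intro nn_integral_cong) (auto split: split_indicator)
  also have "\<dots> = (\<integral>\<^sup>+t. (\<integral>\<^sup>+x. ?a t x \<partial>M) \<partial>lborel)"
    by (rule Fubini'[symmetric]) measurable
  also have "\<dots> \<le> (\<integral>\<^sup>+t. (\<integral>\<^sup>+x. ?b t x \<partial>M) \<partial>lborel)"
  proof (rule nn_integral_mono)
    fix t :: real
    show "(\<integral>\<^sup>+x. ?a t x \<partial>M)
        \<le> (\<integral>\<^sup>+x. ?b t x \<partial>M)"
    proof (cases "0 < t")
      case True
      have [measurable]: "{x. ennreal t < ?G x} \<in> sets M" "{x. t / 2 < F x} \<in> sets M"
      proof -
        have "{x \<in> space M. ennreal t < ?G x} \<in> sets M" "{x \<in> space M. t / 2 < F x} \<in> sets M" by measurable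
        then show "{x. ennreal t < ?G x} \<in> sets M" "{x. t / 2 < F x} \<in> sets M" by (simp_all add: space_UNIV)
      qed
      have eq: "u * t powr (u - 1) = 2 * u * t powr (u - 2) * (t / 2)"
        using True powr_add[of t "u - 2" 1] by simp
      have "(\<integral>\<^sup>+x. ?a t x \<partial>M)
          = (\<integral>\<^sup>+x. ennreal (u * t powr (u - 1)) * indicator {x. ennreal t < ?G x} x \<partial>M)"
        using True by (intro nn_integral_cong) (auto split: split_indicator)
      also have "\<dots> = ennreal (u * t powr (u - 1)) * emeasure M {x. ennreal (2 * (t / 2)) < ?G x}"
        by (simp add: nn_integral_cmult_indicator)
      also have "\<dots> = ennreal (2 * u * t powr (u - 2)) * (ennreal (t / 2) * emeasure M {x. ennreal (2 * (t / 2)) < ?G x})"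
        unfolding eq using True u by (subst ennreal_mult) (auto simp: mult.assoc)
      also have "\<dots> \<le> ennreal (2 * u * t powr (u - 2)) * (\<integral>\<^sup>+x. ennreal (F x) * indicator {x. t / 2 < F x} x \<partial>M)"
        using True by (intro mult_left_mono cell_max_weak) auto
      also have "\<dots> = (\<integral>\<^sup>+x. ennreal (2 * u * t powr (u - 2)) * (ennreal (F x) * indicator {x. t / 2 < F x} x) \<partial>M)"
        by (rule nn_integral_cmult[symmetric]) measurable
      also have "\<dots> = (\<integral>\<^sup>+x. ?b t x \<partial>M)"
      proof (intro nn_integral_cong)
        fix x
        have "ennreal (2 * u * t powr (u - 2) * F x) = ennreal (2 * u * t powr (u - 2)) * ennreal (F x)"
          using u F[of x] by (intro ennreal_mult) auto
        then show "ennreal (2 * u * t powr (u - 2)) * (ennreal (F x) * indicator {x. t / 2 < F x} x)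
          = ?b t x"
          using True by (simp split: split_indicator)
      qed
      finally show ?thesis .
    next
      case False
      then have "?a t x = 0" for x
        by auto
      then show ?thesis by (simp only: nn_integral_const) simp
    qed
  qed
  also have "\<dots> = (\<integral>\<^sup>+x. (\<integral>\<^sup>+t. ?b t x \<partial>lborel) \<partial>M)"
    by (rule Fubini') measurable
  also have "\<dots> = (\<integral>\<^sup>+x. ennreal (u * 2 powr u / (u - 1)) * ennreal (F x powr u) \<partial>M)"
  proof (intro nn_integral_cong)
    fix x
    have "(\<integral>\<^sup>+t. ?b t x \<partial>lborel)
       = (\<integral>\<^sup>+t. ennreal (2 * u / (u - 1) * F x) * (ennreal ((u - 1) * t powr (u - 1 - 1)) * indicator {0<..<2 * F x} t) \<partial>lborel)"
    proof (rule nn_integral_cong)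
      fix t
      have "ennreal (2 * u / (u - 1) * F x) * ennreal ((u - 1) * t powr (u - 1 - 1))
          = ennreal (2 * u / (u - 1) * F x * ((u - 1) * t powr (u - 1 - 1)))"
        using F[of x] u by (intro ennreal_mult[symmetric]) auto
      also have "2 * u / (u - 1) * F x * ((u - 1) * t powr (u - 1 - 1)) = 2 * u * t powr (u - 2) * F x"
        using u by simp
      finally show "?b t x
         = ennreal (2 * u / (u - 1) * F x) * (ennreal ((u - 1) * t powr (u - 1 - 1)) * indicator {0<..<2 * F x} t)"
        by (simp add: mult.assoc[symmetric] split: split_indicator)
    qed
    also have "\<dots> = ennreal (2 * u / (u - 1) * F x) *
        (\<integral>\<^sup>+t. ennreal ((u - 1) * t powr (u - 1 - 1)) * indicator {0<..<2 * F x} t \<partial>lborel)"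
      by (rule nn_integral_cmult) measurable
    also have "\<dots> = ennreal (2 * u / (u - 1) * F x) * ennreal ((2 * F x) powr (u - 1))"
      using F[of x] u by (subst nn_integral_powr_Ioo) auto
    also have "\<dots> = ennreal (2 * u / (u - 1) * F x * (2 * F x) powr (u - 1))"
      using F[of x] u by (intro ennreal_mult[symmetric]) auto
    also have "\<dots> = ennreal (u * 2 powr u / (u - 1) * F x powr u)"
    proof -
      have "2 * u / (u - 1) * F x * z = u / (u - 1) * ((2 * F x) * z)" for z
        by simp
      moreover have "(2 * F x) * (2 * F x) powr (u - 1) = 2 powr u * F x powr u"
        unfolding powr_mult[symmetric] using F[of x] by (subst powr_mult_base) auto
      ultimately have "2 * u / (u - 1) * F x * (2 * F x) powr (u - 1) = u / (u - 1) * (2 powr u * F x powr u)"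
        by (simp only:)
      then show ?thesis by (simp only: times_divide_eq_left mult.assoc)
    qed
    also have "\<dots> = ennreal (u * 2 powr u / (u - 1)) * ennreal (F x powr u)"
      using u by (intro ennreal_mult) auto
    finally show "(\<integral>\<^sup>+t. ?b t x \<partial>lborel)
      = ennreal (u * 2 powr u / (u - 1)) * ennreal (F x powr u)" .
  qed
  also have "\<dots> = ennreal (u * 2 powr u / (u - 1)) * (\<integral>\<^sup>+x. ennreal (F x powr u) \<partial>M)"
    by (rule nn_integral_cmult) measurable
  finally show ?thesis .
qed


text \<open>As a simp rule this would rewrite \<open>vol S\<close> to the measure of the main part
  of S.\<close>

declare emeasure_completion [simp del]

section \<open>Cubes and dyadic cells\<close>

definition cube :: "real ^ 'n \<Rightarrow> real \<Rightarrow> (real ^ 'n) set" where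
  "cube c l = cbox c (\<chi> i. c $ i + l)"

lemma mem_cube: "x \<in> cube c l \<longleftrightarrow> (\<forall>i. c $ i \<le> x $ i \<and> x $ i \<le> c $ i + l)"
  by (simp add: cube_def mem_box_cart)

lemma is_cube_iff: "is_cube Q \<longleftrightarrow> (\<exists>c l. 0 < l \<and> Q = cube c l)"
  by (simp add: is_cube_def cube_def)

lemma is_cube_cube: "0 < l \<Longrightarrow> is_cube (cube c l)"
  by (auto simp: is_cube_iff)

lemma measure_cube:
  fixes c :: "real ^ 'n"
  assumes "0 \<le> l"
  shows "measure lebesgue (cube c l) = l ^ CARD('n)"
proof -
  have "cbox c (\<chi> i. c $ i + l) \<noteq> {}" using assms by (auto simp: interval_eq_empty_cart not_less)
  then show ?thesis by (simp add: cube_def content_cbox_cart)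
qed

lemma lmeasurable_cube: "cube c l \<in> lmeasurable"
  by (simp add: cube_def)

lemma sets_cube [measurable, simp]: "cube c l \<in> sets lebesgue"
  by (simp add: cube_def)

lemma emeasure_cube:
  fixes c :: "real ^ 'n"
  assumes "0 \<le> l"
  shows "vol (cube c l) = ennreal (l ^ CARD('n))"
  using emeasure_eq_measure2[OF lmeasurable_cube[of c l]] measure_cube[OF assms, of c] by simp

text \<open>The half-open cell of side l/2^k in the grid anchored at a, encoded by equal integer
  labels. This makes the partition axioms immediate and reduces nesting to the fact that halving a
  number halves its floor, rounding down.\<close>

definition dcell :: "real ^ 'n \<Rightarrow> real \<Rightarrow> nat \<Rightarrow> real ^ 'n \<Rightarrow> (real ^ 'n) set" where
  "dcell a l k x = {y. \<forall>i. \<lfloor>2 ^ k * (y $ i - a $ i) / l\<rfloor> = \<lfloor>2 ^ k * (x $ i - a $ i) / l\<rfloor>}"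

definition dcorner :: "real ^ 'n \<Rightarrow> real \<Rightarrow> nat \<Rightarrow> real ^ 'n \<Rightarrow> real ^ 'n" where
  "dcorner a l k x = (\<chi> i. a $ i + l / 2 ^ k * \<lfloor>2 ^ k * (x $ i - a $ i) / l\<rfloor>)"

lemma mem_dcell:
  assumes "0 < l"
  shows "y \<in> dcell a l k x \<longleftrightarrow>
    (\<forall>i. dcorner a l k x $ i \<le> y $ i \<and> y $ i < dcorner a l k x $ i + l / 2 ^ k)"
proof -
  have "\<lfloor>2 ^ k * (y $ i - a $ i) / l\<rfloor> = z \<longleftrightarrow>
      a $ i + l / 2 ^ k * z \<le> y $ i \<and> y $ i < a $ i + l / 2 ^ k * z + l / 2 ^ k" for i and z :: int
    using assms by (simp add: floor_eq_iff field_simps)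
  then show ?thesis by (simp add: dcell_def dcorner_def)
qed

lemma dcell_subset_cube: "0 < l \<Longrightarrow> dcell a l k x \<subseteq> cube (dcorner a l k x) (l / 2 ^ k)"
  by (auto simp: mem_dcell mem_cube less_imp_le)

lemma sets_dcell:
  assumes "0 < l" shows "dcell a l k x \<in> sets lebesgue"
proof -
  have [measurable]: "(\<lambda>y::real^'n. y $ i) \<in> borel_measurable borel" for i
    by (intro borel_measurable_continuous_onI continuous_intros)
  have "{y \<in> space borel. \<forall>i. dcorner a l k x $ i \<le> y $ i \<and> y $ i < dcorner a l k x $ i + l / 2 ^ k} \<in> sets borel"
    by measurable
  also have "{y \<in> space borel. \<forall>i. dcorner a l k x $ i \<le> y $ i \<and> y $ i < dcorner a l k x $ i + l / 2 ^ k} = dcell a l k x"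
    using mem_dcell[OF assms] by auto
  finally show ?thesis by (simp add: lborelD)
qed

text \<open>The conditions on weights speak of closed cubes and the partitions of half-open cells.
  The two differ by a piece of the boundary, so integrals can be moved between them.\<close>

lemma dcell_cube_null:
  assumes "0 < l"
  shows "cube (dcorner a l k x) (l / 2 ^ k) - dcell a l k x \<in> null_sets lebesgue"
proof -
  let ?c = "dcorner a l k x" and ?d = "\<chi> i. dcorner a l k x $ i + l / 2 ^ k"
  have "box ?c ?d \<subseteq> dcell a l k x"
    using assms by (auto simp: mem_dcell mem_box_cart less_imp_le)
  moreover have "cbox ?c ?d - box ?c ?d \<in> null_sets lebesgue"
    using negligible_frontier_interval[of ?c ?d] by (simp add: negligible_iff_null_sets)
  ultimately show ?thesis
    using sets_dcell[OF assms, of a k x]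
    by - (rule null_sets_subset[of "cbox ?c ?d - box ?c ?d"], auto simp: cube_def)
qed

lemma AE_dcell_cube:
  assumes "0 < l"
  shows "AE y in lebesgue. y \<in> dcell a l k x \<longleftrightarrow> y \<in> cube (dcorner a l k x) (l / 2 ^ k)"
  using AE_not_in[OF dcell_cube_null[OF assms, of a k x]]
  by eventually_elim (use dcell_subset_cube[OF assms, of a k x] in blast)

lemma nn_integral_dcell:
  assumes "0 < l"
  shows "(\<integral>\<^sup>+y\<in>dcell a l k x. f y \<partial>lebesgue) = (\<integral>\<^sup>+y\<in>cube (dcorner a l k x) (l / 2 ^ k). f y \<partial>lebesgue)"
  using AE_dcell_cube[OF assms, of a k x]
  by (intro nn_integral_cong_AE) (auto elim!: eventually_mono split: split_indicator)

lemma emeasure_dcell: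
  fixes a :: "real ^ 'n"
  assumes "0 < l"
  shows "vol (dcell a l k x) = ennreal ((l / 2 ^ k) ^ CARD('n))"
proof -
  have "vol (dcell a l k x) = vol (cube (dcorner a l k x) (l / 2 ^ k))"
    using AE_dcell_cube[OF assms, of a k x] sets_dcell[OF assms, of a k x]
    by (intro emeasure_eq_AE) auto
  also have "\<dots> = ennreal ((l / 2 ^ k) ^ CARD('n))"
    using assms by (intro emeasure_cube) auto
  finally show ?thesis .
qed

lemma nested_partition_dcell:
  fixes a :: "real ^ 'n"
  assumes "0 < l"
  shows "nested_partition lebesgue (dcell a l)"
proof
  fix x y :: "real ^ 'n" and k
  show "x \<in> dcell a l k x" by (simp add: dcell_def)
  show "dcell a l k y = dcell a l k x" if "y \<in> dcell a l k x" using that by (simp add: dcell_def)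
  show "dcell a l (Suc k) x \<subseteq> dcell a l k x"
  proof
    fix y assume y: "y \<in> dcell a l (Suc k) x"
    have half: "\<lfloor>2 ^ k * t / l\<rfloor> = \<lfloor>2 ^ Suc k * t / l\<rfloor> div 2" for t
    proof -
      have "2 ^ k * t / l = (2 ^ Suc k * t / l) / real_of_int 2" by simp
      then show ?thesis by (simp only: floor_divide_real_eq_div)
    qed
    show "y \<in> dcell a l k x" using y unfolding dcell_def half by simp
  qed
  show "dcell a l k x \<in> sets lebesgue" by (rule sets_dcell[OF assms])
  have "range (dcell a l k) = (\<lambda>z::'n \<Rightarrow> int. {y. \<forall>i. \<lfloor>2 ^ k * (y $ i - a $ i) / l\<rfloor> = z i}) `
      range (\<lambda>x i. \<lfloor>2 ^ k * (x $ i - a $ i) / l\<rfloor>)"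
    by (auto simp: dcell_def image_image)
  also have "countable \<dots>"
    by (intro countable_image countableI_type)
  finally show "countable (range (dcell a l k))" .
  show "space (lebesgue :: (real ^ 'n) measure) = UNIV" by simp
qed

section \<open>Lebesgue differentiation along dyadic cells\<close>

lemma dcell_subset_open:
  fixes a :: "real ^ 'n"
  assumes l: "0 < l" and G: "open G" "x \<in> G"
  obtains k where "dcell a l k x \<subseteq> G"
proof -
  obtain e where e: "0 < e" "ball x e \<subseteq> G" using G open_contains_ball by blast
  have "(\<lambda>k. real CARD('n) * (l / 2 ^ k)) \<longlonglongrightarrow> 0"
    using LIMSEQ_divide_realpow_zero[of 2 "real CARD('n) * l"] by simp
  then have "eventually (\<lambda>k. real CARD('n) * (l / 2 ^ k) < e) sequentially"
    using e by (auto dest: order_tendstoD)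
  then obtain k where k: "real CARD('n) * (l / 2 ^ k) < e"
    by (auto simp: eventually_sequentially)
  have "dcell a l k x \<subseteq> ball x e"
  proof
    fix y assume y: "y \<in> dcell a l k x"
    have x: "x \<in> dcell a l k x" by (simp add: dcell_def)
    have "dist x y \<le> (\<Sum>i\<in>UNIV. \<bar>(x - y) $ i\<bar>)" using norm_le_l1_cart[of "x - y"] by (simp add: dist_norm)
    also have "\<dots> \<le> (\<Sum>i\<in>(UNIV::'n set). l / 2 ^ k)"
      using x y unfolding mem_dcell[OF l] by (intro sum_mono) (smt (verit) vector_minus_component)
    finally show "y \<in> ball x e" using k by simp
  qed
  then show ?thesis using that e by blast
qed

lemma emeasure_density_wmeas:
  assumes "u \<in> borel_measurable lebesgue" "S \<in> sets lebesgue"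
  shows "emeasure (density lebesgue (\<lambda>x. ennreal (u x))) S = wmeas u S"
  using assms by (simp add: emeasure_density wmeas_def)

text \<open>Only this direction of differentiation is required: where u exceeds c, some dyadic
  average does. Let E be the set of exceptions. Cells that meet E have average at most c, and they
  fill an open set only slightly larger than E, so the u-mass of E is at most c times its volume.
  Since u > c on E, the set E is null.\<close>

lemma AE_dcell_average:
  fixes u :: "real ^ 'n \<Rightarrow> real"
  assumes l: "0 < l" and u [measurable]: "u \<in> borel_measurable lebesgue" and c: "0 \<le> c"
  shows "AE x in lebesgue. c < u x \<longrightarrow>
     (\<exists>k. ennreal c * vol (dcell a l k x) < wmeas u (dcell a l k x))"
proof -
  interpret nested_partition lebesgue "dcell a l" by (rule nested_partition_dcell[OF l])
  let ?E = "{x. c < u x \<and> (\<forall>k. wmeas u (dcell a l k x) \<le> ennreal c * vol (dcell a l k x))}"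
  have [measurable]: "(\<lambda>x. wmeas u (dcell a l k x)) \<in> borel_measurable lebesgue"
    "(\<lambda>x. vol (dcell a l k x)) \<in> borel_measurable lebesgue" for k
    by (rule borel_measurable_cell_fun)+
  have "{x \<in> space lebesgue. c < u x \<and> (\<forall>k. wmeas u (dcell a l k x) \<le> ennreal c * vol (dcell a l k x))}
      \<in> sets lebesgue"
    by measurable
  then have Es [measurable]: "?E \<in> sets lebesgue" by simp
  \<comment> \<open>Intersecting with balls makes the volume finite, so that it can be cancelled
    below.\<close>
  have "?E \<inter> cball 0 (real m) \<in> null_sets lebesgue" for m
  proof -
    define E where "E = ?E \<inter> cball 0 (real m)"
    have Em [measurable]: "E \<in> sets lebesgue" unfolding E_def using Es by (rule sets.Int) simp
    have Efin: "vol E < \<infinity>"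
    proof -
      have "E \<in> lmeasurable"
        unfolding E_def Int_commute[of ?E] by (rule fmeasurable_Int_fmeasurable[OF lmeasurable_cball Es])
      then show ?thesis by (simp add: fmeasurable_def)
    qed
    have eps: "wmeas u E \<le> ennreal c * vol E + ennreal e" if e: "0 < e" for e
    proof -
      \<comment> \<open>The denominator c + 1 also serves c = 0 and keeps c times the excess volume
        below e.\<close>
      have e': "0 < e / (c + 1)" using e c by simp
      obtain T where T: "open T" "E \<subseteq> T" "T - E \<in> lmeasurable" "vol (T - E) < ennreal (e / (c + 1))"
        by (rule sets_lebesgue_outer_open[OF Em e'])
      have [measurable]: "T \<in> sets lebesgue" using T(1) by (simp add: borel_open lborelD)
      define P where "P = (\<lambda>(k::nat) S. S \<subseteq> T \<and> S \<inter> E \<noteq> {})"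
      define N1 where "N1 = density lebesgue (\<lambda>x. ennreal (u x))"
      define N2 where "N2 = density lebesgue (\<lambda>x::real^'n. ennreal c)"
      have cell: "emeasure N1 (dcell a l k x) \<le> emeasure N2 (dcell a l k x)" if P: "P k (dcell a l k x)" for k x
      proof -
        obtain y where y: "y \<in> dcell a l k x" "y \<in> E" using P unfolding P_def by blast
        then have "wmeas u (dcell a l k x) \<le> ennreal c * vol (dcell a l k x)"
          using cell_eq[OF y(1)] unfolding E_def by (metis (mono_tags, lifting) IntD1 mem_Collect_eq)
        then show ?thesis
          by (simp add: N1_def N2_def wmeas_def emeasure_density nn_integral_cmult_indicator)
      qed
      let ?U = "{x. \<exists>k. P k (dcell a l k x)}"
      have sets: "sets N1 = sets lebesgue" "sets N2 = sets lebesgue" by (auto simp: N1_def N2_def)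
      have Us: "?U \<in> sets lebesgue" by (rule stopping_sets[OF sets]) (use cell in auto)
      have "E \<subseteq> ?U"
      proof
        fix x assume x: "x \<in> E"
        then obtain k where "dcell a l k x \<subseteq> T" using dcell_subset_open[OF l T(1), of x a] T(2) by blast
        then show "x \<in> ?U" using x cell_self[of x k] by (auto simp: P_def)
      qed
      then have "wmeas u E \<le> emeasure N1 ?U"
        using Us emeasure_mono[of E ?U N1] by (simp add: N1_def emeasure_density_wmeas[symmetric] sets)
      also have "\<dots> \<le> emeasure N2 ?U" by (rule stopping_le[OF sets]) (use cell in auto)
      also have "\<dots> = ennreal c * vol ?U"
        using Us by (simp add: N2_def emeasure_density nn_integral_cmult_indicator)
      also have "\<dots> \<le> ennreal c * vol T"
        using cell_self by (intro mult_left_mono emeasure_mono) (auto simp: P_def)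
      also have "vol T = vol E + vol (T - E)"
        using T(2) Em by (subst plus_emeasure) (auto simp: Un_absorb1)
      also have "ennreal c * (vol E + vol (T - E))
         \<le> ennreal c * (vol E + ennreal (e / (c + 1)))"
        using T(4) by (intro mult_left_mono add_left_mono) auto
      also have "\<dots> = ennreal c * vol E + ennreal (c * (e / (c + 1)))"
        unfolding distrib_left ennreal_mult[OF c less_imp_le[OF e']] ..
      also have "\<dots> \<le> ennreal c * vol E + ennreal e"
        using c e by (intro add_left_mono ennreal_leI) (simp add: field_simps)
      finally show ?thesis .
    qed
    have le: "wmeas u E \<le> ennreal c * vol E"
      by (rule ennreal_le_epsilon) (rule eps)
    have "ennreal c * vol E + (\<integral>\<^sup>+x\<in>E. ennreal (u x - c) \<partial>lebesgue)
       = (\<integral>\<^sup>+x. ennreal c * indicator E x + ennreal (u x - c) * indicator E x \<partial>lebesgue)"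
      by (subst nn_integral_add) (auto simp: nn_integral_cmult_indicator)
    also have "\<dots> = wmeas u E"
      unfolding wmeas_def using c
      by (intro nn_integral_cong) (auto split: split_indicator simp: E_def simp flip: ennreal_plus)
    finally have "ennreal c * vol E + (\<integral>\<^sup>+x\<in>E. ennreal (u x - c) \<partial>lebesgue)
      \<le> ennreal c * vol E + 0" using le by simp
    then have "(\<integral>\<^sup>+x\<in>E. ennreal (u x - c) \<partial>lebesgue) = 0"
      using Efin by (subst (asm) ennreal_add_left_cancel_le) (auto simp: ennreal_mult_eq_top_iff)
    then have "AE x in lebesgue. ennreal (u x - c) * indicator E x = 0"
      by (subst (asm) nn_integral_0_iff_AE) auto
    then have "AE x in lebesgue. x \<notin> E"
      by eventually_elim (auto simp: E_def ennreal_eq_0_iff split: split_indicator_asm)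
    then have "E \<in> null_sets lebesgue" using Em by (simp add: AE_iff_null_sets)
    then show ?thesis by (simp add: E_def)
  qed
  then have "(\<Union>m. ?E \<inter> cball 0 (real m)) \<in> null_sets lebesgue" by blast
  also have "(\<Union>m. ?E \<inter> cball 0 (real m)) = ?E"
    by (auto simp: real_arch_simple)
  finally show ?thesis
    by (rule AE_not_in[THEN eventually_mono]) (auto simp: not_le)
qed


section \<open>The reverse Hoelder inequality\<close>

abbreviation rvol :: "(real ^ 'n) set \<Rightarrow> real" where
  "rvol \<equiv> measure lebesgue"

text \<open>\<open>enn2real\<close> sends an infinite mass to 0, so the value means an average only
  where the mass is known to be finite, as in \<open>wmeas_eq_avg\<close>.\<close>

definition avg :: "(real ^ 'n \<Rightarrow> real) \<Rightarrow> (real ^ 'n) set \<Rightarrow> real" where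
  "avg u Q = enn2real (wmeas u Q) / rvol Q"

lemma wmeas_mono: "S \<subseteq> T \<Longrightarrow> wmeas u S \<le> wmeas u T"
  unfolding wmeas_def by (intro nn_integral_mono) (auto split: split_indicator)

lemma wmeas_dcell: "0 < l \<Longrightarrow> wmeas u (dcell a l k x) = wmeas u (cube (dcorner a l k x) (l / 2 ^ k))"
  unfolding wmeas_def by (rule nn_integral_dcell)

lemma measure_cube_pos: "is_cube Q \<Longrightarrow> 0 < rvol Q"
  by (auto simp: is_cube_iff measure_cube)

lemma emeasure_is_cube: "is_cube Q \<Longrightarrow> vol Q = ennreal (rvol Q)"
  by (auto simp: is_cube_iff measure_cube emeasure_cube)

lemma wmeas_eq_avg:
  assumes "is_cube Q" "wmeas u Q < \<infinity>"
  shows "wmeas u Q = ennreal (avg u Q * rvol Q)"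
  using measure_cube_pos[OF assms(1)] assms(2) by (simp add: avg_def)

lemma avg_pos:
  assumes "is_cube Q" "0 < wmeas u Q" "wmeas u Q < \<infinity>"
  shows "0 < avg u Q"
  using measure_cube_pos[OF assms(1)] assms(2,3) by (simp add: avg_def enn2real_positive_iff)

text \<open>The set where the dyadic maximal function of u, restricted to subcells of the base cell,
  exceeds b. The base cell \<open>dcell c l 0 c\<close> is the half-open version of
  \<open>cube c l\<close>.\<close>

definition level_set :: "(real ^ 'n \<Rightarrow> real) \<Rightarrow> real ^ 'n \<Rightarrow> real \<Rightarrow> real \<Rightarrow> (real ^ 'n) set" where
  "level_set u c l b = {x. \<exists>k. dcell c l k x \<subseteq> dcell c l 0 c \<and>
     ennreal b * vol (dcell c l k x) < wmeas u (dcell c l k x)}"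

text \<open>Let S be a first selected cell at height b. Its parent was not selected, so the average
  over S is at most 2^n b. The part E of S at height 2^(n+1) b therefore has at most half the volume
  of S, and \<open>decay\<close> applies to E. The factor 2^n pays for the parent and the additional
  2 for the half.\<close>

lemma level_set_halving:
  fixes u :: "real ^ 'n \<Rightarrow> real"
  assumes u [measurable]: "u \<in> borel_measurable lebesgue"
    and fin: "\<And>Q. is_cube Q \<Longrightarrow> wmeas u Q < \<infinity>"
    and l: "0 < l" and \<beta>: "0 < \<beta>"
    and decay: "\<And>Q E. is_cube Q \<Longrightarrow> E \<in> sets lebesgue \<Longrightarrow> E \<subseteq> Q \<Longrightarrow>
        2 * vol E \<le> vol Q \<Longrightarrow> wmeas u E \<le> ennreal \<beta> * wmeas u Q"
    and b: "0 < b" "avg u (cube c l) \<le> b"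
  shows "wmeas u (level_set u c l (2 ^ (CARD('n) + 1) * b)) \<le> ennreal \<beta> * wmeas u (level_set u c l b)"
    and "level_set u c l b \<in> sets lebesgue"
proof -
  interpret nested_partition lebesgue "dcell c l" by (rule nested_partition_dcell[OF l])
  define S0 where "S0 = dcell c l 0 c"
  define P where "P = (\<lambda>b (k::nat) S. S \<subseteq> S0 \<and> ennreal b * vol S < wmeas u S)"
  have U: "level_set u c l b = {x. \<exists>k. P b k (dcell c l k x)}" for b
    by (simp add: level_set_def P_def S0_def)
  \<comment> \<open>With null measures the comparison is trivial and the stopping principle yields
    just measurability.\<close>
  have Us [measurable]: "level_set u c l b \<in> sets lebesgue" for b
    unfolding U by (rule stopping_sets[of "null_measure lebesgue" "null_measure lebesgue"]) auto
  then show "level_set u c l b \<in> sets lebesgue" .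
  define b' where "b' = 2 ^ (CARD('n) + 1) * b"
  have bb': "b \<le> b'" "0 < b'"
    using b mult_right_mono[of 1 "2 ^ (CARD('n) + 1)" b] one_le_power[of "2::real" "CARD('n) + 1"]
    by (auto simp: b'_def simp del: power_Suc)
  have S0: "wmeas u S0 \<le> ennreal b * emeasure lebesgue S0"
  proof -
    have "dcorner c l 0 c = c" by (simp add: dcorner_def vec_eq_iff)
    then have "wmeas u S0 = wmeas u (cube c l)" "emeasure lebesgue S0 = vol (cube c l)"
      using wmeas_dcell[OF l, of u c 0 c] emeasure_dcell[OF l, of c 0 c] emeasure_cube[of l c] l
      by (auto simp: S0_def)
    moreover have "wmeas u (cube c l) = ennreal (avg u (cube c l) * rvol (cube c l))"
      by (intro wmeas_eq_avg fin is_cube_cube l)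
    moreover have "avg u (cube c l) * rvol (cube c l) \<le> b * rvol (cube c l)"
      using b by (intro mult_right_mono) auto
    ultimately show ?thesis
      using b emeasure_is_cube[OF is_cube_cube[OF l, of c]] by (simp add: ennreal_mult''[symmetric] ennreal_leI)
  qed
  have first: "wmeas u (level_set u c l b' \<inter> dcell c l j x) \<le> ennreal \<beta> * wmeas u (dcell c l j x)"
    if Pj: "P b j (dcell c l j x)" and nP: "\<And>i. i < j \<Longrightarrow> \<not> P b i (dcell c l i x)" for j x
  proof -
    let ?S = "dcell c l j x"
    have xS0: "x \<in> S0" using Pj cell_self[of x j] by (auto simp: P_def)
    have sub: "dcell c l i x \<subseteq> S0" for i
      using cell_antimono[of 0 i x] cell_eq[of x 0 c] xS0 by (simp add: S0_def)
    have top: "wmeas u ?S \<le> ennreal (2 ^ CARD('n) * b) * vol ?S"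
    \<comment> \<open>The base cell has no parent, but it cannot be selected, since its average is
      at most b.\<close>
    proof (cases j)
      case 0
      then have "?S = S0" using cell_eq[of x 0 c] xS0 by (simp add: S0_def)
      then show ?thesis using S0 Pj by (auto simp: P_def)
    next
      case (Suc i)
      have "wmeas u ?S \<le> wmeas u (dcell c l i x)" using Suc cell_nested by (intro wmeas_mono) auto
      also have "\<dots> \<le> ennreal b * vol (dcell c l i x)"
        using nP[of i] Suc sub by (auto simp: P_def)
      also have "\<dots> = ennreal (b * (l / 2 ^ i) ^ CARD('n))"
        using l b by (simp add: emeasure_dcell ennreal_mult'')
      also have "b * (l / 2 ^ i) ^ CARD('n) = (2 ^ CARD('n) * b) * (l / 2 ^ j) ^ CARD('n)"
        by (simp add: Suc power_divide power_mult_distrib)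
      also have "ennreal \<dots> = ennreal (2 ^ CARD('n) * b) * vol ?S"
        using l b by (subst ennreal_mult'') (auto simp: emeasure_dcell)
      finally show ?thesis .
    qed
    define E where "E = level_set u c l b' \<inter> ?S"
    have Em [measurable]: "E \<in> sets lebesgue" by (simp add: E_def)
    define P' where "P' = (\<lambda>(k::nat) T. T \<subseteq> ?S \<and> ennreal b' * vol T < wmeas u T)"
    define U' where "U' = {x. \<exists>k. P' k (dcell c l k x)}"
    define N1 where "N1 = density lebesgue (\<lambda>x::real^'n. ennreal b')"
    define N2 where "N2 = density lebesgue (\<lambda>x. ennreal (u x))"
    have sets: "sets N1 = sets lebesgue" "sets N2 = sets lebesgue" by (auto simp: N1_def N2_def)
    have cell: "emeasure N1 (dcell c l k y) \<le> emeasure N2 (dcell c l k y)" if "P' k (dcell c l k y)" for k y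
      using that by (auto simp: P'_def N1_def N2_def wmeas_def emeasure_density nn_integral_cmult_indicator)
    have U'm [measurable]: "U' \<in> sets lebesgue"
      unfolding U'_def by (rule stopping_sets[OF sets cell])
    have "E \<subseteq> U'"
    proof
      fix y assume "y \<in> E"
      then obtain k where y: "y \<in> ?S" and k: "P b' k (dcell c l k y)" unfolding E_def U by auto
      \<comment> \<open>A cell selected at height b' is also selected at height b, so by minimality
        of j its level is at least j and it lies inside S.\<close>
      have "P b k (dcell c l k y)"
        using k mult_right_mono[OF ennreal_leI[OF bb'(1)], of "vol (dcell c l k y)"]
        by (auto simp: P_def order_le_less_trans)
      then have "\<not> k < j" using cell_eq_le[OF y, of k] nP[of k] by auto
      then have "dcell c l k y \<subseteq> ?S" using cell_antimono[of j k y] cell_eq[OF y] by simp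
      then have "P' k (dcell c l k y)" using k by (simp add: P_def P'_def)
      then show "y \<in> U'" by (auto simp: U'_def)
    qed
    then have "ennreal b' * vol E \<le> ennreal b' * emeasure lebesgue U'"
      by (intro mult_left_mono emeasure_mono) auto
    also have "\<dots> = emeasure N1 U'" by (simp add: N1_def emeasure_density nn_integral_cmult_indicator)
    also have "\<dots> \<le> emeasure N2 U'" unfolding U'_def by (rule stopping_le[OF sets cell])
    also have "\<dots> = wmeas u U'" by (simp add: N2_def emeasure_density wmeas_def)
    also have "\<dots> \<le> wmeas u ?S" by (intro wmeas_mono) (auto simp: U'_def P'_def intro: cell_self)
    also note top
    finally have "ennreal (2 ^ CARD('n) * b) * (2 * vol E) \<le> ennreal (2 ^ CARD('n) * b) * vol ?S"
      using b by (simp add: b'_def ennreal_mult mult_ac)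
    then have half: "2 * vol E \<le> vol ?S"
      using b by (subst (asm) ennreal_mult_le_mult_iff) auto
    let ?Q = "cube (dcorner c l j x) (l / 2 ^ j)"
    have "wmeas u E \<le> ennreal \<beta> * wmeas u ?Q"
    proof (rule decay)
      show "is_cube ?Q" using l by (intro is_cube_cube) auto
      show "E \<subseteq> ?Q" using dcell_subset_cube[OF l, of c j x] by (auto simp: E_def)
      show "2 * vol E \<le> vol ?Q"
        using half l by (simp add: emeasure_dcell emeasure_cube)
    qed simp
    then show ?thesis by (simp add: wmeas_dcell[OF l] E_def)
  qed
  \<comment> \<open>With these densities the stopping principle adds up \<open>first\<close> over
    the disjoint first selected cells.\<close>
  define N1 where "N1 = density lebesgue (\<lambda>x. ennreal (u x) * indicator (level_set u c l b') x)"
  define N2 where "N2 = density lebesgue (\<lambda>x. ennreal \<beta> * ennreal (u x))"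
  have sets: "sets N1 = sets lebesgue" "sets N2 = sets lebesgue" by (auto simp: N1_def N2_def)
  have N1: "emeasure N1 S = wmeas u (level_set u c l b' \<inter> S)" if "S \<in> sets lebesgue" for S
    using that by (auto simp: N1_def emeasure_density wmeas_def intro!: nn_integral_cong split: split_indicator)
  have N2: "emeasure N2 S = ennreal \<beta> * wmeas u S" if [measurable]: "S \<in> sets lebesgue" for S
    by (simp add: N2_def emeasure_density wmeas_def nn_integral_cmult[symmetric] mult.assoc)
  have "emeasure N1 (level_set u c l b) \<le> emeasure N2 (level_set u c l b)"
    unfolding U[of b] by (rule stopping_le[OF sets]) (simp add: N1 N2 sets_dcell[OF l] first)
  then have "wmeas u (level_set u c l b' \<inter> level_set u c l b) \<le> ennreal \<beta> * wmeas u (level_set u c l b)"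
    by (simp add: N1 N2)
  moreover have "level_set u c l b' \<subseteq> level_set u c l b"
  proof
    fix x assume "x \<in> level_set u c l b'"
    then obtain k where k: "P b' k (dcell c l k x)" unfolding U by auto
    then have "P b k (dcell c l k x)"
      using mult_right_mono[OF ennreal_leI[OF bb'(1)], of "vol (dcell c l k x)"]
      by (auto simp: P_def order_le_less_trans)
    then show "x \<in> level_set u c l b" unfolding U by auto
  qed
  ultimately show "wmeas u (level_set u c l (2 ^ (CARD('n) + 1) * b)) \<le> ennreal \<beta> * wmeas u (level_set u c l b)"
    by (simp add: Int_absorb2 b'_def)
qed

text \<open>The masses of the level sets at heights A^k m fall like \<beta>^k, while u^e grows at
  most like A^(ke) there. For small e the decay wins and the (1+e)-th moment is bounded by a
  geometric series.\<close>

theorem reverse_holder_of_decay: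
  fixes u :: "real ^ 'n \<Rightarrow> real"
  assumes u [measurable]: "u \<in> borel_measurable lebesgue" and nonneg: "\<And>x. 0 \<le> u x"
    and fin: "\<And>Q. is_cube Q \<Longrightarrow> wmeas u Q < \<infinity>" and pos: "\<And>Q. is_cube Q \<Longrightarrow> 0 < wmeas u Q"
    and \<beta>: "0 < \<beta>" "\<beta> < 1"
    and decay: "\<And>Q E. is_cube Q \<Longrightarrow> E \<in> sets lebesgue \<Longrightarrow> E \<subseteq> Q \<Longrightarrow>
        2 * vol E \<le> vol Q \<Longrightarrow> wmeas u E \<le> ennreal \<beta> * wmeas u Q"
  shows "\<exists>e>0. \<exists>C>0. \<forall>Q. is_cube Q \<longrightarrow>
     wmeas (\<lambda>x. u x powr (1 + e)) Q \<le> ennreal (C * rvol Q * avg u Q powr (1 + e))"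
proof -
  define A where "A = (2::real) ^ (CARD('n) + 1)"
  have A: "1 < A" unfolding A_def by (rule one_less_power) auto
  \<comment> \<open>Any number strictly between \<beta> and 1 would do; e is then the solution of
    A^e \<beta> = \<rho>, the ratio of the series.\<close>
  define \<rho> where "\<rho> = (1 + \<beta>) / 2"
  have \<rho>: "0 < \<rho>" "\<rho> < 1" "\<beta> < \<rho>" using \<beta> by (auto simp: \<rho>_def)
  define e where "e = ln (\<rho> / \<beta>) / ln A"
  have e: "0 < e" using \<rho> \<beta> A by (simp add: e_def)
  have Ae: "A powr e = \<rho> / \<beta>" using A \<rho> \<beta> by (simp add: powr_def e_def)
  define C where "C = 1 + A powr e / (1 - \<rho>)"
  have C: "0 < C" using A \<rho> by (auto simp: C_def intro!: add_pos_nonneg)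
  have "wmeas (\<lambda>x. u x powr (1 + e)) Q \<le> ennreal (C * rvol Q * avg u Q powr (1 + e))"
    if Qc: "is_cube Q" for Q
  proof -
    obtain c l where l: "0 < l" and Q: "Q = cube c l" using Qc by (auto simp: is_cube_iff)
    interpret nested_partition lebesgue "dcell c l" by (rule nested_partition_dcell[OF l])
    define m where "m = avg u Q"
    have m: "0 < m" unfolding m_def by (intro avg_pos Qc fin pos)
    define W where "W = m * rvol Q"
    have W0: "0 \<le> W" using m by (simp add: W_def)
    have W: "wmeas u Q = ennreal W" using wmeas_eq_avg[OF Qc fin[OF Qc]] by (simp add: W_def m_def)
    define a where "a = (\<lambda>k. A ^ k * m)"
    have a: "0 < a k" "m \<le> a k" for k
      using A m mult_right_mono[of 1 "A ^ k" m] by (auto simp: a_def one_le_power)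
    define U where "U = (\<lambda>k. level_set u c l (a k))"
    have Um [measurable]: "U k \<in> sets lebesgue" for k
      unfolding U_def by (rule level_set_halving(2)[OF u fin l \<beta>(1) decay a(1) a(2)[unfolded m_def Q]])
    have S0: "dcell c l 0 c \<subseteq> Q" "dcorner c l 0 c = c"
      using dcell_subset_cube[OF l, of c 0 c] by (auto simp: Q dcorner_def vec_eq_iff)
    have UQ: "U k \<subseteq> dcell c l 0 c" for k
      using cell_self by (auto simp: U_def level_set_def)
    have UW: "wmeas u (U k) \<le> ennreal (\<beta> ^ k * W)" for k
    proof (induction k)
      case 0
      have "wmeas u (U 0) \<le> wmeas u Q" using UQ[of 0] S0 by (intro wmeas_mono) auto
      then show ?case by (simp add: W)
    next
      case (Suc k)
      have "wmeas u (U (Suc k)) = wmeas u (level_set u c l (2 ^ (CARD('n) + 1) * a k))"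
        by (simp add: U_def a_def A_def mult_ac)
      also have "\<dots> \<le> ennreal \<beta> * wmeas u (U k)"
        unfolding U_def by (rule level_set_halving(1)[OF u fin l \<beta>(1) decay a(1) a(2)[unfolded m_def Q]])
      also have "\<dots> \<le> ennreal \<beta> * ennreal (\<beta> ^ k * W)" by (intro mult_left_mono Suc) auto
      also have "\<dots> = ennreal (\<beta> ^ Suc k * W)"
        using \<beta> W0 by (simp add: ennreal_mult[symmetric] mult.assoc)
      finally show ?case .
    qed
    have "AE x in lebesgue. \<forall>k. a k < u x \<longrightarrow>
        (\<exists>j. ennreal (a k) * vol (dcell c l j x) < wmeas u (dcell c l j x))"
      unfolding AE_all_countable using a by (intro allI AE_dcell_average l u) (auto simp: less_imp_le)
    then have AE_U: "AE x in lebesgue. x \<in> dcell c l 0 c \<longrightarrow> (\<forall>k. a k < u x \<longrightarrow> x \<in> U k)"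
    proof eventually_elim
      case (elim x)
      show ?case
      proof (intro impI allI)
        fix k assume x: "x \<in> dcell c l 0 c" and "a k < u x"
        then obtain j where j: "ennreal (a k) * vol (dcell c l j x) < wmeas u (dcell c l j x)"
          using elim by blast
        have "dcell c l j x \<subseteq> dcell c l 0 c"
          using cell_antimono[of 0 j x] cell_eq[OF x] by simp
        then show "x \<in> U k" using j by (auto simp: U_def level_set_def)
      qed
    qed
    \<comment> \<open>Where a_j < u \<le> a_(j+1), almost every point lies in U j by the
      differentiation theorem, and u^(1+e) is at most a_(j+1)^e u. The first summand covers the
      points with u \<le> m.\<close>
    let ?B = "\<lambda>x. ennreal (m powr e) * (ennreal (u x) * indicator Q x)
        + (\<Sum>k. ennreal (a (Suc k) powr e) * (ennreal (u x) * indicator (U k) x))"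
    have "AE x in lebesgue. ennreal (u x powr (1 + e)) * indicator Q x \<le> ?B x"
      using AE_U AE_dcell_cube[OF l, of c 0 c]
    proof eventually_elim
      case (elim x)
      have split: "ennreal (u x powr (1 + e)) \<le> ennreal (b powr e) * ennreal (u x)" if "u x \<le> b" for b
      proof -
        have "u x powr (1 + e) = u x powr e * u x" using nonneg[of x] by (cases "u x = 0") (auto simp: powr_add)
        also have "\<dots> \<le> b powr e * u x" using nonneg[of x] e that by (intro mult_right_mono powr_mono2) auto
        finally show ?thesis using nonneg[of x] by (simp add: ennreal_mult''[symmetric] ennreal_leI)
      qed
      show ?case
      proof (cases "x \<in> Q")
        case True
        then have x: "x \<in> dcell c l 0 c" using elim(2) S0 by (simp add: Q)
        have ex: "\<exists>k. u x \<le> a k"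
        proof -
          obtain k where "u x / m < A ^ k" using real_arch_pow[OF A] by blast
          then show ?thesis using m by (intro exI[of _ k]) (simp add: a_def field_simps)
        qed
        define k where "k = (LEAST k. u x \<le> a k)"
        have k: "u x \<le> a k" using LeastI_ex[OF ex] by (simp add: k_def)
        show ?thesis
        proof (cases k)
          case 0
          then have "u x \<le> m" using k by (simp add: a_def)
          then show ?thesis using split[of m] True by (simp add: add_increasing2)
        next
          case (Suc j)
          then have "a j < u x" using not_less_Least[of j "\<lambda>k. u x \<le> a k"] by (simp add: k_def)
          then have xj: "x \<in> U j" using elim(1) x by blast
          have "ennreal (u x powr (1 + e)) * indicator Q x
             \<le> ennreal (a (Suc j) powr e) * (ennreal (u x) * indicator (U j) x)"
            using split[of "a (Suc j)"] k Suc True xj by simp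
          also have "\<dots> \<le> (\<Sum>k. ennreal (a (Suc k) powr e) * (ennreal (u x) * indicator (U k) x))"
            using sum_le_suminf[of "\<lambda>k. ennreal (a (Suc k) powr e) * (ennreal (u x) * indicator (U k) x)" "{j}"]
            by simp
          finally show ?thesis by (simp add: add_increasing)
        qed
      qed simp
    qed
    then have "wmeas (\<lambda>x. u x powr (1 + e)) Q \<le> (\<integral>\<^sup>+x. ?B x \<partial>lebesgue)"
      unfolding wmeas_def by (rule nn_integral_mono_AE)
    also have "\<dots> = ennreal (m powr e) * wmeas u Q + (\<Sum>k. ennreal (a (Suc k) powr e) * wmeas u (U k))"
      unfolding wmeas_def using Q by (simp add: nn_integral_add nn_integral_suminf nn_integral_cmult)
    also have "\<dots> \<le> ennreal (m powr e * W) + ennreal (m powr e * W * A powr e / (1 - \<rho>))"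
    proof (rule add_mono)
      show "ennreal (m powr e) * wmeas u Q \<le> ennreal (m powr e * W)"
        using W0 by (simp add: W ennreal_mult)
      have "ennreal (a (Suc k) powr e) * wmeas u (U k) \<le> ennreal (m powr e * W * A powr e * \<rho> ^ k)" for k
      proof -
        have "ennreal (a (Suc k) powr e) * wmeas u (U k) \<le> ennreal (a (Suc k) powr e) * ennreal (\<beta> ^ k * W)"
          by (intro mult_left_mono UW) auto
        also have "\<dots> = ennreal (a (Suc k) powr e * (\<beta> ^ k * W))"
          using \<beta> W0 by (intro ennreal_mult[symmetric]) auto
        also have "a (Suc k) powr e * (\<beta> ^ k * W) = m powr e * W * A powr e * \<rho> ^ k"
        proof -
          have "a (Suc k) powr e = (A powr e) ^ Suc k * m powr e"
            using A m by (simp add: a_def powr_mult powr_powr powr_realpow[symmetric] powr_add[symmetric] algebra_simps del: power_Suc)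
          then have "a (Suc k) powr e * (\<beta> ^ k * W) = m powr e * W * A powr e * (A powr e * \<beta>) ^ k"
            by (simp add: power_mult_distrib)
          also have "A powr e * \<beta> = \<rho>" using Ae \<beta> by simp
          finally show ?thesis .
        qed
        finally show ?thesis .
      qed
      then have "(\<Sum>k. ennreal (a (Suc k) powr e) * wmeas u (U k)) \<le> (\<Sum>k. ennreal (m powr e * W * A powr e * \<rho> ^ k))"
        by (intro suminf_le) auto
      also have "\<dots> = ennreal (\<Sum>k. m powr e * W * A powr e * \<rho> ^ k)"
        using W0 \<rho> by (intro suminf_ennreal2 summable_mult summable_geometric) auto
      also have "(\<Sum>k. m powr e * W * A powr e * \<rho> ^ k) = m powr e * W * A powr e / (1 - \<rho>)"
        using \<rho> by (subst suminf_mult) (auto simp: suminf_geometric)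
      finally show "(\<Sum>k. ennreal (a (Suc k) powr e) * wmeas u (U k)) \<le> ennreal (m powr e * W * A powr e / (1 - \<rho>))" .
    qed
    also have "\<dots> = ennreal (m powr e * W + m powr e * W * A powr e / (1 - \<rho>))"
      using W0 \<rho> by (intro ennreal_plus[symmetric]) auto
    also have "m powr e * W + m powr e * W * A powr e / (1 - \<rho>) = C * rvol Q * (m * m powr e)"
      by (simp add: C_def W_def algebra_simps)
    also have "m * m powr e = avg u Q powr (1 + e)"
      using m by (simp add: powr_mult_base m_def[symmetric])
    finally show ?thesis .
  qed
  then show ?thesis using e C by blast
qed


section \<open>Muckenhoupt weights as power bounds\<close>

text \<open>For \<alpha> outside [0, 1] this reverses Jensen's inequality. Measuring every power
  against the average of w gives bounds for different exponents a common scale, so they can be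
  multiplied in Hoelder's inequality.\<close>

definition power_bound :: "(real ^ 'n \<Rightarrow> real) \<Rightarrow> real \<Rightarrow> bool" where
  "power_bound w \<alpha> \<longleftrightarrow> (\<exists>C>0. \<forall>Q. is_cube Q \<longrightarrow>
     wmeas (\<lambda>x. w x powr \<alpha>) Q \<le> ennreal (C * rvol Q * avg w Q powr \<alpha>))"

lemma ennreal_div_mult:
  assumes "0 < m" shows "x / ennreal m * ennreal m = x"
proof -
  have "x / ennreal m * ennreal m = x * ennreal m / ennreal m"
    by (simp add: ennreal_times_divide mult.commute)
  also have "\<dots> = x" using assms by (intro ennreal_mult_divide_eq) auto
  finally show ?thesis .
qed

lemma is_weight_wmeas_finite:
  assumes "is_weight w" "is_cube Q"
  shows "wmeas w Q < \<infinity>"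
proof -
  have "compact Q" using assms(2) by (auto simp: is_cube_def)
  then have "integrable lebesgue (\<lambda>x. indicator Q x *\<^sub>R w x)"
    using assms(1) by (auto simp: is_weight_def set_integrable_def)
  then have "(\<integral>\<^sup>+x. ennreal (norm (indicator Q x *\<^sub>R w x)) \<partial>lebesgue) < \<infinity>"
    by (simp add: integrable_iff_bounded)
  moreover have "ennreal (norm (indicator Q x *\<^sub>R w x)) = ennreal (w x) * indicator Q x" for x
    using assms(1) by (auto simp: is_weight_def split: split_indicator)
  ultimately show ?thesis by (simp add: wmeas_def)
qed

locale positive_weight =
  fixes w :: "real ^ 'n \<Rightarrow> real"
  assumes w_measurable [measurable]: "w \<in> borel_measurable lebesgue"
    and w_nonneg: "\<And>x. 0 \<le> w x"
    and w_pos: "AE x in lebesgue. 0 < w x"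
    and w_finite: "\<And>Q. is_cube Q \<Longrightarrow> wmeas w Q < \<infinity>"
begin

abbreviation W :: "real \<Rightarrow> (real ^ 'n) set \<Rightarrow> ennreal" where
  "W \<alpha> \<equiv> wmeas (\<lambda>x. w x powr \<alpha>)"

lemma wmeas_powr_pos:
  assumes "is_cube Q" shows "0 < W \<alpha> Q"
proof (rule ccontr)
  assume "\<not> 0 < W \<alpha> Q"
  moreover have Q [measurable]: "Q \<in> sets lebesgue" using assms by (auto simp: is_cube_iff)
  ultimately have "AE x in lebesgue. ennreal (w x powr \<alpha>) * indicator Q x = 0"
    unfolding wmeas_def by (subst (asm) zero_less_iff_neq_zero, subst (asm) not_not, subst (asm) nn_integral_0_iff_AE) auto
  with w_pos have "AE x in lebesgue. x \<notin> Q"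
    by eventually_elim (auto split: split_indicator_asm simp: ennreal_eq_0_iff)
  then have "vol Q = 0" using AE_iff_null_sets[OF Q] by (simp add: null_setsD1)
  then show False using emeasure_is_cube[OF assms] measure_cube_pos[OF assms] by simp
qed

lemma wmeas_pos: "is_cube Q \<Longrightarrow> 0 < wmeas w Q"
  using wmeas_powr_pos[of Q 1] w_nonneg by simp

lemma avg_w_pos: "is_cube Q \<Longrightarrow> 0 < avg w Q"
  by (intro avg_pos wmeas_pos w_finite)

lemma wmeas_w: "is_cube Q \<Longrightarrow> wmeas w Q = ennreal (avg w Q * rvol Q)"
  by (intro wmeas_eq_avg w_finite)

definition mass :: "(real ^ 'n) set \<Rightarrow> real" where
  "mass R = avg w R * rvol R"

lemma mass_pos: "is_cube R \<Longrightarrow> 0 < mass R"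
  unfolding mass_def by (intro mult_pos_pos avg_w_pos measure_cube_pos)

lemma wmeas_mass: "is_cube R \<Longrightarrow> wmeas w R = ennreal (mass R)"
  unfolding mass_def by (rule wmeas_w)

text \<open>Hoelder's inequality against the constant 1: a bound passes to every exponent between it
  and 0.\<close>

lemma power_bound_scale:
  assumes "power_bound w \<beta>" "0 < t" "t \<le> 1"
  shows "power_bound w (t * \<beta>)"
proof (cases "t = 1")
  case False
  then have t: "0 < t" "t < 1" using assms by auto
  obtain C where C: "0 < C" "\<And>Q. is_cube Q \<Longrightarrow> W \<beta> Q \<le> ennreal (C * rvol Q * avg w Q powr \<beta>)"
    using assms(1) unfolding power_bound_def by blast
  have "W (t * \<beta>) Q \<le> ennreal (C powr t * rvol Q * avg w Q powr (t * \<beta>))"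
    if Q: "is_cube Q" for Q
  proof -
    let ?m = "rvol Q"
    have m: "0 < ?m" by (rule measure_cube_pos[OF Q])
    have [measurable]: "Q \<in> sets lebesgue" using Q by (auto simp: is_cube_iff)
    have "(\<integral>\<^sup>+x\<in>Q. ennreal ((w x powr \<beta>) powr t * 1 powr (1 - t)) \<partial>lebesgue)
        \<le> ennreal ((C * ?m * avg w Q powr \<beta>) powr t * ?m powr (1 - t))"
      using C(2)[OF Q] m C(1) t emeasure_is_cube[OF Q] unfolding wmeas_def
      by (intro set_nn_integral_holder) auto
    also have "(C * ?m * avg w Q powr \<beta>) powr t * ?m powr (1 - t) = C powr t * (?m powr t * ?m powr (1 - t)) * avg w Q powr (t * \<beta>)"
      using m C(1) by (simp add: powr_mult powr_powr mult_ac)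
    also have "?m powr t * ?m powr (1 - t) = ?m" using m by (simp add: powr_add[symmetric])
    finally show ?thesis by (simp add: wmeas_def powr_powr mult.commute)
  qed
  moreover have "0 < C powr t" using C by simp
  ultimately show ?thesis unfolding power_bound_def by blast
qed (use assms in simp)

text \<open>As the exponents have opposite signs, 1 = (w^\<alpha>)^t (w^\<beta>)^(1-t) almost
  everywhere for some t in (0, 1). Hoelder's inequality on E then shows that a set with little
  w^\<alpha>-mass has little volume.\<close>

lemma power_bound_mass:
  assumes \<alpha>\<beta>: "\<alpha> * \<beta> < 0" and P\<beta>: "power_bound w \<beta>" and P\<alpha>: "power_bound w \<alpha>"
  defines "t \<equiv> \<beta> / (\<beta> - \<alpha>)"
  shows "\<exists>C>0. \<forall>Q E. is_cube Q \<longrightarrow> E \<in> sets lebesgue \<longrightarrow> E \<subseteq> Q \<longrightarrow>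
    rvol E \<le> C * rvol Q *
      (enn2real (W \<alpha> E) / (rvol Q * avg w Q powr \<alpha>)) powr t"
proof -
  have t: "0 < t" "t < 1" "\<alpha> * t + \<beta> * (1 - t) = 0"
    using \<alpha>\<beta> by (auto simp: t_def mult_less_0_iff field_simps)
  obtain C where C: "0 < C" "\<And>Q. is_cube Q \<Longrightarrow> W \<beta> Q \<le> ennreal (C * rvol Q * avg w Q powr \<beta>)"
    using P\<beta> unfolding power_bound_def by blast
  have "rvol E \<le> C powr (1 - t) * rvol Q *
      (enn2real (W \<alpha> E) / (rvol Q * avg w Q powr \<alpha>)) powr t"
    if Q: "is_cube Q" and E [measurable]: "E \<in> sets lebesgue" and EQ: "E \<subseteq> Q" for Q E
  proof -
    let ?m = "rvol Q" and ?W = "enn2real (W \<alpha> E)"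
    have m: "0 < ?m" by (rule measure_cube_pos[OF Q])
    have a: "0 < avg w Q" by (rule avg_w_pos[OF Q])
    have "W \<alpha> Q < \<infinity>"
      using P\<alpha> Q unfolding power_bound_def by (auto simp: order_le_less_trans[OF _ ennreal_less_top])
    then have W: "W \<alpha> E = ennreal ?W"
      using wmeas_mono[OF EQ, of "\<lambda>x. w x powr \<alpha>"] by (simp add: order_le_less_trans)
    have fin: "vol E < \<infinity>"
      using emeasure_mono[OF EQ, of lebesgue] emeasure_is_cube[OF Q] Q by (auto simp: is_cube_iff order_le_less_trans)
    have "ennreal (rvol E) = vol E"
      using fin by (simp add: emeasure_eq_ennreal_measure)
    also have "\<dots> = (\<integral>\<^sup>+x\<in>E. ennreal ((w x powr \<alpha>) powr t * (w x powr \<beta>) powr (1 - t)) \<partial>lebesgue)"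
    proof -
      have "vol E = (\<integral>\<^sup>+x. indicator E x \<partial>lebesgue)" by simp
      also have "\<dots> = (\<integral>\<^sup>+x\<in>E. ennreal ((w x powr \<alpha>) powr t * (w x powr \<beta>) powr (1 - t)) \<partial>lebesgue)"
      proof (rule nn_integral_cong_AE)
        show "AE x in lebesgue. indicator E x = ennreal ((w x powr \<alpha>) powr t * (w x powr \<beta>) powr (1 - t)) * indicator E x"
          using w_pos by eventually_elim (simp add: powr_powr powr_add[symmetric] t(3))
      qed
      finally show ?thesis .
    qed
    also have "\<dots> \<le> ennreal (?W powr t * (C * ?m * avg w Q powr \<beta>) powr (1 - t))"
      using t W C m wmeas_mono[OF EQ, of "\<lambda>x. w x powr \<beta>"] C(2)[OF Q] unfolding wmeas_def
      by (intro set_nn_integral_holder) auto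
    finally have "rvol E \<le> ?W powr t * (C * ?m * avg w Q powr \<beta>) powr (1 - t)"
      by (subst (asm) ennreal_le_iff) auto
    also have "\<dots> = C powr (1 - t) * ?m powr (1 - t) * ?W powr t * avg w Q powr (\<beta> * (1 - t))"
      using C m by (simp add: powr_mult powr_powr mult_ac)
    also have "\<beta> * (1 - t) = - (\<alpha> * t)" using t(3) by linarith
    also have "C powr (1 - t) * ?m powr (1 - t) * ?W powr t * avg w Q powr (- (\<alpha> * t))
       = C powr (1 - t) * ?m * (?W / (?m * avg w Q powr \<alpha>)) powr t"
      using m a by (simp add: powr_divide powr_mult powr_powr powr_minus powr_diff field_simps)
    finally show ?thesis .
  qed
  moreover have "0 < C powr (1 - t)" using C by simp
  ultimately show ?thesis by blast
qed

text \<open>The complement of E has at least half the volume of Q, hence by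
  \<open>power_bound_mass\<close> at least a fixed fraction d of the w^\<alpha>-mass of Q. This
  fraction is missing from E.\<close>

lemma power_bound_decay:
  assumes \<alpha>\<beta>: "\<alpha> * \<beta> < 0" and P\<beta>: "power_bound w \<beta>" and P\<alpha>: "power_bound w \<alpha>"
  shows "\<exists>\<delta>. 0 < \<delta> \<and> \<delta> < 1 \<and> (\<forall>Q E. is_cube Q \<longrightarrow> E \<in> sets lebesgue \<longrightarrow> E \<subseteq> Q \<longrightarrow>
     2 * vol E \<le> vol Q \<longrightarrow>
     W \<alpha> E \<le> ennreal \<delta> * W \<alpha> Q)"
proof -
  define t where "t = \<beta> / (\<beta> - \<alpha>)"
  have t: "0 < t" using \<alpha>\<beta> by (auto simp: t_def mult_less_0_iff field_simps)
  obtain C where C: "0 < C" "\<And>Q E. is_cube Q \<Longrightarrow> E \<in> sets lebesgue \<Longrightarrow> E \<subseteq> Q \<Longrightarrow>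
    rvol E \<le> C * rvol Q *
      (enn2real (W \<alpha> E) / (rvol Q * avg w Q powr \<alpha>)) powr t"
    using power_bound_mass[OF assms] unfolding t_def by blast
  obtain K where K: "0 < K" "\<And>Q. is_cube Q \<Longrightarrow> W \<alpha> Q \<le> ennreal (K * rvol Q * avg w Q powr \<alpha>)"
    using P\<alpha> unfolding power_bound_def by blast
  \<comment> \<open>Half the volume forces w^\<alpha>-mass at least (1/(2C))^(1/t) times the volume
    and the \<alpha>-th power of the average; K relates this scale to the mass of Q.\<close>
  define d where "d = (1 / (2 * C)) powr (1 / t) / K"
  have d: "0 < d" using C K by (simp add: d_def)
  \<comment> \<open>The maximum with 1/2 keeps \<delta> positive even when d is at least 1.\<close>
  define \<delta> where "\<delta> = max (1 - d) (1 / 2)"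
  have \<delta>: "0 < \<delta>" "\<delta> < 1" "1 - d \<le> \<delta>" using d by (auto simp: \<delta>_def)
  have "W \<alpha> E \<le> ennreal \<delta> * W \<alpha> Q"
    if Q: "is_cube Q" and E [measurable]: "E \<in> sets lebesgue" and EQ: "E \<subseteq> Q"
      and half: "2 * vol E \<le> vol Q" for Q E
  proof -
    let ?m = "rvol Q" and ?u = "\<lambda>x. w x powr \<alpha>"
    have m: "0 < ?m" by (rule measure_cube_pos[OF Q])
    have a: "0 < avg w Q" by (rule avg_w_pos[OF Q])
    have [measurable]: "Q \<in> sets lebesgue" using Q by (auto simp: is_cube_iff)
    have Qlm: "Q \<in> lmeasurable" using Q by (auto simp: is_cube_iff lmeasurable_cube)
    have Elm: "E \<in> lmeasurable" using Qlm EQ E by (rule fmeasurableI2)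
    have finQ: "wmeas ?u Q < \<infinity>" using K(2)[OF Q] by (auto simp: order_le_less_trans[OF _ ennreal_less_top])
    define x where "x = enn2real (wmeas ?u E)"
    define y where "y = enn2real (wmeas ?u (Q - E))"
    define z where "z = enn2real (wmeas ?u Q)"
    have x: "wmeas ?u E = ennreal x"
      using wmeas_mono[OF EQ, of ?u] finQ by (simp add: x_def order_le_less_trans)
    have y: "wmeas ?u (Q - E) = ennreal y"
      using wmeas_mono[of "Q - E" Q ?u] finQ by (simp add: y_def order_le_less_trans)
    have z: "wmeas ?u Q = ennreal z" using finQ by (simp add: z_def)
    have nn: "0 \<le> x" "0 \<le> y" "0 \<le> z" by (auto simp: x_def y_def z_def)
    have "wmeas ?u Q = wmeas ?u E + wmeas ?u (Q - E)"
    proof -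
      have "wmeas ?u E + wmeas ?u (Q - E) =
         (\<integral>\<^sup>+x. ennreal (?u x) * indicator E x + ennreal (?u x) * indicator (Q - E) x \<partial>lebesgue)"
        unfolding wmeas_def by (rule nn_integral_add[symmetric]) auto
      also have "\<dots> = wmeas ?u Q"
        unfolding wmeas_def using EQ by (intro nn_integral_cong) (auto split: split_indicator)
      finally show ?thesis ..
    qed
    then have xyz: "z = x + y" using x y z nn by (simp flip: ennreal_plus)
    have "2 * rvol E \<le> ?m"
      using half Qlm Elm nn by (simp add: emeasure_eq_measure2 ennreal_le_iff flip: ennreal_numeral ennreal_mult)
    then have "?m / 2 \<le> rvol (Q - E)"
      using measurable_measure_Diff[OF Qlm E EQ] by simp
    also have "\<dots> \<le> C * ?m * (y / (?m * avg w Q powr \<alpha>)) powr t"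
      unfolding y_def by (intro C(2) Q) auto
    finally have "?m * (1 / (2 * C)) \<le> ?m * (y / (?m * avg w Q powr \<alpha>)) powr t"
      using C(1) by (simp add: field_simps)
    then have "1 / (2 * C) \<le> (y / (?m * avg w Q powr \<alpha>)) powr t"
      using m by (rule mult_left_le_imp_le)
    then have "(1 / (2 * C)) powr (1 / t) \<le> ((y / (?m * avg w Q powr \<alpha>)) powr t) powr (1 / t)"
      using C t by (intro powr_mono2) auto
    also have "\<dots> = y / (?m * avg w Q powr \<alpha>)" using t m a nn by (simp add: powr_powr)
    finally have y_ge: "K * d * (?m * avg w Q powr \<alpha>) \<le> y" using m a K by (simp add: d_def field_simps)
    have "z \<le> K * ?m * avg w Q powr \<alpha>"
      using K(2)[OF Q] z K(1) m by (simp add: ennreal_le_iff)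
    then have "d * z \<le> d * (K * ?m * avg w Q powr \<alpha>)" using d by (intro mult_left_mono) auto
    also have "\<dots> = K * d * (?m * avg w Q powr \<alpha>)" by (simp only: mult_ac)
    also note y_ge
    finally have "d * z \<le> y" .
    then have "x \<le> (1 - d) * z" using xyz by (simp add: algebra_simps)
    also have "\<dots> \<le> \<delta> * z" using \<delta> nn by (intro mult_right_mono) auto
    finally show ?thesis unfolding x z using \<delta> nn by (simp add: ennreal_mult'[symmetric] ennreal_leI)
  qed
  then show ?thesis using \<delta> by blast
qed

text \<open>For \<open>\<alpha> < 0\<close> this improves the Muckenhoupt condition, for \<open>\<alpha> > 1\<close> the reverse Hoelder condition.\<close>

theorem power_bound_improve:
  assumes "\<alpha> * \<beta> < 0" "power_bound w \<beta>" "power_bound w \<alpha>"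
  shows "\<exists>e>0. power_bound w (\<alpha> * (1 + e))"
proof -
  let ?u = "\<lambda>x. w x powr \<alpha>"
  obtain \<delta> where \<delta>: "0 < \<delta>" "\<delta> < 1" "\<And>Q E. is_cube Q \<Longrightarrow> E \<in> sets lebesgue \<Longrightarrow> E \<subseteq> Q \<Longrightarrow>
     2 * vol E \<le> vol Q \<Longrightarrow> wmeas ?u E \<le> ennreal \<delta> * wmeas ?u Q"
    using power_bound_decay[OF assms] by blast
  obtain K where K: "0 < K" "\<And>Q. is_cube Q \<Longrightarrow> wmeas ?u Q \<le> ennreal (K * rvol Q * avg w Q powr \<alpha>)"
    using assms(3) unfolding power_bound_def by blast
  have fin: "wmeas ?u Q < \<infinity>" if "is_cube Q" for Q
    using K(2)[OF that] by (auto simp: order_le_less_trans[OF _ ennreal_less_top])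
  obtain e C where e: "0 < e" and C: "0 < C" "\<And>Q. is_cube Q \<Longrightarrow>
     wmeas (\<lambda>x. ?u x powr (1 + e)) Q \<le> ennreal (C * rvol Q * avg ?u Q powr (1 + e))"
    using reverse_holder_of_decay[of ?u \<delta>] \<delta> fin wmeas_powr_pos[of _ \<alpha>] by auto
  have "W (\<alpha> * (1 + e)) Q
      \<le> ennreal (C * K powr (1 + e) * rvol Q * avg w Q powr (\<alpha> * (1 + e)))" if Q: "is_cube Q" for Q
  proof -
    have m: "0 < rvol Q" by (rule measure_cube_pos[OF Q])
    have "avg ?u Q * rvol Q \<le> K * rvol Q * avg w Q powr \<alpha>"
      using K(2)[OF Q] K(1) m unfolding wmeas_eq_avg[OF Q fin[OF Q]] by (subst (asm) ennreal_le_iff) auto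
    then have "avg ?u Q \<le> K * avg w Q powr \<alpha>" using m by (simp add: mult_ac)
    then have "avg ?u Q powr (1 + e) \<le> (K * avg w Q powr \<alpha>) powr (1 + e)"
      using e by (intro powr_mono2) (auto simp: avg_def)
    also have "\<dots> = K powr (1 + e) * avg w Q powr (\<alpha> * (1 + e))" using K by (simp add: powr_mult powr_powr)
    finally have "C * rvol Q * avg ?u Q powr (1 + e)
       \<le> C * rvol Q * (K powr (1 + e) * avg w Q powr (\<alpha> * (1 + e)))"
      using C m by (intro mult_left_mono) auto
    then show ?thesis using C(2)[OF Q] by (simp add: powr_powr mult_ac order_trans[OF _ ennreal_leI])
  qed
  moreover have "0 < C * K powr (1 + e)" using C K by simp
  ultimately show ?thesis using e unfolding power_bound_def by blast
qed

text \<open>\<open>power_bound_mass\<close> with \<alpha> = 1, for which the power bound is trivial,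
  and with Q as subset of R: a small mass ratio would force a small volume ratio.\<close>

lemma doubling:
  assumes "power_bound w \<beta>" "\<beta> < 0" "0 < \<Lambda>"
  shows "\<exists>C>0. \<forall>Q R. is_cube Q \<longrightarrow> is_cube R \<longrightarrow> Q \<subseteq> R \<longrightarrow>
     rvol R \<le> \<Lambda> * rvol Q \<longrightarrow> mass R \<le> C * mass Q"
proof -
  have P1: "power_bound w 1"
    unfolding power_bound_def
  proof (intro exI[of _ 1] conjI allI impI)
    fix Q :: "(real ^ 'n) set" assume Q: "is_cube Q"
    show "W 1 Q \<le> ennreal (1 * rvol Q * avg w Q powr 1)"
      using wmeas_w[OF Q] avg_w_pos[OF Q] w_nonneg by (simp add: mult.commute)
  qed simp
  define t where "t = \<beta> / (\<beta> - 1)"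
  have t: "0 < t" using assms by (auto simp: t_def divide_neg_neg)
  obtain C where C: "0 < C" "\<And>Q E. is_cube Q \<Longrightarrow> E \<in> sets lebesgue \<Longrightarrow> E \<subseteq> Q \<Longrightarrow>
    rvol E \<le> C * rvol Q *
      (enn2real (W 1 E) / (rvol Q * avg w Q powr 1)) powr t"
    using power_bound_mass[OF _ assms(1) P1] assms(2) unfolding t_def by auto
  define K where "K = (C * \<Lambda>) powr (1 / t)"
  have K: "0 < K" using C assms by (simp add: K_def)
  have "mass R \<le> K * mass Q"
    if Q: "is_cube Q" and R: "is_cube R" and QR: "Q \<subseteq> R" and le: "rvol R \<le> \<Lambda> * rvol Q" for Q R
  proof -
    have pos: "0 < mass Q" "0 < mass R" by (rule mass_pos[OF Q], rule mass_pos[OF R])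
    have m: "0 < rvol R" "0 < rvol Q" by (rule measure_cube_pos[OF R], rule measure_cube_pos[OF Q])
    have "rvol R / \<Lambda> \<le> rvol Q" using le assms(3) by (simp add: field_simps)
    also have "\<dots> \<le> C * rvol R * (mass Q / mass R) powr t"
      using C(2)[OF R _ QR] Q wmeas_w[OF Q] avg_w_pos[OF R] pos w_nonneg
      by (auto simp: is_cube_iff mass_def mult.commute)
    finally have "rvol R * (1 / (C * \<Lambda>)) \<le> rvol R * (mass Q / mass R) powr t"
      using C(1) assms(3) by (simp add: field_simps)
    then have "1 / (C * \<Lambda>) \<le> (mass Q / mass R) powr t" using m(1) by (rule mult_left_le_imp_le)
    then have "(1 / (C * \<Lambda>)) powr (1 / t) \<le> ((mass Q / mass R) powr t) powr (1 / t)"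
      using C t assms(3) by (intro powr_mono2) auto
    also have "\<dots> = mass Q / mass R" using t pos by (simp add: powr_powr)
    also have "(1 / (C * \<Lambda>)) powr (1 / t) = 1 / K" using C assms(3) by (simp add: K_def powr_divide)
    finally show ?thesis using pos K by (simp add: field_simps)
  qed
  then show ?thesis using K by blast
qed

text \<open>Hoelder's inequality on Q with the reverse Hoelder bound taken over the larger cube R.
  In contrast to \<open>doubling\<close>, this bounds the mass of Q from above, so masses of dilates
  must grow at a definite rate.\<close>

lemma mass_ratio_le:
  assumes "power_bound w \<sigma>" "1 < \<sigma>"
  shows "\<exists>C>0. \<forall>Q R. is_cube Q \<longrightarrow> is_cube R \<longrightarrow> Q \<subseteq> R \<longrightarrow>
     mass Q \<le> C * mass R * (rvol Q / rvol R) powr (1 - 1 / \<sigma>)"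
proof -
  define t where "t = 1 / \<sigma>"
  have t: "0 < t" "t < 1" "\<sigma> * t = 1" using assms by (auto simp: t_def)
  obtain C where C: "0 < C" "\<And>Q. is_cube Q \<Longrightarrow> W \<sigma> Q \<le> ennreal (C * rvol Q * avg w Q powr \<sigma>)"
    using assms(1) unfolding power_bound_def by blast
  have "mass Q \<le> C powr t * mass R * (rvol Q / rvol R) powr (1 - t)"
    if Q: "is_cube Q" and R: "is_cube R" and QR: "Q \<subseteq> R" for Q R
  proof -
    let ?q = "rvol Q" and ?r = "rvol R" and ?a = "avg w R"
    have m: "0 < ?r" "0 < ?q" "0 < ?a" by (rule measure_cube_pos[OF R], rule measure_cube_pos[OF Q], rule avg_w_pos[OF R])
    have [measurable]: "Q \<in> sets lebesgue" using Q by (auto simp: is_cube_iff)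
    have "ennreal (mass Q) = (\<integral>\<^sup>+x\<in>Q. ennreal ((w x powr \<sigma>) powr t * 1 powr (1 - t)) \<partial>lebesgue)"
      using wmeas_mass[OF Q] t(3) w_nonneg by (simp add: wmeas_def powr_powr)
    also have "\<dots> \<le> ennreal ((C * ?r * ?a powr \<sigma>) powr t * ?q powr (1 - t))"
    proof (rule set_nn_integral_holder)
      show "(\<integral>\<^sup>+x\<in>Q. ennreal (w x powr \<sigma>) \<partial>lebesgue) \<le> ennreal (C * ?r * ?a powr \<sigma>)"
        using order_trans[OF wmeas_mono[OF QR] C(2)[OF R]] by (simp add: wmeas_def)
    qed (use t m C(1) emeasure_is_cube[OF Q] in auto)
    finally have "mass Q \<le> (C * ?r * ?a powr \<sigma>) powr t * ?q powr (1 - t)"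
      by (subst (asm) ennreal_le_iff) auto
    also have "\<dots> = C powr t * (?a * ?r) * (?q / ?r) powr (1 - t)"
      using m C(1) t by (simp add: powr_mult powr_powr powr_divide powr_diff field_simps)
    finally show ?thesis by (simp only: mass_def)
  qed
  moreover have "0 < C powr t" using C by simp
  ultimately show ?thesis unfolding t_def by blast
qed

end

lemma positive_weight_muckenhoupt:
  "w \<in> muckenhoupt p \<Longrightarrow> positive_weight w"
  by standard (use is_weight_wmeas_finite[of w] in \<open>auto simp: muckenhoupt_def is_weight_def\<close>)

lemma wmeas_le_of_average:
  assumes Q: "is_cube Q" and a: "0 < a" and z: "0 \<le> z" and le: "epowr (wmeas u Q / vol Q) a \<le> ennreal z"
  shows "wmeas u Q \<le> ennreal (z powr (1 / a) * rvol Q)"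
proof -
  have "epowr (wmeas u Q / vol Q) (1 / (1 / a)) \<le> ennreal z" using le by simp
  then have "wmeas u Q / vol Q \<le> ennreal (z powr (1 / a))"
    using a z by (subst (asm) epowr_inverse_le_iff) (auto simp: epowr_ennreal)
  then have "wmeas u Q / vol Q * vol Q \<le> ennreal (z powr (1 / a)) * vol Q"
    by (rule mult_right_mono) simp
  then show ?thesis
    unfolding emeasure_is_cube[OF Q] ennreal_div_mult[OF measure_cube_pos[OF Q]]
    by (simp add: ennreal_mult)
qed

lemma wmeas_w_average: "positive_weight w \<Longrightarrow> is_cube Q \<Longrightarrow> wmeas w Q / vol Q = ennreal (avg w Q)"
  using positive_weight.avg_w_pos[of w Q] measure_cube_pos[of Q]
  by (simp add: positive_weight.wmeas_w emeasure_is_cube divide_ennreal)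

lemma power_bound_muckenhoupt:
  assumes w: "w \<in> muckenhoupt p" and p: "1 < p"
  shows "power_bound w (- 1 / (p - 1))"
proof -
  interpret positive_weight w by (rule positive_weight_muckenhoupt[OF w])
  define K where "K = enn2real (muckenhoupt_const p w) + 1"
  have Kpos: "0 < K" by (simp add: K_def add_nonneg_pos)
  have K: "muckenhoupt_const p w \<le> ennreal K"
  proof -
    have "muckenhoupt_const p w = ennreal (enn2real (muckenhoupt_const p w))"
      using w by (simp add: muckenhoupt_def)
    also have "\<dots> \<le> ennreal K" by (intro ennreal_leI) (simp add: K_def)
    finally show ?thesis .
  qed
  have e: "1 - conj_exp p = - 1 / (p - 1)" using p by (simp add: conj_exp_def field_simps)
  let ?e = "- 1 / (p - 1)"
  have "wmeas (\<lambda>x. w x powr ?e) Q \<le> ennreal (K powr (1 / (p - 1)) * rvol Q * avg w Q powr ?e)"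
    if Q: "is_cube Q" for Q
  proof -
    let ?W = "wmeas (\<lambda>x. w x powr ?e) Q" and ?m = "rvol Q" and ?a = "avg w Q"
    have m: "0 < ?m" "0 < ?a" by (rule measure_cube_pos[OF Q], rule avg_w_pos[OF Q])
    have "wmeas w Q / vol Q * epowr (?W / vol Q) (p - 1) \<le> muckenhoupt_const p w"
      unfolding muckenhoupt_const_def e using Q by (intro SUP_upper) auto
    also note K
    finally have le: "wmeas w Q / vol Q * epowr (?W / vol Q) (p - 1) \<le> ennreal K" .
    then have le: "ennreal ?a * epowr (?W / vol Q) (p - 1) \<le> ennreal K"
      by (simp add: wmeas_w_average[OF positive_weight_axioms Q])
    have "ennreal (1 / ?a) * ennreal ?a = 1" using m by (simp flip: ennreal_mult)
    then have "epowr (?W / vol Q) (p - 1) = ennreal (1 / ?a) * (ennreal ?a * epowr (?W / vol Q) (p - 1))"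
      by (simp flip: mult.assoc)
    also have "\<dots> \<le> ennreal (1 / ?a) * ennreal K" by (intro mult_left_mono le) simp
    also have "\<dots> = ennreal (K / ?a)" using m Kpos by (simp flip: ennreal_mult)
    finally have "?W \<le> ennreal ((K / ?a) powr (1 / (p - 1)) * ?m)"
      using p m Kpos by (intro wmeas_le_of_average Q) auto
    also have "(K / ?a) powr (1 / (p - 1)) = K powr (1 / (p - 1)) * ?a powr ?e"
      by (simp add: powr_divide powr_minus_divide)
    finally show ?thesis by (simp add: mult_ac)
  qed
  then show ?thesis unfolding power_bound_def using Kpos by (intro exI[of _ "K powr (1 / (p - 1))"]) auto
qed

lemma power_bound_reverse_holder:
  assumes w: "w \<in> reverse_holder \<sigma>" and "positive_weight w" and \<sigma>: "0 < \<sigma>"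
  shows "power_bound w \<sigma>"
proof -
  interpret positive_weight w by fact
  obtain c where c: "\<And>Q. is_cube Q \<Longrightarrow>
      epowr (wmeas (\<lambda>x. w x powr \<sigma>) Q / vol Q) (1 / \<sigma>) \<le> ennreal c * (wmeas w Q / vol Q)"
    using w by (auto simp: reverse_holder_def)
  \<comment> \<open>The constant in \<open>reverse_holder\<close> comes without a sign.\<close>
  define K where "K = max c 1"
  have K: "0 < K" "c \<le> K" by (auto simp: K_def)
  have "wmeas (\<lambda>x. w x powr \<sigma>) Q \<le> ennreal (K powr \<sigma> * rvol Q * avg w Q powr \<sigma>)"
    if Q: "is_cube Q" for Q
  proof -
    let ?W = "wmeas (\<lambda>x. w x powr \<sigma>) Q" and ?m = "rvol Q" and ?a = "avg w Q"
    have m: "0 < ?m" "0 < ?a" by (rule measure_cube_pos[OF Q], rule avg_w_pos[OF Q])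
    have "epowr (?W / vol Q) (1 / \<sigma>) \<le> ennreal K * (wmeas w Q / vol Q)"
      using order_trans[OF c[OF Q] mult_right_mono[OF ennreal_leI[OF K(2)]]] by simp
    also have "\<dots> = ennreal (K * ?a)"
      using K m by (simp add: wmeas_w_average[OF positive_weight_axioms Q] ennreal_mult)
    finally have "?W \<le> ennreal ((K * ?a) powr (1 / (1 / \<sigma>)) * ?m)"
      using \<sigma> K m by (intro wmeas_le_of_average Q) auto
    then show ?thesis by (simp add: powr_mult mult_ac)
  qed
  then show ?thesis unfolding power_bound_def using K by (intro exI[of _ "K powr \<sigma>"]) auto
qed


section \<open>Maximal functions\<close>

text \<open>For a second factor that may be infinite, as maximal functions can be; its finite
  integral confines the value \<infinity> to a null set.\<close>

lemma set_nn_integral_holder_ennreal: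
  fixes F :: "'a \<Rightarrow> real" and G :: "'a \<Rightarrow> ennreal"
  assumes [measurable]: "F \<in> borel_measurable M" "G \<in> borel_measurable M" "E \<in> sets M"
    and F: "\<And>x. 0 \<le> F x"
    and t: "0 < t" "t < 1"
    and A: "(\<integral>\<^sup>+x\<in>E. ennreal (F x) \<partial>M) \<le> ennreal A" "0 \<le> A"
    and B: "(\<integral>\<^sup>+x. G x \<partial>M) \<le> ennreal B" "0 \<le> B"
  shows "(\<integral>\<^sup>+x\<in>E. ennreal (F x powr t) * epowr (G x) (1 - t) \<partial>M) \<le> ennreal (A powr t * B powr (1 - t))"
proof -
  have fin: "AE x in M. G x \<noteq> \<infinity>"
    using B by (intro nn_integral_noteq_infinite) (auto simp: top_unique)
  have "(\<integral>\<^sup>+x\<in>E. ennreal (F x powr t) * epowr (G x) (1 - t) \<partial>M)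
      = (\<integral>\<^sup>+x\<in>E. ennreal (F x powr t * enn2real (G x) powr (1 - t)) \<partial>M)"
  proof (rule nn_integral_cong_AE)
    show "AE x in M. ennreal (F x powr t) * epowr (G x) (1 - t) * indicator E x
        = ennreal (F x powr t * enn2real (G x) powr (1 - t)) * indicator E x"
      using fin
    proof eventually_elim
      case (elim x)
      then obtain r where "G x = ennreal r" "0 \<le> r" by (cases "G x") auto
      then show ?case using t by (simp add: epowr_ennreal ennreal_mult)
    qed
  qed
  also have "\<dots> \<le> ennreal (A powr t * B powr (1 - t))"
  proof (rule set_nn_integral_holder)
    have "(\<integral>\<^sup>+x\<in>E. ennreal (enn2real (G x)) \<partial>M) \<le> (\<integral>\<^sup>+x. G x \<partial>M)"
      by (intro nn_integral_mono) (auto split: split_indicator simp: ennreal_enn2real_if)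
    then show "(\<integral>\<^sup>+x\<in>E. ennreal (enn2real (G x)) \<partial>M) \<le> ennreal B" using B by simp
  qed (use t A B F in auto)
  finally show ?thesis .
qed

text \<open>This is \<open>cell_max\<close> for Lebesgue measure and the cells
  \<open>dcell a l\<close>, named outside the locale because several grids occur together.\<close>

definition dyadic_max :: "real ^ 'n \<Rightarrow> real \<Rightarrow> (real ^ 'n \<Rightarrow> real) \<Rightarrow> real ^ 'n \<Rightarrow> ennreal" where
  "dyadic_max a l g x = (SUP k. (\<integral>\<^sup>+y\<in>dcell a l k x. ennreal (g y) \<partial>lebesgue) / vol (dcell a l k x))"

lemma borel_measurable_dyadic_max:
  assumes "0 < l" shows "dyadic_max a l g \<in> borel_measurable lebesgue"
proof -
  interpret nested_partition lebesgue "dcell a l" by (rule nested_partition_dcell[OF assms])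
  have "dyadic_max a l g = cell_max g" by (auto simp: dyadic_max_def cell_max_def)
  then show ?thesis by simp
qed

context positive_weight
begin

text \<open>Supplies the Fubini step of \<open>cell_max_strong\<close> for the weighted
  measure.\<close>

lemma sigma_finite_density_powr:
  assumes "power_bound w \<alpha>"
  shows "sigma_finite_measure (density lebesgue (\<lambda>x. ennreal (w x powr \<alpha>)))"
proof
  define c :: "nat \<Rightarrow> (real ^ 'n) set" where "c = (\<lambda>m. cube (\<chi> i. - real m) (2 * real m + 1))"
  have cov: "(\<Union>m. c m) = UNIV"
  proof (intro set_eqI iffI)
    fix x :: "real ^ 'n"
    obtain m where m: "norm x \<le> real m" using real_arch_simple by blast
    have "x \<in> c m"
      unfolding c_def mem_cube
    proof (intro allI)
      fix i
      show "(\<chi> i. - real m) $ i \<le> x $ i \<and> x $ i \<le> (\<chi> i. - real m) $ i + (2 * real m + 1)"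
        using component_le_norm_cart[of x i] m by auto
    qed
    then show "x \<in> (\<Union>m. c m)" by blast
  qed simp
  have fin: "emeasure (density lebesgue (\<lambda>x. ennreal (w x powr \<alpha>))) (c m) \<noteq> \<infinity>" for m
  proof -
    have "is_cube (c m)" unfolding c_def by (intro is_cube_cube) simp
    then have "wmeas (\<lambda>x. w x powr \<alpha>) (c m) < \<infinity>"
      using assms by (auto simp: power_bound_def order_le_less_trans[OF _ ennreal_less_top])
    then show ?thesis by (simp add: emeasure_density wmeas_def c_def)
  qed
  show "\<exists>A. countable A \<and> A \<subseteq> sets (density lebesgue (\<lambda>x. ennreal (w x powr \<alpha>))) \<and>
      \<Union>A = space (density lebesgue (\<lambda>x. ennreal (w x powr \<alpha>))) \<and>
      (\<forall>a\<in>A. emeasure (density lebesgue (\<lambda>x. ennreal (w x powr \<alpha>))) a \<noteq> \<infinity>)"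
    using cov fin by (intro exI[of _ "range c"]) (auto simp: c_def)
qed

text \<open>The gap between \<open>t\<^sub>0\<close> and \<open>t\<close> makes \<open>dyadic_max g\<close> dominated by the weighted maximal function
  of \<open>g\<^bsup>t\<^sub>0\<^esup>\<close>, which is bounded on \<open>L\<^bsub>t/t\<^sub>0\<^esub>\<close> without any condition on the weight.\<close>

theorem dyadic_max_bound:
  assumes T: "1 < T" and t0: "1 < t0" "t0 < t"
    and P1: "power_bound w (1 - T)" and P2: "power_bound w ((T - 1) / (t0 - 1))"
  shows "\<exists>C>0. \<forall>a l g. 0 < l \<longrightarrow> g \<in> borel_measurable lebesgue \<longrightarrow> (\<forall>x. 0 \<le> g x) \<longrightarrow>
    (\<integral>\<^sup>+x. epowr (dyadic_max a l g x) t * ennreal (w x powr (1 - T)) \<partial>lebesgue)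
      \<le> ennreal C * (\<integral>\<^sup>+x. ennreal (g x powr t * w x powr (1 - T)) \<partial>lebesgue)"
proof -
  let ?v = "\<lambda>x. w x powr (1 - T)" and ?\<theta> = "(T - 1) / (t0 - 1)"
  obtain C1 where C1: "0 < C1" "\<And>Q. is_cube Q \<Longrightarrow> wmeas ?v Q \<le> ennreal (C1 * rvol Q * avg w Q powr (1 - T))"
    using P1 unfolding power_bound_def by blast
  obtain C2 where C2: "0 < C2" "\<And>Q. is_cube Q \<Longrightarrow> wmeas (\<lambda>x. w x powr ?\<theta>) Q \<le> ennreal (C2 * rvol Q * avg w Q powr ?\<theta>)"
    using P2 unfolding power_bound_def by blast
  define K where "K = C1 powr (1 / t0) * C2 powr (1 - 1 / t0)"
  have K: "0 < K" using C1 C2 by (simp add: K_def)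
  define u where "u = t / t0"
  have u: "1 < u" using t0 by (simp add: u_def)
  define C where "C = K powr t * (u * 2 powr u / (u - 1))"
  have C: "0 < C" using K u by (simp add: C_def)
  define N where "N = density lebesgue (\<lambda>x. ennreal (?v x))"
  have setsN [measurable_cong]: "sets N = sets lebesgue" by (simp add: N_def)
  have sf: "sigma_finite_measure N" unfolding N_def by (rule sigma_finite_density_powr[OF P1])
  have "(\<integral>\<^sup>+x. epowr (dyadic_max a l g x) t * ennreal (?v x) \<partial>lebesgue)
      \<le> ennreal C * (\<integral>\<^sup>+x. ennreal (g x powr t * ?v x) \<partial>lebesgue)"
    if l: "0 < l" and g [measurable]: "g \<in> borel_measurable lebesgue" and g0: "\<forall>x. 0 \<le> g x" for a l g
  proof -
    interpret L: nested_partition lebesgue "dcell a l" by (rule nested_partition_dcell[OF l])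
    \<comment> \<open>The same cells, now measured by w^(1-T) instead of volume.\<close>
    interpret nested_partition N "dcell a l"
      using L.cell_self L.cell_eq L.cell_nested L.cell_sets L.countable_cells
      by unfold_locales (simp_all only: setsN, auto simp: N_def)
    define F where "F = (\<lambda>x. g x powr t0)"
    have Fm [measurable]: "F \<in> borel_measurable lebesgue" by (simp add: F_def)
    have cell: "(\<integral>\<^sup>+y\<in>dcell a l k x. ennreal (g y) \<partial>lebesgue) / vol (dcell a l k x)
       \<le> ennreal K * epowr ((\<integral>\<^sup>+y\<in>dcell a l k x. ennreal (F y) \<partial>N) / emeasure N (dcell a l k x)) (1 / t0)" for k x
    proof -
      let ?S = "dcell a l k x"
      define Q where "Q = cube (dcorner a l k x) (l / 2 ^ k)"
      have Q: "is_cube Q" using l by (simp add: Q_def is_cube_cube)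
      have [measurable]: "?S \<in> sets lebesgue" by (rule sets_dcell[OF l])
      define m where "m = rvol Q"
      define b where "b = avg w Q"
      have m: "0 < m" "0 < b" unfolding m_def b_def by (rule measure_cube_pos[OF Q], rule avg_w_pos[OF Q])
      have vS: "vol ?S = ennreal m"
        using emeasure_dcell[OF l, of a k x] l by (simp add: m_def Q_def measure_cube)
      have NS: "emeasure N ?S = wmeas ?v Q"
        by (simp add: N_def emeasure_density wmeas_def Q_def nn_integral_dcell[OF l])
      have NSle: "emeasure N ?S \<le> ennreal (C1 * m * b powr (1 - T))"
        using C1(2)[OF Q] by (simp add: NS m_def b_def)
      have NSpos: "0 < emeasure N ?S" unfolding NS by (rule wmeas_powr_pos[OF Q])
      have NSfin: "emeasure N ?S < top" using NSle by (simp add: order_le_less_trans)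
      then obtain n where n: "emeasure N ?S = ennreal n" "0 < n" "n \<le> C1 * m * b powr (1 - T)"
        using NSpos NSle C1(1) m by (cases "emeasure N ?S") (auto simp: ennreal_le_iff)
      define I where "I = (\<integral>\<^sup>+y\<in>?S. ennreal (F y) \<partial>N)"
      have I: "I = (\<integral>\<^sup>+y\<in>?S. ennreal (F y * ?v y) \<partial>lebesgue)"
        by (simp add: I_def N_def nn_integral_density F_def ennreal_mult mult_ac)
      show ?thesis
      proof (cases "I = \<infinity>")
        case True
        then have "I / emeasure N ?S = \<infinity>" using n by (simp add: ennreal_top_divide)
        then show ?thesis using t0 K by (simp add: I_def[symmetric] epowr_def ennreal_mult_top)
      next
        case False
        then obtain i where i: "I = ennreal i" "0 \<le> i" by (cases I) auto
        \<comment> \<open>This identity determines \<open>?\<theta>\<close>: the powers of w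
          introduced by Hoelder's inequality with exponent t0 have to cancel.\<close>
        have e1: "1 / t0 * (1 - T) + (1 - 1 / t0) * ?\<theta> = 0" using t0 by (simp add: field_simps)
        have "(\<integral>\<^sup>+y\<in>?S. ennreal (g y) \<partial>lebesgue)
           = (\<integral>\<^sup>+y\<in>?S. ennreal ((F y * ?v y) powr (1 / t0) * (w y powr ?\<theta>) powr (1 - 1 / t0)) \<partial>lebesgue)"
        proof (rule nn_integral_cong_AE)
          show "AE y in lebesgue. ennreal (g y) * indicator ?S y
              = ennreal ((F y * ?v y) powr (1 / t0) * (w y powr ?\<theta>) powr (1 - 1 / t0)) * indicator ?S y"
            using w_pos
          proof eventually_elim
            case (elim y)
            have "(F y * ?v y) powr (1 / t0) * (w y powr ?\<theta>) powr (1 - 1 / t0)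
               = (F y) powr (1 / t0) * (?v y powr (1 / t0) * (w y powr ?\<theta>) powr (1 - 1 / t0))"
              using g0 by (simp add: powr_mult F_def)
            also have "?v y powr (1 / t0) * (w y powr ?\<theta>) powr (1 - 1 / t0) = w y powr (1 / t0 * (1 - T) + (1 - 1 / t0) * ?\<theta>)"
              by (simp only: powr_powr powr_add mult.commute)
            also have "\<dots> = 1" using elim unfolding e1 by simp
            also have "F y powr (1 / t0) = g y" using g0 t0 by (simp add: F_def powr_powr)
            finally show ?case by simp
          qed
        qed
        also have "\<dots> \<le> ennreal (i powr (1 / t0) * (C2 * m * b powr ?\<theta>) powr (1 - 1 / t0))"
        proof (rule set_nn_integral_holder)
          show "(\<integral>\<^sup>+y\<in>?S. ennreal (F y * ?v y) \<partial>lebesgue) \<le> ennreal i" using i I by simp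
          show "(\<integral>\<^sup>+y\<in>?S. ennreal (w y powr ?\<theta>) \<partial>lebesgue) \<le> ennreal (C2 * m * b powr ?\<theta>)"
            using C2(2)[OF Q] unfolding wmeas_def Q_def nn_integral_dcell[OF l, symmetric] m_def b_def .
        qed (use t0 i C2 m in \<open>auto simp: F_def\<close>)
        finally have "(\<integral>\<^sup>+y\<in>?S. ennreal (g y) \<partial>lebesgue) / vol ?S
            \<le> ennreal (i powr (1 / t0) * (C2 * m * b powr ?\<theta>) powr (1 - 1 / t0)) / ennreal m"
          unfolding vS by (intro divide_right_mono_ennreal)
        also have "\<dots> = ennreal (i powr (1 / t0) * (C2 * m * b powr ?\<theta>) powr (1 - 1 / t0) / m)"
          using m by (intro divide_ennreal) auto
        also have "\<dots> \<le> ennreal (K * (i / n) powr (1 / t0))"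
        proof (rule ennreal_leI)
          \<comment> \<open>The powers of m and b are those in the bound that \<open>P1\<close>
            gives for the N-measure n of the cell. The left side is thus K times the reciprocal of
            that bound to the power 1/t0, and n lies below the bound.\<close>
          have "(C2 * m * b powr ?\<theta>) powr (1 - 1 / t0) / m = C2 powr (1 - 1 / t0) * (b powr (?\<theta> * (1 - 1 / t0)) * (m powr (1 - 1 / t0) / m))"
            using C2 m by (simp add: powr_mult powr_powr)
          also have "m powr (1 - 1 / t0) / m = m powr (- (1 / t0))" using m by (simp add: powr_diff powr_minus_divide)
          also have "?\<theta> * (1 - 1 / t0) = - (1 / t0 * (1 - T))" using e1 by (simp add: algebra_simps)
          also have "b powr (- (1 / t0 * (1 - T))) * m powr (- (1 / t0)) = C1 powr (1 / t0) * (1 / (C1 * m * b powr (1 - T))) powr (1 / t0)"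
            using C1 m by (simp add: powr_divide powr_mult powr_powr powr_minus_divide mult_ac)
          finally have eq: "(C2 * m * b powr ?\<theta>) powr (1 - 1 / t0) / m = K * (1 / (C1 * m * b powr (1 - T))) powr (1 / t0)"
            by (simp add: K_def)
          have "(1 / (C1 * m * b powr (1 - T))) powr (1 / t0) \<le> (1 / n) powr (1 / t0)"
            using n t0 C1 m by (intro powr_mono2 divide_left_mono) auto
          then have "i powr (1 / t0) * (K * (1 / (C1 * m * b powr (1 - T))) powr (1 / t0)) \<le> i powr (1 / t0) * (K * (1 / n) powr (1 / t0))"
            using K by (intro mult_left_mono) auto
          also have "\<dots> = K * (i / n) powr (1 / t0)" using i n by (simp add: powr_divide)
          finally show "i powr (1 / t0) * (C2 * m * b powr ?\<theta>) powr (1 - 1 / t0) / m \<le> K * (i / n) powr (1 / t0)"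
            unfolding eq[symmetric] by simp
        qed
        also have "\<dots> = ennreal K * epowr (I / emeasure N ?S) (1 / t0)"
          using i n K t0 by (simp add: divide_ennreal epowr_ennreal ennreal_mult)
        finally show ?thesis by (simp add: I_def)
      qed
    qed
    have dm: "dyadic_max a l g x \<le> ennreal K * epowr (cell_max F x) (1 / t0)" for x
      unfolding dyadic_max_def
    proof (rule SUP_least)
      fix k
      note cell[of k x]
      also have "epowr ((\<integral>\<^sup>+y\<in>dcell a l k x. ennreal (F y) \<partial>N) / emeasure N (dcell a l k x)) (1 / t0) \<le> epowr (cell_max F x) (1 / t0)"
        unfolding cell_max_def using t0 by (intro epowr_mono SUP_upper) auto
      finally show "(\<integral>\<^sup>+y\<in>dcell a l k x. ennreal (g y) \<partial>lebesgue) / vol (dcell a l k x)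
        \<le> ennreal K * epowr (cell_max F x) (1 / t0)" by (simp add: mult_left_mono)
    qed
    have [measurable]: "dyadic_max a l g \<in> borel_measurable lebesgue" by (rule borel_measurable_dyadic_max[OF l])
    have "(\<integral>\<^sup>+x. epowr (dyadic_max a l g x) t * ennreal (?v x) \<partial>lebesgue) = (\<integral>\<^sup>+x. epowr (dyadic_max a l g x) t \<partial>N)"
      unfolding N_def by (subst nn_integral_density) (auto simp: mult.commute)
    also have "\<dots> \<le> (\<integral>\<^sup>+x. ennreal (K powr t) * epowr (cell_max F x) u \<partial>N)"
    proof (rule nn_integral_mono)
      fix x
      have "epowr (dyadic_max a l g x) t \<le> epowr (ennreal K * epowr (cell_max F x) (1 / t0)) t"
        using t0 by (intro epowr_mono dm) auto
      also have "\<dots> = ennreal (K powr t) * epowr (cell_max F x) u"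
        using t0 K by (simp add: epowr_mult epowr_epowr epowr_ennreal u_def)
      finally show "epowr (dyadic_max a l g x) t \<le> ennreal (K powr t) * epowr (cell_max F x) u" .
    qed
    also have "\<dots> = ennreal (K powr t) * (\<integral>\<^sup>+x. epowr (cell_max F x) u \<partial>N)"
      by (rule nn_integral_cmult) measurable
    also have "\<dots> \<le> ennreal (K powr t) * (ennreal (u * 2 powr u / (u - 1)) * (\<integral>\<^sup>+x. ennreal (F x powr u) \<partial>N))"
      using sf u by (intro mult_left_mono cell_max_strong) (auto simp: F_def)
    also have "\<dots> = ennreal C * (\<integral>\<^sup>+x. ennreal (F x powr u) \<partial>N)"
    proof -
      have "ennreal C = ennreal (K powr t) * ennreal (u * 2 powr u / (u - 1))"
        unfolding C_def using u by (intro ennreal_mult) auto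
      then show ?thesis by (simp only: mult.assoc)
    qed
    also have "(\<integral>\<^sup>+x. ennreal (F x powr u) \<partial>N) = (\<integral>\<^sup>+x. ennreal (g x powr t * ?v x) \<partial>lebesgue)"
      unfolding N_def using t0 by (subst nn_integral_density) (auto simp: F_def powr_powr u_def ennreal_mult mult.commute)
    finally show ?thesis .
  qed
  then show ?thesis using C by blast
qed

end

text \<open>The one-third trick: \<open>2\<^sup>k / 3\<close> keeps distance at least \<open>1/3\<close> from the integers.\<close>

lemma floor_one_third:
  fixes y d :: real
  assumes "0 \<le> d" "d \<le> 1 / 3"
  shows "\<lfloor>y\<rfloor> = \<lfloor>y + d\<rfloor> \<or> \<lfloor>y - 2 ^ k / 3\<rfloor> = \<lfloor>y + d - 2 ^ k / 3\<rfloor>"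
proof (rule ccontr)
  assume "\<not> ?thesis"
  then have ne: "\<lfloor>y\<rfloor> \<noteq> \<lfloor>y + d\<rfloor>" "\<lfloor>y - 2 ^ k / 3\<rfloor> \<noteq> \<lfloor>y + d - 2 ^ k / 3\<rfloor>" by auto
  define m where "m = \<lfloor>y + d\<rfloor>"
  define m' where "m' = \<lfloor>y + d - 2 ^ k / 3\<rfloor>"
  have "\<lfloor>y\<rfloor> < m" "\<lfloor>y - 2 ^ k / 3\<rfloor> < m'"
    using ne floor_mono[of y "y + d"] floor_mono[of "y - 2 ^ k / 3" "y + d - 2 ^ k / 3"] assms
    by (auto simp: m_def m'_def)
  then have "y < m" "y - 2 ^ k / 3 < m'" by (simp_all add: floor_less_iff)
  moreover have "m \<le> y + d" "m' \<le> y + d - 2 ^ k / 3" by (simp_all add: m_def m'_def)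
  \<comment> \<open>Both m and m' + 2^k/3 lie in (y, y + d], so they differ by less than 1/3; as
    integers, 3(m - m') and 2^k would then coincide.\<close>
  ultimately have "\<bar>real_of_int (3 * (m - m') - 2 ^ k)\<bar> < 1" using assms by (simp add: abs_less_iff)
  then have "3 * (m - m') = 2 ^ k" by linarith
  moreover have "(2::int) ^ k mod 3 \<noteq> 0"
  proof (induction k)
    case (Suc k)
    then show ?case unfolding power_Suc by presburger
  qed simp
  ultimately show False by presburger
qed

section \<open>Domination of the maximal function by shifted grids and dilates\<close>

definition shift :: "real ^ 'n \<Rightarrow> real \<Rightarrow> bool ^ 'n \<Rightarrow> real ^ 'n" where
  "shift c l s = (\<chi> i. c $ i + (if s $ i then l else 0))"

text \<open>Grids of side 3l are shifted by l, a third of their mesh, in some coordinates; at level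
  k this is a shift by 2^k/3 cells. With l/2^k between \<rho> and 2\<rho>, the cube is no wider than
  a third of a cell, so one of the shifts puts it into a single cell of side at most 6\<rho>. The
  volumes then differ by at most 6^n.\<close>

lemma small_cube_average:
  fixes c :: "real ^ 'n"
  assumes \<rho>: "0 < \<rho>" "\<rho> \<le> l" and x: "x \<in> cube r \<rho>"
  obtains s where "(\<integral>\<^sup>+y\<in>cube r \<rho>. ennreal (g y) \<partial>lebesgue) / vol (cube r \<rho>)
     \<le> ennreal (6 ^ CARD('n)) * dyadic_max (shift c l s) (3 * l) g x"
proof -
  have l: "0 < l" using \<rho> by simp
  obtain k where k: "\<rho> \<le> l / 2 ^ k" "l / 2 ^ k < 2 * \<rho>"
  proof -
    obtain j where "l / \<rho> < 2 ^ j" using real_arch_pow[of 2 "l / \<rho>"] by auto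
    then have ex: "\<exists>j. l / 2 ^ j < \<rho>" using \<rho> by (intro exI[of _ j]) (simp add: field_simps)
    define j where "j = (LEAST j. l / 2 ^ j < \<rho>)"
    have j: "l / 2 ^ j < \<rho>" using LeastI_ex[OF ex] by (simp add: j_def)
    then obtain i where i: "j = Suc i" using \<rho> by (cases j) auto
    then have "\<not> l / 2 ^ i < \<rho>" using not_less_Least[of i "\<lambda>j. l / 2 ^ j < \<rho>"] by (simp add: j_def)
    then show ?thesis using that[of i] j i by (simp add: field_simps)
  qed
  \<comment> \<open>Shift exactly those coordinates in which a hyperplane of the unshifted grid
    separates the two faces of the cube.\<close>
  define s :: "bool ^ 'n" where "s = (\<chi> i. \<lfloor>2 ^ k * (r $ i - c $ i) / (3 * l)\<rfloor> \<noteq> \<lfloor>2 ^ k * (r $ i + \<rho> - c $ i) / (3 * l)\<rfloor>)"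
  let ?a = "shift c l s"
  have fl: "\<lfloor>2 ^ k * (r $ i - ?a $ i) / (3 * l)\<rfloor> = \<lfloor>2 ^ k * (r $ i + \<rho> - ?a $ i) / (3 * l)\<rfloor>" for i
  proof (cases "s $ i")
    case True
    let ?y = "2 ^ k * (r $ i - c $ i) / (3 * l)" and ?d = "2 ^ k * \<rho> / (3 * l)"
    have "0 \<le> ?d" "?d \<le> 1 / 3" using k(1) l \<rho> by (auto simp: field_simps)
    from floor_one_third[OF this, of ?y k]
    have "\<lfloor>?y\<rfloor> = \<lfloor>?y + ?d\<rfloor> \<or> \<lfloor>?y - 2 ^ k / 3\<rfloor> = \<lfloor>?y + ?d - 2 ^ k / 3\<rfloor>" .
    moreover have "?y + ?d = 2 ^ k * (r $ i + \<rho> - c $ i) / (3 * l)"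
      by (simp add: add_divide_distrib[symmetric] algebra_simps)
    moreover have "?y - 2 ^ k / 3 = 2 ^ k * (r $ i - ?a $ i) / (3 * l)"
      "?y + ?d - 2 ^ k / 3 = 2 ^ k * (r $ i + \<rho> - ?a $ i) / (3 * l)"
      using True l by (simp_all add: shift_def field_simps)
    ultimately show ?thesis using True by (simp add: s_def)
  qed (simp add: s_def shift_def)
  have same: "\<lfloor>2 ^ k * (y $ i - ?a $ i) / (3 * l)\<rfloor> = \<lfloor>2 ^ k * (r $ i - ?a $ i) / (3 * l)\<rfloor>" if "y \<in> cube r \<rho>" for y i
  proof (rule antisym)
    have y: "r $ i \<le> y $ i" "y $ i \<le> r $ i + \<rho>" using that by (auto simp: mem_cube)
    show "\<lfloor>2 ^ k * (y $ i - ?a $ i) / (3 * l)\<rfloor> \<le> \<lfloor>2 ^ k * (r $ i - ?a $ i) / (3 * l)\<rfloor>"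
      unfolding fl using y l by (intro floor_mono divide_right_mono mult_left_mono) auto
    show "\<lfloor>2 ^ k * (r $ i - ?a $ i) / (3 * l)\<rfloor> \<le> \<lfloor>2 ^ k * (y $ i - ?a $ i) / (3 * l)\<rfloor>"
      using y l by (intro floor_mono divide_right_mono mult_left_mono) auto
  qed
  let ?S = "dcell ?a (3 * l) k x"
  have sub: "cube r \<rho> \<subseteq> ?S" using same[OF x] same by (auto simp: dcell_def)
  have vS: "vol ?S = ennreal ((3 * l / 2 ^ k) ^ CARD('n))" using l by (intro emeasure_dcell) simp
  have le: "vol ?S \<le> ennreal (6 ^ CARD('n)) * vol (cube r \<rho>)"
  proof -
    have "(3 * l / 2 ^ k) ^ CARD('n) \<le> (6 * \<rho>) ^ CARD('n)"
      using k(2) l by (intro power_mono) auto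
    then show ?thesis using \<rho> by (simp add: vS emeasure_cube power_mult_distrib ennreal_mult''[symmetric] ennreal_leI)
  qed
  define I where "I = (\<integral>\<^sup>+y\<in>?S. ennreal (g y) \<partial>lebesgue)"
  define vR where "vR = \<rho> ^ CARD('n)"
  define vSr where "vSr = (3 * l / 2 ^ k) ^ CARD('n)"
  have v: "0 < vR" "0 < vSr" using \<rho> l by (auto simp: vR_def vSr_def)
  have "(\<integral>\<^sup>+y\<in>cube r \<rho>. ennreal (g y) \<partial>lebesgue) / vol (cube r \<rho>) \<le> I / ennreal vR"
    unfolding I_def using sub \<rho> emeasure_cube[of \<rho> r]
    by (auto simp: vR_def intro!: divide_right_mono_ennreal nn_integral_mono split: split_indicator)
  also have "\<dots> = (I / ennreal vSr * ennreal vSr) / ennreal vR"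
    using v by (simp add: ennreal_div_mult)
  also have "\<dots> = (I / ennreal vSr) * (ennreal vSr / ennreal vR)"
    by (simp add: ennreal_times_divide)
  also have "\<dots> \<le> (I / ennreal vSr) * ennreal (6 ^ CARD('n))"
  proof (rule mult_left_mono)
    have "vSr \<le> 6 ^ CARD('n) * vR"
      using k(2) l unfolding vSr_def vR_def power_mult_distrib[symmetric] by (intro power_mono) auto
    then show "ennreal vSr / ennreal vR \<le> ennreal (6 ^ CARD('n))"
      using v by (simp add: divide_ennreal ennreal_leI field_simps del: ennreal_numeral)
  qed simp
  also have "I / ennreal vSr \<le> dyadic_max ?a (3 * l) g x"
    unfolding dyadic_max_def I_def vSr_def vS[symmetric] by (rule SUP_upper) simp
  finally show ?thesis using that[of s] by (simp add: mult.commute mult_right_mono)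
qed

lemma le_suminf_ennreal: "f k \<le> (\<Sum>k. f k :: ennreal)"
  using sum_le_suminf[of f "{k}"] by simp

text \<open>The cube enlarged by 2^k l on every side. A cube that meets \<open>cube c l\<close> and
  contains a point outside this one must have side more than 2^k l.\<close>

definition dilate :: "real ^ 'n \<Rightarrow> real \<Rightarrow> nat \<Rightarrow> (real ^ 'n) set" where
  "dilate c l k = cube (\<chi> i. c $ i - 2 ^ k * l) (l * (1 + 2 ^ (k + 1)))"

lemma mem_dilate: "x \<in> dilate c l k \<longleftrightarrow> (\<forall>i. c $ i - 2 ^ k * l \<le> x $ i \<and> x $ i \<le> c $ i + l + 2 ^ k * l)"
  by (simp add: dilate_def mem_cube algebra_simps)

lemma dilate_exhausts:
  assumes "0 < l" shows "\<exists>k. x \<in> dilate c l k"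
proof -
  obtain k where k: "(norm x + norm c) / l < 2 ^ k" using real_arch_pow[of 2] by auto
  then have "norm x + norm c \<le> 2 ^ k * l" using assms by (simp add: field_simps)
  then have "x \<in> dilate c l k"
    unfolding mem_dilate using assms component_le_norm_cart[of x] component_le_norm_cart[of c]
    by (smt (verit) zero_less_power)
  then show ?thesis ..
qed

text \<open>A cube through x either misses the support of g, or is a small cube near the support, or
  is large. Small cubes go to the shifted grids. If k is the first dilate containing x, a large cube
  has side at least 2^(k-1) l, or at least l if k = 0, so its average is at most the k-th summand
  before the power 1/s.\<close>

lemma maximal_pointwise:
  fixes c :: "real ^ 'n" and g :: "real ^ 'n \<Rightarrow> real"
  assumes l: "0 < l" and s: "0 < s" and g0: "\<And>y. 0 \<le> g y" and supp: "\<And>y. y \<notin> cube c l \<Longrightarrow> g y = 0"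
  shows "epowr (maximal g x) (1 / s) \<le>
     (\<Sum>\<eta>\<in>UNIV. epowr (ennreal (6 ^ CARD('n)) * dyadic_max (shift c l \<eta>) (3 * l) g x) (1 / s) * indicator (dilate c l 0) x)
     + (\<Sum>k. epowr (ennreal (2 ^ CARD('n) / 2 ^ (k * CARD('n))) * ((\<integral>\<^sup>+y. ennreal (g y) \<partial>lebesgue) / ennreal (l ^ CARD('n)))) (1 / s)
         * indicator (dilate c l k) x)"
    (is "_ \<le> ?A + suminf ?B")
proof -
  let ?R = "\<lambda>r \<rho>. (\<integral>\<^sup>+y\<in>cube r \<rho>. ennreal \<bar>g y\<bar> \<partial>lebesgue) / vol (cube r \<rho>)"
  let ?J = "\<integral>\<^sup>+y. ennreal (g y) \<partial>lebesgue" and ?n = "CARD('n)"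
  have B_le: "?B k \<le> suminf ?B" for k
    by (rule le_suminf_ennreal)
  \<comment> \<open>The condition k \<le> j + 1 serves both cases: k = j + 1 for a point first
    reached by a later dilate, and k = j = 0 for a point near the cube.\<close>
  have large: "?R r \<rho> \<le> epowr (?A + suminf ?B) s"
    if \<rho>: "2 ^ j * l \<le> \<rho>" and k: "x \<in> dilate c l k" "k \<le> Suc j" for r \<rho> j k
  proof -
    have \<rho>0: "0 < \<rho>" using \<rho> l by (smt (verit) mult_pos_pos zero_less_power)
    have "?R r \<rho> \<le> ?J / vol (cube r \<rho>)"
      using g0 by (intro divide_right_mono_ennreal nn_integral_mono) (auto split: split_indicator)
    also have "\<dots> = ?J / ennreal (\<rho> ^ ?n)" using \<rho>0 by (simp add: emeasure_cube)
    also have "\<dots> = ?J / ennreal (l ^ ?n) * (ennreal (l ^ ?n) / ennreal (\<rho> ^ ?n))"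
      using l by (simp add: ennreal_times_divide ennreal_div_mult)
    also have "\<dots> \<le> ?J / ennreal (l ^ ?n) * ennreal (2 ^ ?n / 2 ^ (k * ?n))"
    proof (rule mult_left_mono)
      have "(2 ^ k) * l \<le> 2 * \<rho>"
      proof -
        have "(2::real) ^ k * l \<le> 2 ^ Suc j * l"
          using l k(2) by (intro mult_right_mono power_increasing) auto
        then show ?thesis using \<rho> by simp
      qed
      then have "((2 ^ k) * l) ^ ?n \<le> (2 * \<rho>) ^ ?n" using l by (intro power_mono) auto
      then have "l ^ ?n / \<rho> ^ ?n \<le> 2 ^ ?n / 2 ^ (k * ?n)"
        using \<rho>0 by (simp add: power_mult_distrib power_mult field_simps)
      then show "ennreal (l ^ ?n) / ennreal (\<rho> ^ ?n) \<le> ennreal (2 ^ ?n / 2 ^ (k * ?n))"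
        using \<rho>0 l by (simp add: divide_ennreal ennreal_leI)
    qed simp
    finally have "epowr (?R r \<rho>) (1 / s) \<le> ?B k"
      using k s by (simp add: epowr_mono mult.commute)
    also have "\<dots> \<le> ?A + suminf ?B" using B_le[of k] by (simp add: add_increasing)
    finally show ?thesis using s by (simp add: epowr_inverse_le_iff)
  qed
  have "maximal g x \<le> epowr (?A + suminf ?B) s"
    unfolding maximal_def
  proof (rule SUP_least)
    fix R assume "R \<in> {Q. is_cube Q \<and> x \<in> Q}"
    then obtain r \<rho> where R: "R = cube r \<rho>" and \<rho>: "0 < \<rho>" and xR: "x \<in> cube r \<rho>" by (auto simp: is_cube_iff)
    show "(\<integral>\<^sup>+y\<in>R. ennreal \<bar>g y\<bar> \<partial>lebesgue) / vol R \<le> epowr (?A + suminf ?B) s"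
    proof (cases "R \<inter> cube c l = {}")
      case True
      then have "(\<integral>\<^sup>+y\<in>R. ennreal \<bar>g y\<bar> \<partial>lebesgue) = (\<integral>\<^sup>+y. 0 \<partial>(lebesgue :: (real ^ 'n) measure))"
        using supp by (intro nn_integral_cong) (auto split: split_indicator)
      then show ?thesis by simp
    next
      case False
      then obtain y where y: "y \<in> cube r \<rho>" "y \<in> cube c l" using R by auto
      define k where "k = (LEAST k. x \<in> dilate c l k)"
      have k: "x \<in> dilate c l k" using LeastI_ex[OF dilate_exhausts[OF l]] by (simp add: k_def)
      show ?thesis
      proof (cases k)
        case 0
        show ?thesis
        proof (cases "l \<le> \<rho>")
          case True
          then show ?thesis unfolding R by (intro large[of 0 _ k]) (use k 0 in auto)
        next
          case False
          obtain \<eta> where \<eta>: "(\<integral>\<^sup>+y\<in>cube r \<rho>. ennreal (g y) \<partial>lebesgue) / vol (cube r \<rho>)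
             \<le> ennreal (6 ^ ?n) * dyadic_max (shift c l \<eta>) (3 * l) g x"
            using small_cube_average[OF \<rho> _ xR, of l g c] False by auto
          have "epowr (?R r \<rho>) (1 / s)
             \<le> epowr (ennreal (6 ^ ?n) * dyadic_max (shift c l \<eta>) (3 * l) g x) (1 / s) * indicator (dilate c l 0) x"
            using \<eta> s k 0 g0 by (simp add: epowr_mono)
          also have "\<dots> \<le> ?A" by (rule member_le_sum) auto
          also have "\<dots> \<le> ?A + suminf ?B" by simp
          finally show ?thesis unfolding R using s by (simp add: epowr_inverse_le_iff)
        qed
      next
        case (Suc j)
        \<comment> \<open>In some coordinate x is more than 2^j l away from the cube, and R contains
          points of both.\<close>
        then have "x \<notin> dilate c l j" using not_less_Least[of j "\<lambda>k. x \<in> dilate c l k"] by (simp add: k_def)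
        then obtain i where "\<not> (c $ i - 2 ^ j * l \<le> x $ i \<and> x $ i \<le> c $ i + l + 2 ^ j * l)"
          unfolding mem_dilate by blast
        moreover have "c $ i \<le> y $ i" "y $ i \<le> c $ i + l" "r $ i \<le> y $ i" "y $ i \<le> r $ i + \<rho>"
          "r $ i \<le> x $ i" "x $ i \<le> r $ i + \<rho>" using y xR by (auto simp: mem_cube)
        ultimately have "2 ^ j * l \<le> \<rho>" by linarith
        then show ?thesis unfolding R by (intro large[of j _ k]) (use k Suc in auto)
      qed
    qed
  qed
  then show ?thesis using s by (simp add: epowr_inverse_le_iff)
qed


section \<open>The embeddings\<close>

abbreviation norm_integral :: "real \<Rightarrow> (real ^ 'n \<Rightarrow> real) \<Rightarrow> (real ^ 'n \<Rightarrow> complex) \<Rightarrow> (real ^ 'n) set \<Rightarrow> ennreal" where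
  "norm_integral p w f R \<equiv> \<integral>\<^sup>+x\<in>R. ennreal (norm (f x) powr p) * ennreal (w x) \<partial>lebesgue"

context positive_weight
begin

text \<open>Hoelder's inequality for |f|^q = (|f|^p w)^(q/p) (w^(1-T))^(1-q/p). It removes the
  weight, since averages of h^s w^s over large cubes enter as constants.\<close>

lemma integral_norm_powr_le:
  assumes q: "0 < q" "q < p" and P1: "power_bound w (1 - p / (p - q))"
  shows "\<exists>C>0. \<forall>R A f. is_cube R \<longrightarrow> f \<in> borel_measurable lebesgue \<longrightarrow> 0 \<le> A \<longrightarrow>
     norm_integral p w f R \<le> ennreal (A powr p) \<longrightarrow>
     (\<integral>\<^sup>+x\<in>R. ennreal (norm (f x) powr q) \<partial>lebesgue)
       \<le> ennreal (C * A powr q * rvol R powr (1 - q / p) * avg w R powr (- (q / p)))"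
proof -
  let ?T = "p / (p - q)"
  obtain C where C: "0 < C" "\<And>Q. is_cube Q \<Longrightarrow> wmeas (\<lambda>x. w x powr (1 - ?T)) Q \<le> ennreal (C * rvol Q * avg w Q powr (1 - ?T))"
    using P1 unfolding power_bound_def by blast
  have e: "(1 - ?T) * (1 - q / p) = - (q / p)" using q by (simp add: field_simps)
  have "(\<integral>\<^sup>+x\<in>R. ennreal (norm (f x) powr q) \<partial>lebesgue)
       \<le> ennreal (C powr (1 - q / p) * A powr q * rvol R powr (1 - q / p) * avg w R powr (- (q / p)))"
    if R: "is_cube R" and f [measurable]: "f \<in> borel_measurable lebesgue" and A: "0 \<le> A"
      and le: "norm_integral p w f R \<le> ennreal (A powr p)" for R A f
  proof -
    have m: "0 < rvol R" "0 < avg w R" by (rule measure_cube_pos[OF R], rule avg_w_pos[OF R])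
    have [measurable]: "R \<in> sets lebesgue" using R by (auto simp: is_cube_iff)
    have "(\<integral>\<^sup>+x\<in>R. ennreal (norm (f x) powr q) \<partial>lebesgue)
        = (\<integral>\<^sup>+x\<in>R. ennreal ((norm (f x) powr p * w x) powr (q / p) * (w x powr (1 - ?T)) powr (1 - q / p)) \<partial>lebesgue)"
    proof (rule nn_integral_cong_AE)
      show "AE x in lebesgue. ennreal (norm (f x) powr q) * indicator R x
        = ennreal ((norm (f x) powr p * w x) powr (q / p) * (w x powr (1 - ?T)) powr (1 - q / p)) * indicator R x"
        using w_pos
      proof eventually_elim
        case (elim x)
        have "(norm (f x) powr p * w x) powr (q / p) * (w x powr (1 - ?T)) powr (1 - q / p)
          = norm (f x) powr q * (w x powr (q / p) * w x powr (- (q / p)))"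
          using elim q by (simp only: powr_powr e powr_mult) (simp add: mult.assoc)
        also have "w x powr (q / p) * w x powr (- (q / p)) = 1" using elim by (simp flip: powr_add)
        finally show ?case by simp
      qed
    qed
    also have "\<dots> \<le> ennreal ((A powr p) powr (q / p) * (C * rvol R * avg w R powr (1 - ?T)) powr (1 - q / p))"
      using le C(2)[OF R] q m C(1) w_nonneg unfolding wmeas_def
      by (intro set_nn_integral_holder) (auto simp: ennreal_mult)
    also have "(A powr p) powr (q / p) * (C * rvol R * avg w R powr (1 - ?T)) powr (1 - q / p)
       = C powr (1 - q / p) * A powr q * rvol R powr (1 - q / p) * avg w R powr (- (q / p))"
      using C(1) m q by (simp only: powr_mult powr_powr e) (simp add: mult_ac)
    finally show ?thesis .
  qed
  moreover have "0 < C powr (1 - q / p)" using C by simp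
  ultimately show ?thesis by blast
qed

text \<open>Hoelder's inequality with exponents T/s and its conjugate, splitting off h^T w, whose
  integral is at most 1. The remaining power of w has the exponent s(T-1)/(T-s) of the
  hypothesis.\<close>

lemma local_average_le:
  assumes q: "0 < q" "q < p" and s: "0 < s" "s < p / (p - q)"
    and P: "power_bound w (s * (p / (p - q) - 1) / (p / (p - q) - s))"
  shows "\<exists>C>0. \<forall>Q h. is_cube Q \<longrightarrow> h \<in> borel_measurable lebesgue \<longrightarrow> (\<forall>x. 0 \<le> h x) \<longrightarrow>
     (\<integral>\<^sup>+x\<in>Q. ennreal (h x powr (p / (p - q)) * w x) \<partial>lebesgue) \<le> 1 \<longrightarrow>
     epowr ((\<integral>\<^sup>+x\<in>Q. ennreal (h x powr s * w x powr s) \<partial>lebesgue) / vol Q) (1 / s)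
       \<le> ennreal (C * rvol Q powr (- (1 - q / p)) * avg w Q powr (q / p))"
proof -
  define T where "T = p / (p - q)"
  define \<theta> where "\<theta> = s * (T - 1) / (T - s)"
  have T: "0 < T" "s < T" "1 / T = 1 - q / p" "(T - 1) / T = q / p"
    using q s by (auto simp: T_def field_simps)
  have e: "\<theta> * (1 - s / T) = s * ((T - 1) / T)" using T by (simp add: \<theta>_def field_simps)
  have "T * (T - 1) / T = T - 1" using T by simp
  then have e2: "s / T + s * ((T - 1) / T) = s" using T by (simp add: field_simps)
  obtain C where C: "0 < C" "\<And>Q. is_cube Q \<Longrightarrow> wmeas (\<lambda>x. w x powr \<theta>) Q \<le> ennreal (C * rvol Q * avg w Q powr \<theta>)"
    using P unfolding power_bound_def \<theta>_def T_def by blast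
  define K where "K = (C powr (1 - s / T)) powr (1 / s)"
  have "epowr ((\<integral>\<^sup>+x\<in>Q. ennreal (h x powr s * w x powr s) \<partial>lebesgue) / vol Q) (1 / s)
       \<le> ennreal (K * rvol Q powr (- (1 - q / p)) * avg w Q powr (q / p))"
    if Q: "is_cube Q" and h [measurable]: "h \<in> borel_measurable lebesgue" and h0: "\<forall>x. 0 \<le> h x"
      and le: "(\<integral>\<^sup>+x\<in>Q. ennreal (h x powr T * w x) \<partial>lebesgue) \<le> 1" for Q h
  proof -
    let ?m = "rvol Q" and ?a = "avg w Q"
    have m: "0 < ?m" "0 < ?a" by (rule measure_cube_pos[OF Q], rule avg_w_pos[OF Q])
    have [measurable]: "Q \<in> sets lebesgue" using Q by (auto simp: is_cube_iff)
    define J where "J = (\<integral>\<^sup>+x\<in>Q. ennreal (h x powr s * w x powr s) \<partial>lebesgue)"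
    have "J = (\<integral>\<^sup>+x\<in>Q. ennreal ((h x powr T * w x) powr (s / T) * (w x powr \<theta>) powr (1 - s / T)) \<partial>lebesgue)"
      unfolding J_def
    proof (rule nn_integral_cong_AE)
      show "AE x in lebesgue. ennreal (h x powr s * w x powr s) * indicator Q x
        = ennreal ((h x powr T * w x) powr (s / T) * (w x powr \<theta>) powr (1 - s / T)) * indicator Q x"
        using w_pos
      proof eventually_elim
        case (elim x)
        have "(h x powr T * w x) powr (s / T) * (w x powr \<theta>) powr (1 - s / T)
          = h x powr s * (w x powr (s / T) * w x powr (s * ((T - 1) / T)))"
          using elim T h0 by (simp only: powr_powr e powr_mult) (simp add: mult.assoc)
        also have "w x powr (s / T) * w x powr (s * ((T - 1) / T)) = w x powr s"
          unfolding powr_add[symmetric] e2 ..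
        finally show ?case by simp
      qed
    qed
    also have "\<dots> \<le> ennreal (1 powr (s / T) * (C * ?m * ?a powr \<theta>) powr (1 - s / T))"
      using C(2)[OF Q] le s T C(1) m h0 w_nonneg unfolding wmeas_def
      by (intro set_nn_integral_holder) auto
    finally have "J / ennreal ?m \<le> ennreal ((C * ?m * ?a powr \<theta>) powr (1 - s / T)) / ennreal ?m"
      by (intro divide_right_mono_ennreal) simp
    also have "\<dots> = ennreal ((C * ?m * ?a powr \<theta>) powr (1 - s / T) / ?m)"
      using m by (intro divide_ennreal) auto
    finally have "epowr (J / ennreal ?m) (1 / s) \<le> epowr (ennreal ((C * ?m * ?a powr \<theta>) powr (1 - s / T) / ?m)) (1 / s)"
      using s by (intro epowr_mono) auto
    also have "\<dots> = ennreal (((C * ?m * ?a powr \<theta>) powr (1 - s / T) / ?m) powr (1 / s))"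
      using s m by (intro epowr_ennreal) auto
    also have "((C * ?m * ?a powr \<theta>) powr (1 - s / T) / ?m) powr (1 / s) = K * ?m powr (- (1 - q / p)) * ?a powr (q / p)"
    proof -
      have "(C * ?m * ?a powr \<theta>) powr (1 - s / T) / ?m = C powr (1 - s / T) * (?m powr (1 - s / T) / ?m) * ?a powr (s * ((T - 1) / T))"
        using C(1) m by (simp only: powr_mult powr_powr e) simp
      also have "?m powr (1 - s / T) / ?m = ?m powr (- (s / T))"
        using m by (simp add: powr_diff powr_minus_divide)
      finally have "((C * ?m * ?a powr \<theta>) powr (1 - s / T) / ?m) powr (1 / s)
         = K * ?m powr (- (s / T) * (1 / s)) * ?a powr (s * ((T - 1) / T) * (1 / s))"
        unfolding K_def by (simp only: powr_mult powr_powr)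
      also have "- (s / T) * (1 / s) = - (1 - q / p)" using T s by (simp flip: T(3))
      also have "s * ((T - 1) / T) * (1 / s) = q / p" using T s by simp
      finally show ?thesis .
    qed
    finally show ?thesis by (simp add: J_def emeasure_is_cube[OF Q])
  qed
  moreover have "0 < K" using C by (simp add: K_def)
  ultimately show ?thesis unfolding T_def by blast
qed

text \<open>Hoelder's inequality with p/q and its conjugate T: the powers w^(q/p) and w^(-q/p)
  cancel, so w for |f|^p is matched with w^(1-T) for the other factor.\<close>

lemma local_term_le:
  fixes f :: "real ^ 'n \<Rightarrow> complex" and D :: "real ^ 'n \<Rightarrow> ennreal"
  assumes q: "0 < q" "q < p" and s: "0 < s"
    and [measurable]: "f \<in> borel_measurable lebesgue" "D \<in> borel_measurable lebesgue" "R \<in> sets lebesgue"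
    and A: "0 \<le> A" "norm_integral p w f R \<le> ennreal (A powr p)"
    and B: "0 \<le> B" "(\<integral>\<^sup>+x. epowr (D x) (p / (p - q) / s) * ennreal (w x powr (1 - p / (p - q))) \<partial>lebesgue) \<le> ennreal B"
  shows "(\<integral>\<^sup>+x\<in>R. ennreal (norm (f x) powr q) * epowr (D x) (1 / s) \<partial>lebesgue) \<le> ennreal (A powr q * B powr (1 - q / p))"
proof -
  let ?T = "p / (p - q)"
  have e: "(1 - ?T) * (1 - q / p) = - (q / p)" using q by (simp add: field_simps)
  have e2: "?T / s * (1 - q / p) = 1 / s" "0 < ?T / s" "0 < 1 - q / p" using q s by (auto simp: field_simps)
  have "(\<integral>\<^sup>+x\<in>R. ennreal (norm (f x) powr q) * epowr (D x) (1 / s) \<partial>lebesgue)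
     = (\<integral>\<^sup>+x\<in>R. ennreal ((norm (f x) powr p * w x) powr (q / p)) * epowr (epowr (D x) (?T / s) * ennreal (w x powr (1 - ?T))) (1 - q / p) \<partial>lebesgue)"
  proof (rule nn_integral_cong_AE)
    show "AE x in lebesgue. ennreal (norm (f x) powr q) * epowr (D x) (1 / s) * indicator R x
      = ennreal ((norm (f x) powr p * w x) powr (q / p)) * epowr (epowr (D x) (?T / s) * ennreal (w x powr (1 - ?T))) (1 - q / p) * indicator R x"
      using w_pos
    proof eventually_elim
      case (elim x)
      have "epowr (epowr (D x) (?T / s) * ennreal (w x powr (1 - ?T))) (1 - q / p) = epowr (D x) (1 / s) * ennreal (w x powr (- (q / p)))"
        unfolding epowr_mult[OF e2(3)] epowr_epowr[OF e2(2,3)] e2(1) epowr_ennreal[OF e2(3) powr_ge_zero] powr_powr e ..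
      moreover have "ennreal ((norm (f x) powr p * w x) powr (q / p)) = ennreal (norm (f x) powr q) * ennreal (w x powr (q / p))"
        using q elim by (simp add: powr_mult powr_powr ennreal_mult)
      moreover have "ennreal (w x powr (q / p)) * ennreal (w x powr (- (q / p))) = 1"
      proof -
        have "w x powr (q / p) * w x powr (- (q / p)) = 1" using elim by (simp flip: powr_add)
        then show ?thesis by (simp flip: ennreal_mult)
      qed
      ultimately show ?case by (simp add: mult_ac)
    qed
  qed
  also have "\<dots> \<le> ennreal ((A powr p) powr (q / p) * B powr (1 - q / p))"
    using q A B w_nonneg by (intro set_nn_integral_holder_ennreal) (auto simp: ennreal_mult)
  also have "(A powr p) powr (q / p) = A powr q" using q by (simp add: powr_powr)
  finally show ?thesis .
qed

end

section \<open>From integral estimates to embeddings\<close>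

text \<open>Functions in \<open>unit_nonneg_Lp\<close> are measurable only on Q and arbitrary
  outside it. Extension by 0 repairs this without changing the maximal weight.\<close>

lemma unit_nonneg_Lp_extend:
  assumes h: "h \<in> unit_nonneg_Lp T w Q" and Q [measurable]: "Q \<in> sets lebesgue" and T: "0 < T"
    and w: "\<And>x. 0 \<le> w x"
  defines "h' \<equiv> \<lambda>x. if x \<in> Q then h x else 0"
  shows "h' \<in> borel_measurable lebesgue" "\<And>x. 0 \<le> h' x"
    "(\<integral>\<^sup>+x. ennreal (h' x powr T * w x) \<partial>lebesgue) = 1"
    "\<And>s x. max_weight s h w Q x = epowr (maximal (\<lambda>y. h' y powr s * w y powr s) x) (1 / s)"
proof -
  have hm: "h \<in> borel_measurable (lebesgue_on Q)" and h0: "\<And>x. x \<in> Q \<Longrightarrow> 0 \<le> h x"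
    and n: "wLp_norm T (\<lambda>x. ennreal (w x)) Q h = 1"
    using h by (auto simp: unit_nonneg_Lp_def)
  show "h' \<in> borel_measurable lebesgue"
    unfolding h'_def using hm by (rule borel_measurable_if_I) simp
  show "0 \<le> h' x" for x using h0 by (simp add: h'_def)
  have "(\<integral>\<^sup>+x. ennreal (h' x powr T * w x) \<partial>lebesgue) = (\<integral>\<^sup>+x\<in>Q. ennreal (norm (h x) powr T) * ennreal (w x) \<partial>lebesgue)"
    using h0 w by (intro nn_integral_cong) (auto simp: h'_def ennreal_mult split: split_indicator)
  also have "\<dots> = epowr (wLp_norm T (\<lambda>x. ennreal (w x)) Q h) T"
    using T by (simp add: wLp_norm_def epowr_epowr epowr_1)
  also have "\<dots> = 1" unfolding n by (simp add: epowr_def)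
  finally show "(\<integral>\<^sup>+x. ennreal (h' x powr T * w x) \<partial>lebesgue) = 1" .
  have "(\<lambda>y. h y powr s * w y powr s * indicator Q y) = (\<lambda>y. h' y powr s * w y powr s)" for s
    by (auto simp: h'_def fun_eq_iff)
  then show "max_weight s h w Q x = epowr (maximal (\<lambda>y. h' y powr s * w y powr s) x) (1 / s)" for s x
    by (simp add: max_weight_def)
qed

text \<open>Here A plays the role of the Morrey norm of f. The factor D stays apart from C so that
  the dependence on the cube Q remains visible in the embedding constant.\<close>

lemma embeds_with_of_bound:
  fixes N :: "(real ^ 'n \<Rightarrow> complex) \<Rightarrow> ennreal" and V :: "real ^ 'n \<Rightarrow> ennreal"
  assumes pq: "0 < p" "0 < q" and CD: "0 \<le> C" "0 \<le> D"
    and \<nu>: "\<And>R. is_cube R \<Longrightarrow> \<nu> R = ennreal (\<mu> R)" "\<And>R. is_cube R \<Longrightarrow> 0 < \<mu> R"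
    and N: "N = (\<lambda>f. SUP Q\<in>Collect is_cube. epowr (\<nu> Q) (- e) * wLp_norm p (\<lambda>x. ennreal (w x)) Q f)"
    and bound: "\<And>f A. f \<in> borel_measurable lebesgue \<Longrightarrow> 0 \<le> A \<Longrightarrow>
      (\<forall>R. is_cube R \<longrightarrow> norm_integral p w f R \<le> ennreal ((A * \<mu> R powr e) powr p)) \<Longrightarrow>
      (\<integral>\<^sup>+x. ennreal (norm (f x) powr q) * V x \<partial>lebesgue) \<le> ennreal (C * (A * D) powr q)"
  shows "embeds_with (ennreal (C powr (1 / q)) * ennreal D) N (wLp_norm q V UNIV)"
proof -
  have main: "wLp_norm q V UNIV f \<le> ennreal (C powr (1 / q)) * ennreal D * N f" if f: "f \<in> fun_space N" for f
  proof -
    have fm: "f \<in> borel_measurable lebesgue" and fin: "N f < \<infinity>" using f by (auto simp: fun_space_def)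
    then obtain A where A: "N f = ennreal A" "0 \<le> A" by (cases "N f") auto
    have "norm_integral p w f R \<le> ennreal ((A * \<mu> R powr e) powr p)"
      if R: "is_cube R" for R
    proof -
      have m: "0 < \<mu> R" using \<nu>(2)[OF R] .
      have "epowr (\<nu> R) (- e) * wLp_norm p (\<lambda>x. ennreal (w x)) R f \<le> N f"
        unfolding N using R by (intro SUP_upper) auto
      then have "ennreal (\<mu> R powr e) * (ennreal (\<mu> R powr (- e)) * wLp_norm p (\<lambda>x. ennreal (w x)) R f) \<le> ennreal (\<mu> R powr e) * ennreal A"
        unfolding A \<nu>(1)[OF R] epowr_ennreal_pos[OF m] by (rule mult_left_mono) simp
      also have "ennreal (\<mu> R powr e) * (ennreal (\<mu> R powr (- e)) * wLp_norm p (\<lambda>x. ennreal (w x)) R f)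
         = ennreal (\<mu> R powr e * \<mu> R powr (- e)) * wLp_norm p (\<lambda>x. ennreal (w x)) R f"
        by (simp add: ennreal_mult mult.assoc)
      also have "\<mu> R powr e * \<mu> R powr (- e) = 1" using m by (simp flip: powr_add)
      finally have "wLp_norm p (\<lambda>x. ennreal (w x)) R f \<le> ennreal (A * \<mu> R powr e)"
        using A by (simp add: ennreal_mult mult.commute)
      then show ?thesis
        using pq A unfolding wLp_norm_def by (subst (asm) epowr_inverse_le_iff) (auto simp: epowr_ennreal)
    qed
    then have le: "(\<integral>\<^sup>+x. ennreal (norm (f x) powr q) * V x \<partial>lebesgue) \<le> ennreal (C * (A * D) powr q)"
      using fm A by (intro bound) auto
    have "wLp_norm q V UNIV f \<le> epowr (ennreal (C * (A * D) powr q)) (1 / q)"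
      unfolding wLp_norm_def using le pq by (intro epowr_mono) auto
    also have "\<dots> = ennreal ((C * (A * D) powr q) powr (1 / q))" using pq CD by (intro epowr_ennreal) auto
    also have "(C * (A * D) powr q) powr (1 / q) = C powr (1 / q) * D * A"
      using pq CD A by (simp add: powr_mult powr_powr)
    also have "ennreal (C powr (1 / q) * D * A) = ennreal (C powr (1 / q)) * ennreal D * N f"
      using CD A by (simp add: ennreal_mult)
    finally show ?thesis .
  qed
  have "f \<in> fun_space (wLp_norm q V UNIV)" if f: "f \<in> fun_space N" for f
  proof -
    have "ennreal (C powr (1 / q)) * ennreal D * N f < \<infinity>"
      using f by (auto simp: fun_space_def ennreal_mult_less_top)
    then show ?thesis using main[OF f] f by (auto simp: fun_space_def order_le_less_trans)
  qed
  then show ?thesis using main by (auto simp: embeds_with_def)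
qed

context positive_weight
begin

text \<open>\<open>K1\<close> controls the single dilate on which the shifted grids act.
  \<open>K2\<close> says that the k-th dilate contributes at most a multiple of \<rho>^k; its three
  factors are the growth of the Morrey bound, what remains of the volume ratio after the decay of
  the averages, and the mass ratio left by the two uses of Hoelder's inequality.\<close>

theorem embedding_of_growth:
  fixes \<mu> :: "(real ^ 'n) set \<Rightarrow> real" and p q s t0 e \<rho> K1 K2 :: real
  defines "T \<equiv> p / (p - q)"
  assumes q: "0 < q" "q < p" and s: "1 \<le> s" and t0: "1 < t0" "t0 < T / s"
    and P1: "power_bound w (1 - T)" and P2: "power_bound w ((T - 1) / (t0 - 1))"
    and \<mu>: "\<And>R. is_cube R \<Longrightarrow> 0 < \<mu> R" and \<nu>: "\<And>R. is_cube R \<Longrightarrow> \<nu> R = ennreal (\<mu> R)"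
    and K1: "\<And>c l. 0 < l \<Longrightarrow> \<mu> (dilate c l 0) powr e \<le> K1 * \<mu> (cube c l) powr e"
    and \<rho>: "0 \<le> \<rho>" "\<rho> < 1"
    and K2: "\<And>c l k. 0 < l \<Longrightarrow> \<mu> (dilate c l k) powr (e * q) * 2 powr (k * CARD('n) * (1 - 1 / s)) *
        (mass (cube c l) / mass (dilate c l k)) powr (q / p) \<le> K2 * \<rho> ^ k * \<mu> (cube c l) powr (e * q)"
    and N: "N = (\<lambda>f. SUP Q\<in>Collect is_cube. epowr (\<nu> Q) (- e) * wLp_norm p (\<lambda>x. ennreal (w x)) Q f)"
  shows "\<exists>C. \<forall>Q. is_cube Q \<longrightarrow> (\<forall>h\<in>unit_nonneg_Lp T w Q.
      embeds_with (ennreal C * epowr (\<nu> Q) e) N (wLp_norm q (max_weight s h w Q) UNIV))"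
proof -
  let ?n = "CARD('n)"
  define \<phi> where "\<phi> = (\<lambda>R. \<mu> R powr e)"
  have \<phi>: "0 < \<phi> R" if R: "is_cube R" for R using \<mu>[OF R] by (simp add: \<phi>_def)
  have \<phi>q: "\<phi> R powr q = \<mu> R powr (e * q)" for R by (simp add: \<phi>_def powr_powr)
  have \<phi>_eq: "\<phi> R = \<mu> R powr e" for R by (simp add: \<phi>_def)
  note K1 = K1[folded \<phi>_eq] and K2 = K2[folded \<phi>q]
  have T: "1 < T" "s < T" "0 < T / s"
  proof -
    show "1 < T" using q by (simp add: T_def)
    have "1 < T / s" using t0 by simp
    then show "s < T" "0 < T / s" using s by (auto simp: field_simps)
  qed
  have P3: "power_bound w (s * (T - 1) / (T - s))"
  proof -
    \<comment> \<open>Since t0 < T/s, the exponent needed by \<open>local_average_le\<close> is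
      smaller than the one in \<open>P2\<close>.\<close>
    have "power_bound w ((t0 - 1) / (T / s - 1) * ((T - 1) / (t0 - 1)))"
      using t0 by (intro power_bound_scale P2) auto
    also have "(t0 - 1) / (T / s - 1) * ((T - 1) / (t0 - 1)) = s * (T - 1) / (T - s)"
    proof -
      have "T / s - 1 = (T - s) / s" using s by (simp add: field_simps)
      then show ?thesis using t0 by simp
    qed
    finally show ?thesis .
  qed
  obtain C1 where C1: "0 < C1" "\<And>R A f. is_cube R \<Longrightarrow> f \<in> borel_measurable lebesgue \<Longrightarrow> 0 \<le> A \<Longrightarrow>
     norm_integral p w f R \<le> ennreal (A powr p) \<Longrightarrow>
     (\<integral>\<^sup>+x\<in>R. ennreal (norm (f x) powr q) \<partial>lebesgue)
       \<le> ennreal (C1 * A powr q * rvol R powr (1 - q / p) * avg w R powr (- (q / p)))"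
    using integral_norm_powr_le[OF q P1[unfolded T_def]] by blast
  obtain C2 where C2: "0 < C2" "\<And>Q h. is_cube Q \<Longrightarrow> h \<in> borel_measurable lebesgue \<Longrightarrow> (\<forall>x. 0 \<le> h x) \<Longrightarrow>
     (\<integral>\<^sup>+x\<in>Q. ennreal (h x powr T * w x) \<partial>lebesgue) \<le> 1 \<Longrightarrow>
     epowr ((\<integral>\<^sup>+x\<in>Q. ennreal (h x powr s * w x powr s) \<partial>lebesgue) / vol Q) (1 / s)
       \<le> ennreal (C2 * rvol Q powr (- (1 - q / p)) * avg w Q powr (q / p))"
    using local_average_le[OF q, of s] P3 s T unfolding T_def by auto
  obtain C3 where C3: "0 < C3" "\<And>a l g. 0 < l \<Longrightarrow> g \<in> borel_measurable lebesgue \<Longrightarrow> (\<forall>x. 0 \<le> g x) \<Longrightarrow>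
    (\<integral>\<^sup>+x. epowr (dyadic_max a l g x) (T / s) * ennreal (w x powr (1 - T)) \<partial>lebesgue)
      \<le> ennreal C3 * (\<integral>\<^sup>+x. ennreal (g x powr (T / s) * w x powr (1 - T)) \<partial>lebesgue)"
    using dyadic_max_bound[OF T(1) t0 P1 P2] by blast
  have K1pos: "0 < K1"
  proof -
    have "0 < \<phi> (dilate 0 1 0)" "0 < \<phi> (cube 0 1)" unfolding dilate_def by (auto intro!: \<phi> is_cube_cube)
    then show ?thesis using K1[of 1 0] by (smt (verit) mult_nonpos_nonneg)
  qed
  have K2pos: "0 \<le> K2"
  proof -
    have "0 < \<phi> (cube 0 1)" by (auto intro!: \<phi> is_cube_cube)
    moreover have "0 \<le> K2 * \<rho> ^ 0 * \<phi> (cube 0 1) powr q"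
      by (rule order_trans[OF _ K2[of 1 0 0]]) auto
    ultimately show ?thesis by (simp add: zero_le_mult_iff)
  qed
  \<comment> \<open>\<open>KA\<close> belongs to one shifted grid, of which there are 2^n, and
    \<open>KB\<close> to the dilates, whose contributions sum to the factor 1/(1 - \<rho>).\<close>
  define KA where "KA = (6 ^ ?n) powr (1 / s) * (K1 powr q * C3 powr (1 - q / p))"
  define KB where "KB = 2 powr (?n / s) * C2 * C1 * 3 ^ ?n * K2"
  define C where "C = 2 ^ ?n * KA + KB / (1 - \<rho>)"
  have KA: "0 < KA" using K1pos C3 by (simp add: KA_def)
  have KB: "0 \<le> KB" using C1 C2 K2pos by (simp add: KB_def)
  have C: "0 < C" using KA KB \<rho> by (simp add: C_def add_pos_nonneg)
  have "(\<integral>\<^sup>+x. ennreal (norm (f x) powr q) * max_weight s h w Q x \<partial>lebesgue) \<le> ennreal (C * (A * \<phi> Q) powr q)"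
    if Q: "is_cube Q" and h: "h \<in> unit_nonneg_Lp T w Q" and f [measurable]: "f \<in> borel_measurable lebesgue" and A: "0 \<le> A"
      and le: "\<forall>R. is_cube R \<longrightarrow> norm_integral p w f R \<le> ennreal ((A * \<phi> R) powr p)"
    for Q h f A
  proof -
    obtain c l where l: "0 < l" and Qc: "Q = cube c l" using Q by (auto simp: is_cube_iff)
    have Qs [measurable]: "Q \<in> sets lebesgue" by (simp add: Qc)
    have T0: "0 < T" using T by simp
    define h' where "h' = (\<lambda>x. if x \<in> Q then h x else 0)"
    have h': "h' \<in> borel_measurable lebesgue" "0 \<le> h' x"
      "(\<integral>\<^sup>+x. ennreal (h' x powr T * w x) \<partial>lebesgue) = 1"
      "max_weight s h w Q x = epowr (maximal (\<lambda>y. h' y powr s * w y powr s) x) (1 / s)" for x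
      unfolding h'_def by (fact unit_nonneg_Lp_extend[OF h Qs T0 w_nonneg])+
    note [measurable] = h'(1)
    define g where "g = (\<lambda>y. h' y powr s * w y powr s)"
    have gm [measurable]: "g \<in> borel_measurable lebesgue" by (simp add: g_def)
    have g0: "0 \<le> g y" for y by (simp add: g_def)
    have supp: "g y = 0" if "y \<notin> cube c l" for y using that by (simp add: g_def h'_def Qc)
    \<comment> \<open>The weight w^(1-T) is exactly what turns the L_(T/s) norm of g = h^s w^s into
      the normalization of h.\<close>
    have "(\<integral>\<^sup>+x. ennreal (g x powr (T / s) * w x powr (1 - T)) \<partial>lebesgue) = (\<integral>\<^sup>+x. ennreal (h' x powr T * w x) \<partial>lebesgue)"
    proof (rule nn_integral_cong_AE)
      show "AE x in lebesgue. ennreal (g x powr (T / s) * w x powr (1 - T)) = ennreal (h' x powr T * w x)"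
        using w_pos
      proof eventually_elim
        case (elim x)
        have "g x powr (T / s) * w x powr (1 - T) = h' x powr T * (w x powr T * w x powr (1 - T))"
          using s T0 by (simp add: g_def powr_mult powr_powr)
        also have "w x powr T * w x powr (1 - T) = w x" using elim by (simp flip: powr_add)
        finally show ?case by simp
      qed
    qed
    then have mass_g: "(\<integral>\<^sup>+x. ennreal (g x powr (T / s) * w x powr (1 - T)) \<partial>lebesgue) = 1"
      using h'(3) by simp
    let ?D = "\<lambda>\<eta>. dyadic_max (shift c l \<eta>) (3 * l) g"
    have Dm [measurable]: "?D \<eta> \<in> borel_measurable lebesgue" for \<eta>
      using l by (intro borel_measurable_dyadic_max) auto
    define L where "L = rvol Q"
    define a where "a = avg w Q"
    define Lk where "Lk = (\<lambda>k. rvol (dilate c l k))"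
    define ak where "ak = (\<lambda>k. avg w (dilate c l k))"
    have cube_k: "is_cube (dilate c l k)" for k
      unfolding dilate_def using l by (intro is_cube_cube mult_pos_pos add_pos_pos) auto
    have dil_sets [measurable]: "dilate c l k \<in> sets lebesgue" for k by (simp add: dilate_def)
    have pos: "0 < L" "0 < a" "0 < Lk k" "0 < ak k" for k
      unfolding L_def a_def Lk_def ak_def using measure_cube_pos[OF Q] avg_w_pos[OF Q] measure_cube_pos[OF cube_k] avg_w_pos[OF cube_k] by auto
    have \<phi>pos: "0 < \<phi> Q" "0 < \<phi> (dilate c l k)" for k by (rule \<phi>[OF Q], rule \<phi>[OF cube_k])
    define J where "J = (\<integral>\<^sup>+y. ennreal (g y) \<partial>lebesgue)"
    define B where "B = (\<lambda>k. epowr (ennreal (2 ^ ?n / 2 ^ (k * ?n)) * (J / ennreal (l ^ ?n))) (1 / s))"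
    have B: "B k \<le> ennreal ((2 ^ ?n / 2 ^ (k * ?n)) powr (1 / s) * (C2 * L powr (- (1 - q / p)) * a powr (q / p)))" for k
    proof -
      have J: "J = (\<integral>\<^sup>+x\<in>Q. ennreal (h' x powr s * w x powr s) \<partial>lebesgue)"
        unfolding J_def g_def by (intro nn_integral_cong) (auto simp: h'_def split: split_indicator)
      have "(\<integral>\<^sup>+x\<in>Q. ennreal (h' x powr T * w x) \<partial>lebesgue) \<le> (\<integral>\<^sup>+x. ennreal (h' x powr T * w x) \<partial>lebesgue)"
        by (intro nn_integral_mono) (auto split: split_indicator)
      then have "epowr (J / vol Q) (1 / s) \<le> ennreal (C2 * L powr (- (1 - q / p)) * a powr (q / p))"
        unfolding J L_def a_def using h'(2,3) by (intro C2(2) Q h'(1)) auto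
      moreover have "vol Q = ennreal (l ^ ?n)" using l by (simp add: Qc emeasure_cube)
      moreover have "B k = ennreal ((2 ^ ?n / 2 ^ (k * ?n)) powr (1 / s)) * epowr (J / ennreal (l ^ ?n)) (1 / s)"
        unfolding B_def using s by (subst epowr_mult) (auto simp: epowr_ennreal)
      ultimately have "B k \<le> ennreal ((2 ^ ?n / 2 ^ (k * ?n)) powr (1 / s)) * ennreal (C2 * L powr (- (1 - q / p)) * a powr (q / p))"
        by (simp add: mult_left_mono)
      also have "\<dots> = ennreal ((2 ^ ?n / 2 ^ (k * ?n)) powr (1 / s) * (C2 * L powr (- (1 - q / p)) * a powr (q / p)))"
        using C2(1) by (intro ennreal_mult[symmetric]) auto
      finally show ?thesis .
    qed
    let ?I = "\<lambda>\<eta>. \<integral>\<^sup>+x\<in>dilate c l 0. ennreal (norm (f x) powr q) * epowr (ennreal (6 ^ ?n) * ?D \<eta> x) (1 / s) \<partial>lebesgue"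
    let ?F = "\<lambda>k. \<integral>\<^sup>+x\<in>dilate c l k. ennreal (norm (f x) powr q) \<partial>lebesgue"
    have max_le: "max_weight s h w Q x \<le>
       (\<Sum>\<eta>\<in>UNIV. epowr (ennreal (6 ^ ?n) * ?D \<eta> x) (1 / s) * indicator (dilate c l 0) x)
       + (\<Sum>k. B k * indicator (dilate c l k) x)" for x
      unfolding h'(4) B_def J_def g_def[symmetric] using s by (intro maximal_pointwise l g0 supp) auto
    have "(\<integral>\<^sup>+x. ennreal (norm (f x) powr q) * max_weight s h w Q x \<partial>lebesgue)
      \<le> (\<integral>\<^sup>+x. (\<Sum>\<eta>\<in>UNIV. ennreal (norm (f x) powr q) * epowr (ennreal (6 ^ ?n) * ?D \<eta> x) (1 / s) * indicator (dilate c l 0) x)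
         + (\<Sum>k. B k * (ennreal (norm (f x) powr q) * indicator (dilate c l k) x)) \<partial>lebesgue)"
    proof (rule nn_integral_mono)
      fix x
      have "ennreal (norm (f x) powr q) * max_weight s h w Q x \<le> ennreal (norm (f x) powr q) *
        ((\<Sum>\<eta>\<in>UNIV. epowr (ennreal (6 ^ ?n) * ?D \<eta> x) (1 / s) * indicator (dilate c l 0) x)
         + (\<Sum>k. B k * indicator (dilate c l k) x))"
        by (intro mult_left_mono max_le) simp
      also have "\<dots> = (\<Sum>\<eta>\<in>UNIV. ennreal (norm (f x) powr q) * epowr (ennreal (6 ^ ?n) * ?D \<eta> x) (1 / s) * indicator (dilate c l 0) x)
         + (\<Sum>k. B k * (ennreal (norm (f x) powr q) * indicator (dilate c l k) x))"
        by (simp add: distrib_left sum_distrib_left mult.assoc mult.left_commute flip: ennreal_suminf_cmult)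
      finally show "ennreal (norm (f x) powr q) * max_weight s h w Q x \<le> \<dots>" .
    qed
    also have "\<dots> = (\<Sum>\<eta>\<in>UNIV. ?I \<eta>)
         + (\<Sum>k. B k * ?F k)"
    proof (subst nn_integral_add)
      have "(\<integral>\<^sup>+x. (\<Sum>k. B k * (ennreal (norm (f x) powr q) * indicator (dilate c l k) x)) \<partial>lebesgue)
        = (\<Sum>k. (\<integral>\<^sup>+x. B k * (ennreal (norm (f x) powr q) * indicator (dilate c l k) x) \<partial>lebesgue))"
        by (rule nn_integral_suminf) measurable
      also have "\<dots> = (\<Sum>k. B k * ?F k)"
        by (intro suminf_cong nn_integral_cmult) measurable
      finally show "(\<integral>\<^sup>+x. (\<Sum>\<eta>\<in>UNIV. ennreal (norm (f x) powr q) * epowr (ennreal (6 ^ ?n) * ?D \<eta> x) (1 / s) * indicator (dilate c l 0) x) \<partial>lebesgue)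
          + (\<integral>\<^sup>+x. (\<Sum>k. B k * (ennreal (norm (f x) powr q) * indicator (dilate c l k) x)) \<partial>lebesgue)
        = (\<Sum>\<eta>\<in>UNIV. ?I \<eta>)
          + (\<Sum>k. B k * ?F k)"
        by (subst nn_integral_sum) auto
    qed measurable
    also have "\<dots> \<le> ennreal (2 ^ ?n * KA * (A * \<phi> Q) powr q) + ennreal (KB * (A * \<phi> Q) powr q / (1 - \<rho>))"
    proof (rule add_mono)
      have "?I \<eta>
         \<le> ennreal (KA * (A * \<phi> Q) powr q)" for \<eta>
      proof -
        have "?I \<eta>
           = (\<integral>\<^sup>+x. ennreal ((6 ^ ?n) powr (1 / s)) * (ennreal (norm (f x) powr q) * epowr (?D \<eta> x) (1 / s) * indicator (dilate c l 0) x) \<partial>lebesgue)"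
          using s by (intro nn_integral_cong) (simp add: epowr_mult epowr_ennreal mult_ac)
        also have "\<dots> = ennreal ((6 ^ ?n) powr (1 / s)) *
            (\<integral>\<^sup>+x\<in>dilate c l 0. ennreal (norm (f x) powr q) * epowr (?D \<eta> x) (1 / s) \<partial>lebesgue)"
          by (rule nn_integral_cmult) measurable
        also have "\<dots> \<le> ennreal ((6 ^ ?n) powr (1 / s)) * ennreal ((A * \<phi> (dilate c l 0)) powr q * C3 powr (1 - q / p))"
        proof (intro mult_left_mono local_term_le q)
          show "norm_integral p w f (dilate c l 0) \<le> ennreal ((A * \<phi> (dilate c l 0)) powr p)"
            using le cube_k by blast
          show "(\<integral>\<^sup>+x. epowr (?D \<eta> x) (p / (p - q) / s) * ennreal (w x powr (1 - p / (p - q))) \<partial>lebesgue) \<le> ennreal C3"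
            using C3(2)[of "3 * l" g "shift c l \<eta>"] l g0 unfolding mass_g by (simp add: T_def)
        qed (use s A less_imp_le[OF \<phi>pos(2)[of 0]] C3(1) in \<open>auto intro!: mult_nonneg_nonneg\<close>)
        also have "\<dots> = ennreal ((6 ^ ?n) powr (1 / s) * ((A * \<phi> (dilate c l 0)) powr q * C3 powr (1 - q / p)))"
          by (intro ennreal_mult[symmetric]) auto
        also have "\<dots> \<le> ennreal (KA * (A * \<phi> Q) powr q)"
        proof (rule ennreal_leI)
          have "(A * \<phi> (dilate c l 0)) powr q \<le> (A * (K1 * \<phi> Q)) powr q"
            using K1[OF l, of c] A q \<phi>pos by (intro powr_mono2 mult_left_mono) (auto simp: Qc less_imp_le)
          also have "\<dots> = K1 powr q * (A * \<phi> Q) powr q" by (simp add: powr_mult)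
          finally have "(6 ^ ?n) powr (1 / s) * ((A * \<phi> (dilate c l 0)) powr q * C3 powr (1 - q / p))
            \<le> (6 ^ ?n) powr (1 / s) * (K1 powr q * (A * \<phi> Q) powr q * C3 powr (1 - q / p))"
            by (intro mult_left_mono mult_right_mono) auto
          then show "(6 ^ ?n) powr (1 / s) * ((A * \<phi> (dilate c l 0)) powr q * C3 powr (1 - q / p)) \<le> KA * (A * \<phi> Q) powr q"
            by (simp add: KA_def mult_ac)
        qed
        finally show ?thesis .
      qed
      then have "(\<Sum>\<eta>\<in>UNIV. ?I \<eta>)
        \<le> (\<Sum>\<eta>\<in>(UNIV :: (bool ^ 'n) set). ennreal (KA * (A * \<phi> Q) powr q))"
        by (intro sum_mono)
      also have "\<dots> = ennreal (2 ^ ?n * KA * (A * \<phi> Q) powr q)"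
        using KA by (subst sum_ennreal) (auto simp: mult_ac)
      finally show "(\<Sum>\<eta>\<in>UNIV. ?I \<eta>)
        \<le> ennreal (2 ^ ?n * KA * (A * \<phi> Q) powr q)" .
      have "B k * ?F k \<le> ennreal (KB * (A * \<phi> Q) powr q * \<rho> ^ k)" for k
      proof -
        let ?\<phi>k = "\<phi> (dilate c l k)"
        define b1 where "b1 = (2 ^ ?n / 2 ^ (k * ?n)) powr (1 / s) * (C2 * L powr (- (1 - q / p)) * a powr (q / p))"
        define b2 where "b2 = C1 * (A * ?\<phi>k) powr q * Lk k powr (1 - q / p) * ak k powr (- (q / p))"
        have b0: "0 \<le> b1" "0 \<le> b2" using C1 C2 by (auto simp: b1_def b2_def)
        have "?F k \<le> ennreal b2"
          unfolding b2_def Lk_def ak_def using A less_imp_le[OF \<phi>pos(2)[of k]] le cube_k by (intro C1(2)) (auto intro!: mult_nonneg_nonneg)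
        then have "B k * ?F k \<le> ennreal b1 * ennreal b2"
          using B[of k] unfolding b1_def by (intro mult_mono) auto
        also have "\<dots> = ennreal (b1 * b2)" using b0 by (simp add: ennreal_mult)
        also have "\<dots> \<le> ennreal (KB * (A * \<phi> Q) powr q * \<rho> ^ k)"
        proof (rule ennreal_leI)
          define M where "M = (mass Q / mass (dilate c l k)) powr (q / p)"
          have mass_eq: "mass Q = a * L" "mass (dilate c l k) = ak k * Lk k"
            by (simp_all add: mass_def a_def L_def ak_def Lk_def)
          \<comment> \<open>Hoelder on the dilate and Hoelder on Q combine to the volume ratio times
            a power of the mass ratio.\<close>
          have ratio: "L powr (- (1 - q / p)) * a powr (q / p) * (Lk k powr (1 - q / p) * ak k powr (- (q / p))) = Lk k / L * M"
            unfolding M_def mass_eq using pos(1,2) pos(3)[of k] pos(4)[of k]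
            by (simp add: powr_divide powr_mult powr_diff powr_minus_divide field_simps)
          have two: "(2 ^ ?n / 2 ^ (k * ?n) :: real) powr (1 / s) = 2 powr (?n / s) * 2 powr (- (k * ?n * (1 / s)))"
            by (simp add: powr_divide powr_realpow[symmetric] powr_powr powr_minus_divide del: of_nat_mult)
          have Lkle: "Lk k / L \<le> 3 ^ ?n * 2 powr (k * ?n)"
          proof -
            have "Lk k = (l * (1 + 2 ^ (k + 1))) ^ ?n" "L = l ^ ?n"
              unfolding Lk_def L_def dilate_def Qc using l by (auto intro!: measure_cube)
            then have "Lk k / L = (1 + 2 ^ (k + 1)) ^ ?n" using l by (simp add: power_mult_distrib)
            also have "\<dots> \<le> (3 * 2 ^ k) ^ ?n" by (intro power_mono) auto
            also have "\<dots> = 3 ^ ?n * 2 powr (k * ?n)"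
              by (simp add: power_mult_distrib powr_realpow[symmetric] powr_powr)
            finally show ?thesis .
          qed
          have "b1 * b2 = 2 powr (?n / s) * C2 * C1 * (A powr q * ?\<phi>k powr q) * 2 powr (- (k * ?n * (1 / s))) *
             (L powr (- (1 - q / p)) * a powr (q / p) * (Lk k powr (1 - q / p) * ak k powr (- (q / p))))"
            unfolding b1_def b2_def two powr_mult by (simp only: mult_ac)
          also have "\<dots> = 2 powr (?n / s) * C2 * C1 * A powr q * ?\<phi>k powr q * 2 powr (- (k * ?n * (1 / s))) * M * (Lk k / L)"
            unfolding ratio by (simp only: mult_ac)
          also have "\<dots> \<le> 2 powr (?n / s) * C2 * C1 * A powr q * ?\<phi>k powr q * 2 powr (- (k * ?n * (1 / s))) * M * (3 ^ ?n * 2 powr (k * ?n))"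
            using C1 C2 by (intro mult_left_mono Lkle) (auto simp: M_def)
          also have "\<dots> = 2 powr (?n / s) * C2 * C1 * A powr q * 3 ^ ?n * (?\<phi>k powr q * (2 powr (- (k * ?n * (1 / s))) * 2 powr (k * ?n)) * M)"
            by (simp only: mult_ac)
          \<comment> \<open>The volume ratio contributes 2^(kn) and the decay of averages over large
            cubes 2^(-kn/s).\<close>
          also have "2 powr (- (k * ?n * (1 / s))) * 2 powr (k * ?n) = 2 powr (k * ?n * (1 - 1 / s))"
            unfolding powr_add[symmetric] by (simp add: algebra_simps)
          also have "2 powr (?n / s) * C2 * C1 * A powr q * 3 ^ ?n * (?\<phi>k powr q * 2 powr (k * ?n * (1 - 1 / s)) * M)
             \<le> 2 powr (?n / s) * C2 * C1 * A powr q * 3 ^ ?n * (K2 * \<rho> ^ k * \<phi> Q powr q)"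
            using C1 C2 K2[OF l, of c k] unfolding M_def Qc by (intro mult_left_mono) auto
          also have "\<dots> = KB * (A * \<phi> Q) powr q * \<rho> ^ k"
            by (simp add: KB_def powr_mult mult_ac)
          finally show "b1 * b2 \<le> KB * (A * \<phi> Q) powr q * \<rho> ^ k" .
        qed
        finally show ?thesis .
      qed
      then have "(\<Sum>k. B k * ?F k) \<le> (\<Sum>k. ennreal (KB * (A * \<phi> Q) powr q * \<rho> ^ k))"
        by (intro suminf_le) auto
      also have "\<dots> = ennreal (\<Sum>k. KB * (A * \<phi> Q) powr q * \<rho> ^ k)"
        using KB \<rho> by (intro suminf_ennreal2 summable_mult summable_geometric) auto
      also have "(\<Sum>k. KB * (A * \<phi> Q) powr q * \<rho> ^ k) = KB * (A * \<phi> Q) powr q / (1 - \<rho>)"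
        using \<rho> by (subst suminf_mult) (auto simp: suminf_geometric)
      finally show "(\<Sum>k. B k * ?F k) \<le> ennreal (KB * (A * \<phi> Q) powr q / (1 - \<rho>))" .
    qed
    also have "\<dots> = ennreal (2 ^ ?n * KA * (A * \<phi> Q) powr q + KB * (A * \<phi> Q) powr q / (1 - \<rho>))"
      using KA KB \<rho> by (intro ennreal_plus[symmetric]) auto
    also have "2 ^ ?n * KA * (A * \<phi> Q) powr q + KB * (A * \<phi> Q) powr q / (1 - \<rho>) = C * (A * \<phi> Q) powr q"
      by (simp add: C_def algebra_simps)
    finally show ?thesis .
  qed
  then have "embeds_with (ennreal (C powr (1 / q)) * epowr (\<nu> Q) e) N (wLp_norm q (max_weight s h w Q) UNIV)"
    if Q: "is_cube Q" and "h \<in> unit_nonneg_Lp T w Q" for Q h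
    unfolding \<nu>[OF Q] epowr_ennreal_pos[OF \<mu>[OF Q]] using that q C
    by (intro embeds_with_of_bound[OF _ _ _ _ \<nu> \<mu> N]) (auto simp: \<phi>_def)
  then show ?thesis by blast
qed

end


lemma embeds_smaller_weight:
  fixes N :: "(real ^ 'n \<Rightarrow> complex) \<Rightarrow> ennreal"
  assumes q: "0 < q" and c: "0 < c" and E: "embeds_with (ennreal C) N (wLp_norm q V UNIV)"
    and U [measurable]: "U \<in> borel_measurable lebesgue" and le: "\<And>x. ennreal c * U x \<le> V x"
  shows "embeds N (wLp_norm q U UNIV)"
proof -
  \<comment> \<open>C may be negative, and then \<open>ennreal C\<close> is 0.\<close>
  let ?K = "(1 / c) powr (1 / q) * max C 0"
  have main: "wLp_norm q U UNIV f \<le> ennreal ?K * N f" if f: "f \<in> fun_space N" for f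
  proof -
    have [measurable]: "f \<in> borel_measurable lebesgue" using f by (simp add: fun_space_def)
    have "(\<integral>\<^sup>+x. ennreal (norm (f x) powr q) * U x \<partial>lebesgue)
       \<le> (\<integral>\<^sup>+x. ennreal (1 / c) * (ennreal (norm (f x) powr q) * (ennreal c * U x)) \<partial>lebesgue)"
    proof (rule nn_integral_mono)
      fix x
      have "ennreal (1 / c) * ennreal c = 1" using c by (simp flip: ennreal_mult)
      then have "ennreal (1 / c) * (ennreal (norm (f x) powr q) * (ennreal c * U x)) = ennreal (norm (f x) powr q) * U x"
        by (metis mult.assoc mult.left_commute mult_1)
      then show "ennreal (norm (f x) powr q) * U x \<le> ennreal (1 / c) * (ennreal (norm (f x) powr q) * (ennreal c * U x))"
        by simp
    qed
    also have "\<dots> = ennreal (1 / c) * (\<integral>\<^sup>+x. ennreal (norm (f x) powr q) * (ennreal c * U x) \<partial>lebesgue)"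
      by (rule nn_integral_cmult) measurable
    also have "\<dots> \<le> ennreal (1 / c) * (\<integral>\<^sup>+x. ennreal (norm (f x) powr q) * V x \<partial>lebesgue)"
      by (intro mult_left_mono nn_integral_mono le) auto
    finally have "wLp_norm q U UNIV f \<le> epowr (ennreal (1 / c) * (\<integral>\<^sup>+x. ennreal (norm (f x) powr q) * V x \<partial>lebesgue)) (1 / q)"
      unfolding wLp_norm_def using q by (intro epowr_mono) auto
    also have "\<dots> = ennreal ((1 / c) powr (1 / q)) * wLp_norm q V UNIV f"
      unfolding wLp_norm_def using q c by (subst epowr_mult) (auto simp: epowr_ennreal)
    also have "\<dots> \<le> ennreal ((1 / c) powr (1 / q)) * (ennreal (max C 0) * N f)"
      using E f by (intro mult_left_mono) (auto simp: embeds_with_def max_def ennreal_neg split: if_splits)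
    also have "\<dots> = ennreal ?K * N f" by (simp add: ennreal_mult mult.assoc)
    finally show ?thesis .
  qed
  have "f \<in> fun_space (wLp_norm q U UNIV)" if f: "f \<in> fun_space N" for f
  proof -
    have "ennreal ?K * N f < \<infinity>" using f by (auto simp: fun_space_def ennreal_mult_less_top)
    then show ?thesis using main[OF f] f by (auto simp: fun_space_def order_le_less_trans)
  qed
  then show ?thesis using main unfolding embeds_def embeds_with_def by blast
qed

section \<open>Volume and mass of dilates, and the two Morrey scales\<close>

lemma measure_dilate:
  fixes c :: "real ^ 'n"
  assumes "0 < l"
  shows "rvol (dilate c l k) = (1 + 2 ^ (k + 1)) ^ CARD('n) * rvol (cube c l)"
proof -
  have "rvol (dilate c l k) = (l * (1 + 2 ^ (k + 1))) ^ CARD('n)"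
    unfolding dilate_def using assms by (intro measure_cube) auto
  then show ?thesis using assms by (simp add: measure_cube power_mult_distrib mult.commute)
qed

lemma dilate_ratio:
  fixes c :: "real ^ 'n"
  assumes "0 < l"
  shows "2 powr (k * CARD('n)) \<le> rvol (dilate c l k) / rvol (cube c l)"
    and "rvol (dilate c l k) / rvol (cube c l) \<le> 3 powr CARD('n) * 2 powr (k * CARD('n))"
proof -
  have e: "rvol (dilate c l k) / rvol (cube c l) = (1 + 2 ^ (k + 1)) ^ CARD('n)"
    using measure_cube_pos[OF is_cube_cube[OF assms, of c]] by (simp add: measure_dilate[OF assms])
  have two: "2 powr (k * CARD('n)) = (2 ^ k :: real) ^ CARD('n)"
    by (simp add: powr_realpow[symmetric] powr_powr)
  have "(2 ^ k) ^ CARD('n) \<le> (1 + 2 ^ (k + 1) :: real) ^ CARD('n)" by (intro power_mono) auto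
  then show "2 powr (k * CARD('n)) \<le> rvol (dilate c l k) / rvol (cube c l)"
    unfolding e two .
  have "(1 + 2 ^ (k + 1) :: real) ^ CARD('n) \<le> (3 * 2 ^ k) ^ CARD('n)" by (intro power_mono) auto
  also have "\<dots> = 3 powr CARD('n) * 2 powr (k * CARD('n))"
    unfolding two by (simp add: power_mult_distrib powr_realpow)
  finally show "rvol (dilate c l k) / rvol (cube c l) \<le> 3 powr CARD('n) * 2 powr (k * CARD('n))"
    unfolding e .
qed

lemma is_cube_dilate: "0 < l \<Longrightarrow> is_cube (dilate c l k)"
  unfolding dilate_def by (intro is_cube_cube mult_pos_pos add_pos_pos) auto

lemma cube_subset_dilate: "0 < l \<Longrightarrow> cube c l \<subseteq> dilate c l k"
proof
  fix x assume l: "0 < l" and x: "x \<in> cube c l"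
  have "0 < 2 ^ k * l" using l by simp
  then show "x \<in> dilate c l k" using x unfolding mem_cube mem_dilate by (smt (verit))
qed

context positive_weight
begin

text \<open>Reverse doubling: the volume ratio decays like 2^(-kn), and \<open>mass_ratio_le\<close>
  passes a power of this decay to the masses.\<close>

lemma mass_dilate:
  assumes "power_bound w \<sigma>" "1 < \<sigma>"
  shows "\<exists>C>0. \<forall>c l k. 0 < l \<longrightarrow>
     mass (cube c l) / mass (dilate c l k) \<le> C * 2 powr (- (k * CARD('n) * (1 - 1 / \<sigma>)))"
proof -
  obtain C where C: "0 < C" "\<And>Q R. is_cube Q \<Longrightarrow> is_cube R \<Longrightarrow> Q \<subseteq> R \<Longrightarrow>
     mass Q \<le> C * mass R * (rvol Q / rvol R) powr (1 - 1 / \<sigma>)"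
    using mass_ratio_le[OF assms] by blast
  have "mass (cube c l) / mass (dilate c l k) \<le> C * 2 powr (- (k * CARD('n) * (1 - 1 / \<sigma>)))"
    if l: "0 < l" for c l k
  proof -
    let ?Q = "cube c l" and ?R = "dilate c l k"
    have Q: "is_cube ?Q" "is_cube ?R" using l by (auto intro: is_cube_cube is_cube_dilate)
    have m: "0 < rvol ?Q" "0 < rvol ?R" using Q by (auto intro: measure_cube_pos)
    have "mass ?Q / mass ?R \<le> C * (rvol ?Q / rvol ?R) powr (1 - 1 / \<sigma>)"
      using C(2)[OF Q cube_subset_dilate[OF l]] mass_pos[OF Q(2)] by (simp add: field_simps)
    also have "\<dots> \<le> C * (2 powr (- (k * CARD('n)))) powr (1 - 1 / \<sigma>)"
    proof (intro mult_left_mono powr_mono2)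
      have "rvol ?Q / rvol ?R = 1 / (rvol ?R / rvol ?Q)" by simp
      also have "\<dots> \<le> 1 / 2 powr (k * CARD('n))"
        using dilate_ratio(1)[OF l, of k c] m by (intro divide_left_mono) auto
      finally show "rvol ?Q / rvol ?R \<le> 2 powr (- (k * CARD('n)))"
        by (simp add: powr_minus_divide)
    qed (use C assms m in auto)
    also have "\<dots> = C * 2 powr (- (k * CARD('n) * (1 - 1 / \<sigma>)))" by (simp add: powr_powr)
    finally show ?thesis .
  qed
  then show ?thesis using C by blast
qed

lemma doubling_mass:
  assumes "power_bound w \<beta>" "\<beta> < 0"
  shows "\<exists>C>0. \<forall>c l. 0 < l \<longrightarrow> mass (dilate c l 0) \<le> C * mass (cube c l)"
proof -
  \<comment> \<open>The first dilate has three times the side of the cube.\<close>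
  obtain C where C: "0 < C" "\<And>Q R. is_cube Q \<Longrightarrow> is_cube R \<Longrightarrow> Q \<subseteq> R \<Longrightarrow>
     rvol R \<le> 3 ^ CARD('n) * rvol Q \<Longrightarrow> mass R \<le> C * mass Q"
    using doubling[OF assms, of "3 ^ CARD('n)"] by auto
  have "mass (dilate c l 0) \<le> C * mass (cube c l)" if l: "0 < l" for c l
    using l by (intro C(2) cube_subset_dilate is_cube_cube is_cube_dilate) (auto simp: measure_dilate)
  then show ?thesis using C by blast
qed

text \<open>\<open>\<sigma>\<^sub>1\<close> is the improved reverse Hoelder exponent; the strict inequality on \<open>s\<close> makes the sum over
  the dilates of \<open>Q\<close> geometric.\<close>

lemma embedding_mass:
  fixes p q s t0 r \<sigma>1 :: real
  defines "T \<equiv> p / (p - q)" and "e \<equiv> 1 / p + r / CARD('n)"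
  assumes q: "0 < q" "q < p" and s: "1 \<le> s" and t0: "1 < t0" "t0 < T / s"
    and P1: "power_bound w (1 - T)" and P2: "power_bound w ((T - 1) / (t0 - 1))"
    and \<sigma>1: "power_bound w \<sigma>1" "1 < \<sigma>1" and r: "r < 0" "0 \<le> e"
    and strict: "CARD('n) * (1 - 1 / s) + q * r * (1 - 1 / \<sigma>1) < 0"
  shows "\<exists>C. \<forall>Q. is_cube Q \<longrightarrow> (\<forall>h\<in>unit_nonneg_Lp T w Q.
      embeds_with (ennreal C * epowr (wmeas w Q) e) (morrey_norm p r w) (wLp_norm q (max_weight s h w Q) UNIV))"
proof -
  let ?n = "CARD('n)"
  obtain Cd where Cd: "0 < Cd" "\<And>c l. 0 < l \<Longrightarrow> mass (dilate c l 0) \<le> Cd * mass (cube c l)"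
    using doubling_mass[OF P1] q by (auto simp: T_def)
  obtain Cm where Cm: "0 < Cm" "\<And>c l k. 0 < l \<Longrightarrow>
     mass (cube c l) / mass (dilate c l k) \<le> Cm * 2 powr (- (k * ?n * (1 - 1 / \<sigma>1)))"
    using mass_dilate[OF \<sigma>1] by blast
  \<comment> \<open>2^d will be the ratio of the series, so \<open>strict\<close> is its
    convergence.\<close>
  define d where "d = ?n * (1 - 1 / s) + q * r * (1 - 1 / \<sigma>1)"
  define \<rho> where "\<rho> = 2 powr d"
  have \<rho>: "0 \<le> \<rho>" "\<rho> < 1" using strict by (auto simp: \<rho>_def d_def powr_less_one)
  define g where "g = - (q * r / ?n)"
  have g: "0 < g" using q r by (auto simp: g_def mult_pos_neg divide_neg_pos)
  \<comment> \<open>The part e q of the exponent of the mass ratio cancels the growth of the Morrey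
    bound; the positive rest g meets the decay from \<open>mass_dilate\<close>.\<close>
  have eg: "q / p = e * q + g" using q by (simp add: e_def g_def field_simps)
  show ?thesis
    unfolding T_def
  proof (rule embedding_of_growth[OF q s t0(1), where \<mu> = mass and \<nu> = "wmeas w"])
    show "t0 < p / (p - q) / s" "power_bound w (1 - p / (p - q))" "power_bound w ((p / (p - q) - 1) / (t0 - 1))"
      using t0 P1 P2 by (simp_all add: T_def)
    show "morrey_norm p r w = (\<lambda>f. SUP Q\<in>Collect is_cube. epowr (wmeas w Q) (- e) * wLp_norm p (\<lambda>x. ennreal (w x)) Q f)"
      by (simp add: morrey_norm_def e_def fun_eq_iff)
    show "mass (dilate c l 0) powr e \<le> Cd powr e * mass (cube c l) powr e" if l: "0 < l" for c l
      using powr_mono2[OF r(2) _ Cd(2)[OF l, of c]] mass_pos[OF is_cube_dilate[OF l, of c 0]]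
      by (simp add: powr_mult)
    show "0 \<le> \<rho>" "\<rho> < 1" by fact+
    show "mass (dilate c l k) powr (e * q) * 2 powr (k * ?n * (1 - 1 / s)) *
        (mass (cube c l) / mass (dilate c l k)) powr (q / p) \<le> Cm powr g * \<rho> ^ k * mass (cube c l) powr (e * q)"
      if l: "0 < l" for c l and k :: nat
    proof -
      let ?x = "mass (cube c l)" and ?y = "mass (dilate c l k)"
      have xy: "0 < ?x" "0 < ?y" using l by (auto intro!: mass_pos is_cube_cube is_cube_dilate)
      have "(?x / ?y) powr (q / p) = (?x / ?y) powr (e * q) * (?x / ?y) powr g"
        unfolding eg powr_add ..
      moreover have "?y powr (e * q) * (?x / ?y) powr (e * q) = ?x powr (e * q)"
        using xy by (simp add: powr_divide)
      ultimately have "?y powr (e * q) * 2 powr (k * ?n * (1 - 1 / s)) * (?x / ?y) powr (q / p)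
         = ?x powr (e * q) * 2 powr (k * ?n * (1 - 1 / s)) * (?x / ?y) powr g"
        by (simp add: mult_ac)
      also have "\<dots> \<le> ?x powr (e * q) * 2 powr (k * ?n * (1 - 1 / s)) * (Cm * 2 powr (- (k * ?n * (1 - 1 / \<sigma>1)))) powr g"
        using xy g Cm(2)[OF l, of c k] by (intro mult_left_mono powr_mono2) auto
      also have "\<dots> = Cm powr g * (2 powr (k * ?n * (1 - 1 / s)) * 2 powr (- (k * ?n * (1 - 1 / \<sigma>1)) * g)) * ?x powr (e * q)"
        using Cm by (simp add: powr_mult powr_powr)
      also have "2 powr (k * ?n * (1 - 1 / s)) * 2 powr (- (k * ?n * (1 - 1 / \<sigma>1)) * g) = \<rho> ^ k"
      proof -
        have "k * ?n * (1 - 1 / s) + - (k * ?n * (1 - 1 / \<sigma>1)) * g = k * d"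
          by (simp add: d_def g_def algebra_simps)
        moreover have "\<rho> ^ k = 2 powr (k * d)" by (simp add: \<rho>_def powr_realpow[symmetric] powr_powr mult.commute)
        ultimately show ?thesis unfolding powr_add[symmetric] by simp
      qed
      finally show ?thesis .
    qed
  qed (auto simp: wmeas_mass mass_pos)
qed

text \<open>Here the Morrey bound grows like 2^(kneq) with the volume, and the whole power q/p of
  the mass ratio has to work against it. Inserting e gives the exponent in
  \<open>strict\<close>.\<close>

lemma embedding_lambda:
  fixes p q s t0 r \<sigma>1 :: real
  defines "T \<equiv> p / (p - q)" and "e \<equiv> 1 / p + r / CARD('n)"
  assumes q: "0 < q" "q < p" and s: "1 \<le> s" and t0: "1 < t0" "t0 < T / s"
    and P1: "power_bound w (1 - T)" and P2: "power_bound w ((T - 1) / (t0 - 1))"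
    and \<sigma>1: "power_bound w \<sigma>1" "1 < \<sigma>1" and e: "0 \<le> e"
    and strict: "CARD('n) * (1 - 1 / s) + q * r + CARD('n) * q / (p * \<sigma>1) < 0"
  shows "\<exists>C. \<forall>Q. is_cube Q \<longrightarrow> (\<forall>h\<in>unit_nonneg_Lp T w Q.
      embeds_with (ennreal C * epowr (vol Q) e) (morrey_norm_lambda p r w) (wLp_norm q (max_weight s h w Q) UNIV))"
proof -
  let ?n = "CARD('n)"
  obtain Cm where Cm: "0 < Cm" "\<And>c l k. 0 < l \<Longrightarrow>
     mass (cube c l) / mass (dilate c l k) \<le> Cm * 2 powr (- (k * ?n * (1 - 1 / \<sigma>1)))"
    using mass_dilate[OF \<sigma>1] by blast
  define d where "d = ?n * (1 - 1 / s) + q * r + ?n * q / (p * \<sigma>1)"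
  define \<rho> where "\<rho> = 2 powr d"
  have \<rho>: "0 \<le> \<rho>" "\<rho> < 1" using strict by (auto simp: \<rho>_def d_def powr_less_one)
  show ?thesis
    unfolding T_def
  proof (rule embedding_of_growth[OF q s t0(1), where \<mu> = rvol and \<nu> = "vol"])
    show "t0 < p / (p - q) / s" "power_bound w (1 - p / (p - q))" "power_bound w ((p / (p - q) - 1) / (t0 - 1))"
      using t0 P1 P2 by (simp_all add: T_def)
    show "morrey_norm_lambda p r w = (\<lambda>f. SUP Q\<in>Collect is_cube. epowr (vol Q) (- e) * wLp_norm p (\<lambda>x. ennreal (w x)) Q f)"
      by (simp add: morrey_norm_lambda_def e_def fun_eq_iff)
    show "rvol (dilate c l 0) powr e \<le> (3 ^ ?n) powr e * rvol (cube c l) powr e"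
      if l: "0 < l" for c :: "real ^ 'n" and l
      by (simp add: measure_dilate[OF l] powr_mult)
    show "0 \<le> \<rho>" "\<rho> < 1" by fact+
    show "rvol (dilate c l k) powr (e * q) * 2 powr (k * ?n * (1 - 1 / s)) *
        (mass (cube c l) / mass (dilate c l k)) powr (q / p)
        \<le> ((3 powr ?n) powr (e * q) * Cm powr (q / p)) * \<rho> ^ k * rvol (cube c l) powr (e * q)"
      if l: "0 < l" for c l and k :: nat
    proof -
      let ?x = "mass (cube c l)" and ?y = "mass (dilate c l k)"
      let ?X = "rvol (cube c l)" and ?Y = "rvol (dilate c l k)"
      have xy: "0 < ?x" "0 < ?y" using l by (auto intro!: mass_pos is_cube_cube is_cube_dilate)
      have XY: "0 < ?X" "0 < ?Y" using l by (auto intro!: measure_cube_pos is_cube_cube is_cube_dilate)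
      have "?Y powr (e * q) = (?Y / ?X) powr (e * q) * ?X powr (e * q)" using XY by (simp add: powr_divide)
      also have "\<dots> \<le> (3 powr ?n * 2 powr (k * ?n)) powr (e * q) * ?X powr (e * q)"
        using e q XY dilate_ratio(2)[OF l, of c k] by (intro mult_right_mono powr_mono2) auto
      also have "\<dots> = (3 powr ?n) powr (e * q) * 2 powr (k * ?n * (e * q)) * ?X powr (e * q)"
        unfolding powr_mult powr_powr by simp
      finally have Y: "?Y powr (e * q) \<le> (3 powr ?n) powr (e * q) * 2 powr (k * ?n * (e * q)) * ?X powr (e * q)" .
      have y: "(?x / ?y) powr (q / p) \<le> Cm powr (q / p) * 2 powr (- (k * ?n * (1 - 1 / \<sigma>1)) * (q / p))"
        using powr_mono2[OF _ _ Cm(2)[OF l, of c k], of "q / p"] xy q Cm(1) by (simp add: powr_mult powr_powr)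
      have "?Y powr (e * q) * 2 powr (k * ?n * (1 - 1 / s)) * (?x / ?y) powr (q / p)
         \<le> ((3 powr ?n) powr (e * q) * 2 powr (k * ?n * (e * q)) * ?X powr (e * q)) * 2 powr (k * ?n * (1 - 1 / s)) *
            (Cm powr (q / p) * 2 powr (- (k * ?n * (1 - 1 / \<sigma>1)) * (q / p)))"
        by (intro mult_mono Y y) auto
      also have "\<dots> = ((3 powr ?n) powr (e * q) * Cm powr (q / p)) *
         (2 powr (k * ?n * (e * q)) * 2 powr (k * ?n * (1 - 1 / s)) * 2 powr (- (k * ?n * (1 - 1 / \<sigma>1)) * (q / p))) * ?X powr (e * q)"
        by (simp only: mult_ac)
      also have "2 powr (k * ?n * (e * q)) * 2 powr (k * ?n * (1 - 1 / s)) * 2 powr (- (k * ?n * (1 - 1 / \<sigma>1)) * (q / p)) = \<rho> ^ k"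
      proof -
        have "k * ?n * (e * q) + k * ?n * (1 - 1 / s) + - (k * ?n * (1 - 1 / \<sigma>1)) * (q / p) = k * d"
          using q \<sigma>1 s by (simp add: d_def e_def field_simps)
        moreover have "\<rho> ^ k = 2 powr (k * d)" by (simp add: \<rho>_def powr_realpow[symmetric] powr_powr mult.commute)
        ultimately show ?thesis unfolding powr_add[symmetric] by simp
      qed
      finally show ?thesis .
    qed
  qed (auto simp: emeasure_is_cube measure_cube_pos)
qed

text \<open>Test the maximal function at x with a cube of side 2|x| + 1 that contains both x and the
  unit cube. Its volume is at most a constant times (1+|x|)^n, and the power 1/s turns this into the
  exponent n/s.\<close>

lemma max_weight_lower_bound:
  assumes T: "0 < T" and s: "0 < s"
  shows "\<exists>h Q c. is_cube Q \<and> h \<in> unit_nonneg_Lp T w Q \<and> 0 < c \<and>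
     (\<forall>x. ennreal c * ennreal ((1 + norm x) powr (- (CARD('n) / s))) \<le> max_weight s h w Q x)"
proof -
  let ?n = "CARD('n)"
  define Q :: "(real ^ 'n) set" where "Q = cube 0 1"
  have Q: "is_cube Q" by (simp add: Q_def is_cube_cube)
  have Qs [measurable]: "Q \<in> sets lebesgue" by (simp add: Q_def)
  define k where "k = mass Q powr (- 1 / T)"
  have k: "0 < k" "k powr T = 1 / mass Q"
  proof -
    have "- 1 / T * T = - 1" using T by simp
    then have "k powr T = mass Q powr (- 1)" by (simp only: k_def powr_powr)
    then show "k powr T = 1 / mass Q" using mass_pos[OF Q] by (simp add: powr_minus_divide)
  qed (use mass_pos[OF Q] in \<open>simp add: k_def\<close>)
  define h where "h = (\<lambda>x :: real ^ 'n. k)"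
  have "(\<integral>\<^sup>+x\<in>Q. ennreal (norm (h x) powr T) * ennreal (w x) \<partial>lebesgue) = ennreal (k powr T) * wmeas w Q"
    using k by (simp add: h_def wmeas_def nn_integral_cmult[symmetric] mult.assoc)
  also have "\<dots> = ennreal (k powr T * mass Q)"
    unfolding wmeas_mass[OF Q] using mass_pos[OF Q] by (simp add: ennreal_mult)
  also have "\<dots> = 1" using mass_pos[OF Q] by (simp add: k)
  finally have "wLp_norm T (\<lambda>x. ennreal (w x)) Q h = 1" using T by (simp add: wLp_norm_def epowr_def)
  then have h: "h \<in> unit_nonneg_Lp T w Q" using k by (simp add: unit_nonneg_Lp_def h_def)
  define J where "J = ennreal (k powr s) * wmeas (\<lambda>x. w x powr s) Q"
  have "0 < J" unfolding J_def using wmeas_powr_pos[OF Q, of s] k by (simp add: ennreal_zero_less_mult_iff)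
  \<comment> \<open>J may be infinite; a positive real number below it is enough.\<close>
  then obtain j where j: "0 < j" "ennreal j \<le> J"
  proof (cases J)
    case (real r)
    then show ?thesis using \<open>0 < J\<close> that[of r] by auto
  next
    case top
    then show ?thesis using that[of 1] by simp
  qed
  define c where "c = (j / 2 ^ ?n) powr (1 / s)"
  have c: "0 < c" using j by (simp add: c_def)
  have "ennreal c * ennreal ((1 + norm x) powr (- (?n / s))) \<le> max_weight s h w Q x" for x
  proof -
    define R :: "(real ^ 'n) set" where "R = cube (\<chi> i. - norm x) (2 * norm x + 1)"
    have Rc: "is_cube R" unfolding R_def by (intro is_cube_cube) (simp add: add_nonneg_pos)
    have xR: "x \<in> R"
      unfolding R_def mem_cube
    proof
      fix i
      show "(\<chi> i. - norm x) $ i \<le> x $ i \<and> x $ i \<le> (\<chi> i. - norm x) $ i + (2 * norm x + 1)"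
        using component_le_norm_cart[of x i] by (auto simp: abs_le_iff)
    qed
    have QR: "Q \<subseteq> R"
    proof
      fix y assume y: "y \<in> Q"
      show "y \<in> R"
        unfolding R_def mem_cube
      proof
        fix i
        have "0 \<le> y $ i" "y $ i \<le> 1" using y by (auto simp: Q_def mem_cube)
        then show "(\<chi> i. - norm x) $ i \<le> y $ i \<and> y $ i \<le> (\<chi> i. - norm x) $ i + (2 * norm x + 1)"
          unfolding vec_lambda_beta using norm_ge_zero[of x] by linarith
      qed
    qed
    have vR: "vol R = ennreal ((2 * norm x + 1) ^ ?n)" unfolding R_def by (intro emeasure_cube) simp
    let ?g = "\<lambda>y. h y powr s * w y powr s * indicator Q y"
    have "(\<integral>\<^sup>+y\<in>R. ennreal \<bar>?g y\<bar> \<partial>lebesgue) = (\<integral>\<^sup>+y. ennreal (k powr s) * (ennreal (w y powr s) * indicator Q y) \<partial>lebesgue)"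
      using QR by (intro nn_integral_cong) (auto simp: h_def ennreal_mult split: split_indicator)
    also have "\<dots> = J" unfolding J_def wmeas_def by (rule nn_integral_cmult) measurable
    finally have "J / vol R \<le> maximal ?g x"
      unfolding maximal_def using Rc xR by (intro SUP_upper2[of R]) auto
    moreover have "ennreal (j / 2 ^ ?n * (1 + norm x) powr (- ?n)) \<le> J / vol R"
    proof -
      have "j / 2 ^ ?n * (1 + norm x) powr (- ?n) = j / (2 * (1 + norm x)) ^ ?n"
        unfolding power_mult_distrib by (simp add: powr_minus_divide powr_realpow add_pos_nonneg)
      also have "\<dots> \<le> j / (2 * norm x + 1) ^ ?n"
        using j by (intro divide_left_mono power_mono mult_pos_pos zero_less_power) (auto simp: add_nonneg_pos add_pos_nonneg)
      finally have "ennreal (j / 2 ^ ?n * (1 + norm x) powr (- ?n)) \<le> ennreal (j / (2 * norm x + 1) ^ ?n)"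
        by (rule ennreal_leI)
      also have "\<dots> = ennreal j / vol R"
        unfolding vR using j by (intro divide_ennreal[symmetric]) (auto simp: add_nonneg_pos)
      also have "\<dots> \<le> J / vol R" using j by (intro divide_right_mono_ennreal)
      finally show ?thesis .
    qed
    ultimately have "ennreal (j / 2 ^ ?n * (1 + norm x) powr (- ?n)) \<le> maximal ?g x" by (rule order_trans[rotated])
    then have "epowr (ennreal (j / 2 ^ ?n * (1 + norm x) powr (- ?n))) (1 / s) \<le> max_weight s h w Q x"
      unfolding max_weight_def using s by (intro epowr_mono) auto
    also have "epowr (ennreal (j / 2 ^ ?n * (1 + norm x) powr (- ?n))) (1 / s)
       = ennreal ((j / 2 ^ ?n * (1 + norm x) powr (- ?n)) powr (1 / s))"
      using s j by (intro epowr_ennreal) auto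
    also have "(j / 2 ^ ?n * (1 + norm x) powr (- ?n)) powr (1 / s) = c * (1 + norm x) powr (- (?n / s))"
      unfolding c_def powr_mult powr_powr by simp
    finally show ?thesis using c by (simp add: ennreal_mult)
  qed
  then show ?thesis using Q h c by blast
qed

end


section \<open>Choice of the exponents\<close>

theorem proposition3p8:
  fixes \<gamma> b p \<sigma> r :: real
    and w :: "real ^ 'n \<Rightarrow> real"
  assumes "1 \<le> \<gamma>" and "\<gamma> < b"
    and "\<gamma> < p" and "p < b"
    and "conj_exp (b / p) < \<sigma>"
    and "w \<in> muckenhoupt (p / \<gamma>) \<inter> reverse_holder \<sigma>"
    and "r \<in> {- real CARD('n) / p .. - real CARD('n) * conj_exp \<sigma> / b}"
  shows "\<exists>q\<^sub>0\<in>{\<gamma><..<p}. \<forall>q\<in>{\<gamma>..q\<^sub>0}.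
    (\<exists>s\<^sub>0>conj_exp (b / q). \<forall>s\<in>{conj_exp (b / q)<..s\<^sub>0}.
       (\<exists>C::real. \<forall>Q. is_cube Q \<longrightarrow> (\<forall>h\<in>unit_nonneg_Lp (conj_exp (p / q)) w Q.
          embeds_with (ennreal C * epowr (wmeas w Q) (1 / p + r / real CARD('n)))
            (morrey_norm p r w) (wLp_norm q (max_weight s h w Q) UNIV))) \<and>
       (r \<in> {- real CARD('n) / p .. - real CARD('n) / (p * \<sigma>) - real CARD('n) / b} \<longrightarrow>
         (\<exists>C::real. \<forall>Q. is_cube Q \<longrightarrow> (\<forall>h\<in>unit_nonneg_Lp (conj_exp (p / q)) w Q.
            embeds_with (ennreal C * epowr (vol Q) (1 / p + r / real CARD('n)))
              (morrey_norm_lambda p r w) (wLp_norm q (max_weight s h w Q) UNIV))))) \<and>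
    (\<exists>\<alpha>. 0 < \<alpha> \<and> \<alpha> < real CARD('n) / conj_exp (b / q) \<and>
       embeds (morrey_norm p r w) (wLp_norm q (\<lambda>x. ennreal ((1 + norm x) powr (- \<alpha>))) UNIV) \<and>
       (r \<in> {- real CARD('n) / p .. - real CARD('n) / (p * \<sigma>) - real CARD('n) / b} \<longrightarrow>
         embeds (morrey_norm_lambda p r w)
           (wLp_norm q (\<lambda>x. ennreal ((1 + norm x) powr (- \<alpha>))) UNIV)))"
proof -
  let ?n = "real CARD('n)"
  have wA: "w \<in> muckenhoupt (p / \<gamma>)" and wR: "w \<in> reverse_holder \<sigma>" using assms(6) by auto
  interpret positive_weight w by (rule positive_weight_muckenhoupt[OF wA])
  have g: "0 < \<gamma>" "0 < p" "0 < b" using assms(1-4) by auto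
  have \<sigma>: "b / (b - p) < \<sigma>" "1 < \<sigma>"
  proof -
    have "conj_exp (b / p) = b / (b - p)" using g assms(4) by (simp add: conj_exp_def field_simps)
    then show "b / (b - p) < \<sigma>" using assms(5) by simp
    moreover have "1 < b / (b - p)" using g assms(4) by (simp add: field_simps)
    ultimately show "1 < \<sigma>" by linarith
  qed
  define \<kappa> where "\<kappa> = \<gamma> / (p - \<gamma>)"
  have \<kappa>: "0 < \<kappa>" using g assms(3) by (simp add: \<kappa>_def)
  have P\<kappa>: "power_bound w (- \<kappa>)"
  proof -
    have "power_bound w (- 1 / (p / \<gamma> - 1))" using g assms(3) by (intro power_bound_muckenhoupt wA) simp
    also have "- 1 / (p / \<gamma> - 1) = - \<kappa>" using g assms(3) by (simp add: \<kappa>_def field_simps)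
    finally show ?thesis .
  qed
  have P\<sigma>: "power_bound w \<sigma>"
    using \<sigma> by (intro power_bound_reverse_holder wR positive_weight_axioms) simp
  obtain e where e: "0 < e" "power_bound w (\<sigma> * (1 + e))"
    using power_bound_improve[OF _ P\<kappa> P\<sigma>] \<sigma> \<kappa> by (auto simp: mult_less_0_iff)
  define \<sigma>1 where "\<sigma>1 = \<sigma> * (1 + e)"
  have \<sigma>1: "\<sigma> < \<sigma>1" "1 < \<sigma>1" "power_bound w \<sigma>1"
  proof -
    show "\<sigma> < \<sigma>1" using \<sigma> e by (simp add: \<sigma>1_def)
    then show "1 < \<sigma>1" using \<sigma> by linarith
  qed (use e in \<open>simp add: \<sigma>1_def\<close>)
  obtain \<delta> where \<delta>: "0 < \<delta>" "power_bound w (- \<kappa> * (1 + \<delta>))"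
    using power_bound_improve[OF _ P\<sigma> P\<kappa>] \<sigma> \<kappa> by (auto simp: mult_less_0_iff)
  define \<kappa>1 where "\<kappa>1 = \<kappa> * (1 + \<delta>)"
  have \<kappa>1: "\<kappa> < \<kappa>1" "0 < \<kappa>1" "power_bound w (- \<kappa>1)"
  proof -
    show "\<kappa> < \<kappa>1" using \<kappa> \<delta> by (simp add: \<kappa>1_def)
    then show "0 < \<kappa>1" using \<kappa> by linarith
  qed (use \<delta> in \<open>simp add: \<kappa>1_def\<close>)
  \<comment> \<open>The solution of q/(p-q) = \<open>\<kappa>1\<close>. Since T - 1 = q/(p-q)
    increases with q, the improved bound covers all q up to \<open>q0\<close>.\<close>
  define q0 where "q0 = p * \<kappa>1 / (1 + \<kappa>1)"
  have q0: "\<gamma> < q0" "q0 < p"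
  proof -
    have "\<gamma> < \<kappa>1 * (p - \<gamma>)" using \<kappa>1(1) assms(3) by (simp add: \<kappa>_def field_simps)
    then show "\<gamma> < q0" "q0 < p" using \<kappa>1(2) g by (simp_all add: q0_def field_simps)
  qed
  \<comment> \<open>This is 1/\<sigma>'. In terms of a, the assumption on \<sigma> reads p/b < a and
    the upper bound for r is -n/(ab).\<close>
  define a where "a = 1 - 1 / \<sigma>"
  define a1 where "a1 = 1 - 1 / \<sigma>1"
  have a: "p / b < a" "a < a1" "0 < a"
  proof -
    have "1 / \<sigma> < (b - p) / b" using \<sigma> g assms(4) by (simp add: field_simps)
    also have "(b - p) / b = 1 - p / b" using g by (simp add: field_simps)
    finally show "p / b < a" by (simp add: a_def)
    moreover have "0 < p / b" using g by simp
    ultimately show "0 < a" by linarith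
    show "a < a1" using \<sigma> \<sigma>1 by (simp add: a_def a1_def frac_less2)
  qed
  have r: "- ?n / p \<le> r" "r \<le> - ?n / (a * b)" "r < 0" "0 \<le> 1 / p + r / ?n"
  proof -
    have "conj_exp \<sigma> = 1 / a" using \<sigma> by (simp add: conj_exp_def a_def field_simps)
    then show 1: "- ?n / p \<le> r" "r \<le> - ?n / (a * b)" using assms(7) by auto
    have "0 < ?n / (a * b)" using a g by simp
    then show "r < 0" using 1 by simp
    show "0 \<le> 1 / p + r / ?n" using 1(1) g by (simp add: field_simps)
  qed
  define rc where "rc \<longleftrightarrow> r \<in> {- ?n / p .. - ?n / (p * \<sigma>) - ?n / b}"
  let ?M = "\<lambda>q C s h Q. embeds_with (ennreal C * epowr (wmeas w Q) (1 / p + r / ?n))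
    (morrey_norm p r w) (wLp_norm q (max_weight s h w Q) UNIV)"
  let ?L = "\<lambda>q C s h Q. embeds_with (ennreal C * epowr (vol Q) (1 / p + r / ?n))
    (morrey_norm_lambda p r w) (wLp_norm q (max_weight s h w Q) UNIV)"
  show ?thesis
  proof (intro bexI[of _ q0] ballI, goal_cases)
    case (1 q)
    have q: "0 < q" "q < p" "q \<le> q0" "q < b" using 1 q0 g assms(4) by auto
    define T where "T = p / (p - q)"
    have T: "1 < T" "1 / T = 1 - q / p" using q by (simp_all add: T_def field_simps)
    have cT: "conj_exp (p / q) = T" using q by (simp add: conj_exp_def T_def field_simps)
    define S where "S = b / (b - q)"
    have cS: "conj_exp (b / q) = S" using q by (simp add: conj_exp_def S_def field_simps)
    have S: "0 < S" "1 / S = 1 - q / b" "1 < S" using q by (simp_all add: S_def field_simps)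
    have P1: "power_bound w (1 - T)"
    proof -
      have "q \<le> \<kappa>1 * (p - q)" using q(3) \<kappa>1(2) by (simp add: q0_def field_simps)
      then have le: "q / (p - q) \<le> \<kappa>1" using q by (simp add: field_simps)
      have "q / (p - q) / \<kappa>1 \<le> 1" using le \<kappa>1(2) by (subst pos_divide_le_eq) auto
      moreover have "0 < q / (p - q) / \<kappa>1" using q \<kappa>1(2) by simp
      ultimately have "power_bound w (q / (p - q) / \<kappa>1 * - \<kappa>1)"
        by (intro power_bound_scale \<kappa>1(3))
      also have "q / (p - q) / \<kappa>1 * - \<kappa>1 = 1 - T" using \<kappa>1(2) q by (simp add: T_def field_simps)
      finally show ?thesis .
    qed
    \<comment> \<open>Chosen so that the second exponent in \<open>dyadic_max_bound\<close> is
      \<sigma>.\<close>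
    define t0 where "t0 = 1 + (T - 1) / \<sigma>"
    have t0: "1 < t0" "(T - 1) / (t0 - 1) = \<sigma>" using T \<sigma> by (simp_all add: t0_def)
    have P2: "power_bound w ((T - 1) / (t0 - 1))" unfolding t0 by (rule P\<sigma>)
    \<comment> \<open>Upper limits for 1 - 1/s: \<open>e1\<close> from t0 < T/s, \<open>e2\<close>
      and \<open>e3\<close> from the series for the w-mass and for the volume. The value 1 stands
      for no restriction by the second series. The lower limit is q/b = 1 - 1/S.\<close>
    define e1 where "e1 = 1 - t0 / T"
    define e2 where "e2 = - (q * r / ?n) * a1"
    define e3 where "e3 = (if rc then - (q * r / ?n) - q / (p * \<sigma>1) else 1)"
    have e1: "q / b < e1"
    proof -
      have "e1 = (1 - 1 / T) * a" using T \<sigma> by (simp add: e1_def t0_def a_def field_simps)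
      also have "\<dots> = q / p * a" by (simp add: T)
      finally have "e1 = q / p * a" .
      moreover have "q / p * (p / b) < q / p * a" using a q g by (intro mult_strict_left_mono) auto
      ultimately show ?thesis using g by simp
    qed
    have e2: "q / b < e2"
    proof -
      \<comment> \<open>At the right end of the range of r this is an equality, so strictness has to
        come from a < a1.\<close>
      have "q * ?n / (a * b) \<le> q * - r" using r(2) q mult_left_mono[of r "- ?n / (a * b)" q] by simp
      then have ge: "q / (a * b) \<le> - (q * r / ?n)" by (simp add: field_simps)
      have "q / b = q / (a * b) * a" using a by simp
      also have "\<dots> < q / (a * b) * a1" using a q g by (intro mult_strict_left_mono) auto
      also have "\<dots> \<le> e2" unfolding e2_def using ge a by (intro mult_right_mono) auto
      finally show ?thesis .
    qed
    have e3: "q / b < e3"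
    proof (cases rc)
      case True
      then have "r \<le> - ?n / (p * \<sigma>) - ?n / b" by (simp add: rc_def)
      then have "q * r / ?n \<le> q * (- ?n / (p * \<sigma>) - ?n / b) / ?n"
        using q by (intro divide_right_mono mult_left_mono) auto
      also have "\<dots> = - (q / (p * \<sigma>)) - q / b" by (simp add: field_simps)
      finally have "q / (p * \<sigma>) + q / b \<le> - (q * r / ?n)" by simp
      \<comment> \<open>Again the improved exponent provides strictness at the end of the
        range.\<close>
      moreover have "q / (p * \<sigma>1) < q / (p * \<sigma>)"
        using \<sigma>1 \<sigma> g q by (intro divide_strict_left_mono mult_strict_left_mono mult_pos_pos) auto
      ultimately show ?thesis using True by (simp add: e3_def)
    next
      case False
      then show ?thesis using q by (simp add: e3_def)
    qed
    obtain E where E: "q / b < E" "E < e1" "E < e2" "E < e3"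
      using dense[of "q / b" "min e1 (min e2 e3)"] e1 e2 e3 by auto
    have E1: "E < 1" using E(2) T t0 by (simp add: e1_def) (smt (verit) divide_pos_pos)
    \<comment> \<open>Solves 1 - 1/s = E, so all upper limits hold for s up to
      \<open>s0\<close>.\<close>
    define s0 where "s0 = 1 / (1 - E)"
    have s0: "S < s0"
    proof -
      have "S = 1 / (1 - q / b)" unfolding S(2)[symmetric] by simp
      also have "\<dots> < s0" unfolding s0_def using E E1 by (intro divide_strict_left_mono) auto
      finally show ?thesis .
    qed
    have conds: "1 \<le> s" "t0 < T / s" "?n * (1 - 1 / s) + q * r * (1 - 1 / \<sigma>1) < 0"
        "rc \<Longrightarrow> ?n * (1 - 1 / s) + q * r + ?n * q / (p * \<sigma>1) < 0"
      if s: "s \<in> {S<..s0}" for s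
    proof -
      show 1: "1 \<le> s" using s S by auto
      have "1 / s0 \<le> 1 / s" using s 1 by (intro divide_left_mono) auto
      then have sE: "1 - 1 / s \<le> E" using E1 by (simp add: s0_def)
      have "t0 / T < 1 / s" using sE E(2) by (simp add: e1_def)
      then show "t0 < T / s" using T by (simp add: field_simps)
      have "?n * (1 - 1 / s) < ?n * e2" using sE E by (intro mult_strict_left_mono) auto
      also have "?n * e2 = - (q * r * (1 - 1 / \<sigma>1))" by (simp add: e2_def a1_def)
      finally show "?n * (1 - 1 / s) + q * r * (1 - 1 / \<sigma>1) < 0" by simp
      show "?n * (1 - 1 / s) + q * r + ?n * q / (p * \<sigma>1) < 0" if rc
      proof -
        have "?n * (1 - 1 / s) < ?n * e3" using sE E by (intro mult_strict_left_mono) auto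
        also have "?n * e3 = - (q * r) - ?n * q / (p * \<sigma>1)" using that by (simp add: e3_def right_diff_distrib)
        finally show ?thesis by simp
      qed
    qed
    have mass: "\<exists>C::real. \<forall>Q. is_cube Q \<longrightarrow> (\<forall>h\<in>unit_nonneg_Lp T w Q.
          ?M q C s h Q)" if s: "s \<in> {S<..s0}" for s
      unfolding T_def
      by (rule embedding_mass[OF q(1,2) conds(1)[OF s] t0(1) conds(2)[OF s, unfolded T_def]
            P1[unfolded T_def] P2[unfolded T_def] \<sigma>1(3,2) r(3,4) conds(3)[OF s]])
    have lambda: "\<exists>C::real. \<forall>Q. is_cube Q \<longrightarrow> (\<forall>h\<in>unit_nonneg_Lp T w Q.
          ?L q C s h Q)" if s: "s \<in> {S<..s0}" and rc: rc for s
      unfolding T_def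
      by (rule embedding_lambda[OF q(1,2) conds(1)[OF s] t0(1) conds(2)[OF s, unfolded T_def]
            P1[unfolded T_def] P2[unfolded T_def] \<sigma>1(3,2) r(4) conds(4)[OF s rc]])
    \<comment> \<open>The decay exponent of the lower bound for s = \<open>s0\<close>; it is below
      n/S because \<open>s0\<close> exceeds S.\<close>
    define \<alpha> where "\<alpha> = ?n / s0"
    have s0in: "s0 \<in> {S<..s0}" "0 < s0" using s0 S by auto
    have \<alpha>: "0 < \<alpha>" "\<alpha> < ?n / S" using s0 S by (auto simp: \<alpha>_def intro!: divide_strict_left_mono)
    obtain h Q c where Q: "is_cube Q" and h: "h \<in> unit_nonneg_Lp T w Q" and c: "0 < c"
      and low: "\<And>x. ennreal c * ennreal ((1 + norm x) powr (- \<alpha>)) \<le> max_weight s0 h w Q x"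
      using max_weight_lower_bound[of T s0] T s0in unfolding \<alpha>_def by auto
    have U: "(\<lambda>x :: real ^ 'n. ennreal ((1 + norm x) powr (- \<alpha>))) \<in> borel_measurable lebesgue"
      by (intro measurable_completion) measurable
    have "embeds (morrey_norm p r w) (wLp_norm q (\<lambda>x. ennreal ((1 + norm x) powr (- \<alpha>))) UNIV)"
    proof -
      obtain C :: real where "?M q C s0 h Q"
        using mass[OF s0in(1)] Q h by blast
      then have "embeds_with (ennreal (C * mass Q powr (1 / p + r / ?n)))
            (morrey_norm p r w) (wLp_norm q (max_weight s0 h w Q) UNIV)"
        by (simp add: wmeas_mass[OF Q] epowr_ennreal_pos[OF mass_pos[OF Q]] ennreal_mult'')
      from embeds_smaller_weight[OF q(1) c this U low] show ?thesis .
    qed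
    moreover have "embeds (morrey_norm_lambda p r w) (wLp_norm q (\<lambda>x. ennreal ((1 + norm x) powr (- \<alpha>))) UNIV)" if rc: rc
    proof -
      obtain C :: real where "?L q C s0 h Q"
        using lambda[OF s0in(1) rc] Q h by blast
      then have "embeds_with (ennreal (C * rvol Q powr (1 / p + r / ?n)))
            (morrey_norm_lambda p r w) (wLp_norm q (max_weight s0 h w Q) UNIV)"
        by (simp add: emeasure_is_cube[OF Q] epowr_ennreal_pos[OF measure_cube_pos[OF Q]] ennreal_mult'')
      from embeds_smaller_weight[OF q(1) c this U low] show ?thesis .
    qed
    ultimately show ?case
      unfolding cS cT rc_def[symmetric] using s0 mass lambda \<alpha> by blast
  next
    case 2
    then show ?case using q0 by auto
  qed
qed

end
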